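(* Let $\operatorname{Re}(y)>0$ and $\operatorname{Re}(a)>-1$. Then $$\sum_{n=1}^\infty\sigma_a(n)e^{-ny}+\frac12\left(\left(\frac{2\pi}{y}\right)^{1+a}\operatorname{cosec}\left(\frac{\pi a}{2}\right)+1\right)\zeta(-a)-\frac1y\zeta(1-a)$$ $$=\frac{2\pi}{y\sin\left(\frac{\pi a}{2}\right)}\sum_{n=1}^\infty\sigma_a(n)\left(\frac{(2\pi n)^{-a}}{\Gamma(1-a)}{}_1F_2\!\left(1;\frac{1-a}{2},1-\frac a2;\frac{4\pi^4n^2}{y^2}\right)-\left(\frac{2\pi}{y}\right)^a\cosh\left(\frac{4\pi^2n}{y}\right)\right).$$
   Context: $\sigma_a(n)=\sum_{d\mid n}d^a$, $\zeta$ is the Riemann zeta function, and ${}_1F_2$ is the generalized hypergeometric series. *)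

theory Defs
  imports "HOL-Complex_Analysis.Complex_Analysis"
begin

text \<open>
  The Riemann zeta function: the unique analytic continuation of the Dirichlet series to the
  complex plane without 1. The value at the pole 1 is fixed to be 0, only in order that the
  description determines a total function.
\<close>

definition is_zeta :: "(complex \<Rightarrow> complex) \<Rightarrow> bool" where
  "is_zeta f \<longleftrightarrow> f holomorphic_on (- {1}) \<and>
     (\<forall>s. Re s > 1 \<longrightarrow> f s = (\<Sum>n. 1 / of_nat (Suc n) powr s)) \<and> f 1 = 0"

definition zeta :: "complex \<Rightarrow> complex" where
  "zeta = (THE f. is_zeta f)"

definition divisor_sigma :: "complex \<Rightarrow> nat \<Rightarrow> complex" where
  "divisor_sigma a n = (\<Sum>d | d dvd n. of_nat d powr a)"

definition hypergeo_1F2 :: "complex \<Rightarrow> complex \<Rightarrow> complex \<Rightarrow> complex \<Rightarrow> complex" where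
  "hypergeo_1F2 a b c z = eval_fps (fps_hypergeo [a] [b, c] 1) z"

text \<open>
  The parameter a comes last in the following three functions because the identity has removable
  singularities exactly at a = 0, 1, 2, ... (in the region Re a > -1) and is read there as a limit
  in a. At even a the factor itself has a pole, so the limit is taken of factor times term.
\<close>

definition zeta_part :: "complex \<Rightarrow> complex \<Rightarrow> complex" where
  "zeta_part y a =
     1 / 2 * ((2 * of_real pi / y) powr (1 + a) * (1 / sin (of_real pi * a / 2)) + 1) * zeta (- a)
     - 1 / y * zeta (1 - a)"

definition rhs_factor :: "complex \<Rightarrow> complex \<Rightarrow> complex" where
  "rhs_factor y a = 2 * of_real pi / (y * sin (of_real pi * a / 2))"

definition rhs_term :: "complex \<Rightarrow> nat \<Rightarrow> complex \<Rightarrow> complex" where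
  "rhs_term y n a = divisor_sigma a n *
     ((2 * of_real pi * of_nat n) powr (- a) / Gamma (1 - a) *
        hypergeo_1F2 1 ((1 - a) / 2) (1 - a / 2) (4 * of_real pi ^ 4 * of_nat n ^ 2 / y ^ 2)
      - (2 * of_real pi / y) powr a * cosh (4 * of_real pi ^ 2 * of_nat n / y))"

end

(*
  Expanding 1 / (exp (d y) - 1) in partial fractions writes the left-hand side, for -2 < Re a < -1,
  as a series over m of lattice defects: the sum over d of d^(a+1) / (d^2 + (m w)^2), where
  w = 2 pi / y, minus the corresponding integral. Euler-Maclaurin type bounds show that this series
  converges locally uniformly for -2 < Re a < 0, which continues the identity across Re a = -1.
  For -1 < Re a < 0 every defect is in turn the sum over k of a kernel at 2 pi m w k, and the kernel
  is the combination of 1F2 and cosh divided by sin(pi a / 2). Collecting the terms with m k = n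
  yields the divisor sums. Since the kernel is holomorphic in a for Re a > -2 and decays like n^(-2 - Re a),
  the resulting series is holomorphic for Re a > -1, and the identity extends by continuation. At the
  non-negative integers a both sides are limits.
*)

theory Submission
  imports Defs
begin

section \<open>Integrals and series depending on a parameter\<close>

text \<open>The obstacle is cancellation: the hypergeometric part and the cosh of one summand both
  grow exponentially in n, only their difference decays, so no estimate can treat them apart. An
  exact formula for the difference is derived instead: a Laplace integral plus a multiple of exp
  (-x). On the natural ray that integral can meet its pole, so the ray is tilted by an auxiliary Z
  with Im Z < 0; the branch of the logarithm of -Z then determines the multiple of exp (-x). The
  ranges of a have separate causes. The Dirichlet series of zeta (-a) needs Re a < -1. The integral
  in a lattice defect needs Re a > -2 at the origin and Re a < 0 at infinity. The decay of the
  kernel, weighted with sigma_a, needs Re a > -1. The first and the last range are disjoint, which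
  is why the lattice defects have to be controlled on both sides of Re a = -1; the point a = -1
  itself is left out on the way because zeta (-a) has its pole there.\<close>

lemma has_field_derivative_integral_dominated:
  fixes f :: "complex \<Rightarrow> 'a \<Rightarrow> complex"
  assumes r: "r > 0"
    and hol: "\<And>u. u \<in> space M \<Longrightarrow> (\<lambda>z. f z u) holomorphic_on ball z0 r"
    and meas: "\<And>z. z \<in> ball z0 r \<Longrightarrow> f z \<in> borel_measurable M"
    and h: "integrable M h"
    and bound: "\<And>z u. z \<in> ball z0 r \<Longrightarrow> u \<in> space M \<Longrightarrow> norm (f z u) \<le> h u"
  shows "((\<lambda>z. \<integral>u. f z u \<partial>M) has_field_derivative (\<integral>u. deriv (\<lambda>z. f z u) z0 \<partial>M)) (at z0)"
proof -
  have int: "integrable M (f z)" if "z \<in> ball z0 r" for z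
  proof (rule Bochner_Integration.integrable_bound[OF h meas[OF that]])
    show "AE u in M. norm (f z u) \<le> norm (h u)"
      using bound[OF that] by (intro AE_I2) (force intro: order_trans)
  qed
  have z0: "z0 \<in> ball z0 r" using r by simp
  \<comment> \<open>Cauchy's inequality on discs of radius r / 3 around points of the smaller ball
    bounds the derivative by \<open>3 * h u / r\<close>. So the difference quotients inherit an
    integrable majorant from \<open>f\<close> itself.\<close>
  have lip: "norm (f z u - f z0 u) \<le> 3 * h u / r * norm (z - z0)"
    if z: "z \<in> ball z0 (r/3)" and u: "u \<in> space M" for z u
  proof (rule field_differentiable_bound[of "ball z0 (r/3)" "\<lambda>z. f z u" "deriv (\<lambda>z. f z u)"])
    show "convex (ball z0 (r/3))" by simp
    show "z \<in> ball z0 (r/3)" "z0 \<in> ball z0 (r/3)" using z r by auto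
  next
    fix w assume w: "w \<in> ball z0 (r/3)"
    hence "w \<in> ball z0 r" using r by auto
    thus "((\<lambda>z. f z u) has_field_derivative deriv (\<lambda>z. f z u) w) (at w within ball z0 (r/3))"
      by (intro has_field_derivative_at_within[OF holomorphic_derivI[OF hol[OF u] open_ball]])
    have sub: "cball w (r/3) \<subseteq> ball z0 r"
    proof
      fix v assume "v \<in> cball w (r/3)"
      thus "v \<in> ball z0 r" using w r dist_triangle[of z0 v w] by auto
    qed
    have "norm ((deriv ^^ 1) (\<lambda>z. f z u) w) \<le> fact 1 * h u / (r/3) ^ 1"
    proof (rule Cauchy_inequality)
      show "(\<lambda>z. f z u) holomorphic_on ball w (r/3)"
        using sub by (intro holomorphic_on_subset[OF hol[OF u]]) auto
      show "continuous_on (cball w (r/3)) (\<lambda>z. f z u)"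
        using sub by (intro holomorphic_on_imp_continuous_on holomorphic_on_subset[OF hol[OF u]]) auto
      show "0 < r / 3" using r by simp
      fix x assume "norm (w - x) = r/3"
      hence "x \<in> cball w (r/3)" by (auto simp: dist_norm)
      thus "norm (f x u) \<le> h u" using sub bound u by blast
    qed
    thus "norm (deriv (\<lambda>z. f z u) w) \<le> 3 * h u / r" by (simp add: mult.commute)
  qed
  have "((\<lambda>z. ((\<integral>u. f z u \<partial>M) - (\<integral>u. f z0 u \<partial>M)) / (z - z0)) \<longlongrightarrow> (\<integral>u. deriv (\<lambda>z. f z u) z0 \<partial>M)) (at z0)"
  proof (subst tendsto_at_iff_sequentially, intro allI impI)
    fix X :: "nat \<Rightarrow> complex"
    assume X: "\<forall>i. X i \<in> UNIV - {z0}" and lim: "X \<longlonglongrightarrow> z0"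
    from lim r have "eventually (\<lambda>n. X n \<in> ball z0 (r/3)) sequentially"
      by (intro topological_tendstoD) auto
    then obtain N where N: "\<And>n. n \<ge> N \<Longrightarrow> X n \<in> ball z0 (r/3)"
      by (auto simp: eventually_sequentially)
    \<comment> \<open>Dropping the first \<open>N\<close> terms keeps the whole sequence in the
      small ball, where the Lipschitz bound holds; \<open>LIMSEQ_offset\<close> restores them at the
      end.\<close>
    define Y where "Y n = X (n + N)" for n
    have Y: "Y n \<in> ball z0 (r/3)" "Y n \<noteq> z0" for n using N X by (auto simp: Y_def)
    have Y': "Y n \<in> ball z0 r" for n using Y(1)[of n] r by auto
    have limY: "Y \<longlonglongrightarrow> z0" unfolding Y_def using lim by (rule LIMSEQ_ignore_initial_segment)
    have tends: "(\<lambda>n. (f (Y n) u - f z0 u) / (Y n - z0)) \<longlonglongrightarrow> deriv (\<lambda>z. f z u) z0" if u: "u \<in> space M" for u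
    proof -
      have "((\<lambda>z. f z u) has_field_derivative deriv (\<lambda>z. f z u) z0) (at z0)"
        using holomorphic_derivI[OF hol[OF u] _ z0] by simp
      hence "((\<lambda>z. (f z u - f z0 u) / (z - z0)) \<longlongrightarrow> deriv (\<lambda>z. f z u) z0) (at z0)"
        by (simp add: has_field_derivative_iff)
      thus ?thesis
        using Y limY by (simp add: tendsto_at_iff_sequentially o_def)
    qed
    have m: "(\<lambda>u. (f (Y n) u - f z0 u) / (Y n - z0)) \<in> borel_measurable M" for n
      using meas[OF Y'] meas[OF z0] by measurable
    have "(\<lambda>n. \<integral>u. (f (Y n) u - f z0 u) / (Y n - z0) \<partial>M) \<longlonglongrightarrow> (\<integral>u. deriv (\<lambda>z. f z u) z0 \<partial>M)"
    proof (rule integral_dominated_convergence[where w = "\<lambda>u. 3 / r * h u"])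
      show "(\<lambda>u. deriv (\<lambda>z. f z u) z0) \<in> borel_measurable M"
        by (rule borel_measurable_LIMSEQ_metric[OF m tends])
      show "integrable M (\<lambda>u. 3 / r * h u)" using h by simp
      show "AE u in M. (\<lambda>n. (f (Y n) u - f z0 u) / (Y n - z0)) \<longlonglongrightarrow> deriv (\<lambda>z. f z u) z0"
        using tends by (intro AE_I2)
      fix n
      show "AE u in M. norm ((f (Y n) u - f z0 u) / (Y n - z0)) \<le> 3 / r * h u"
        using lip[OF Y(1)] Y(2) by (intro AE_I2) (auto simp: norm_divide field_simps)
    qed (use m in auto)
    also have "(\<lambda>n. \<integral>u. (f (Y n) u - f z0 u) / (Y n - z0) \<partial>M) =
        (\<lambda>n. ((\<integral>u. f (Y n) u \<partial>M) - (\<integral>u. f z0 u \<partial>M)) / (Y n - z0))"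
      using int[OF Y'] int[OF z0] by (simp add: Bochner_Integration.integral_diff)
    finally show "((\<lambda>z. ((\<integral>u. f z u \<partial>M) - (\<integral>u. f z0 u \<partial>M)) / (z - z0)) \<circ> X) \<longlonglongrightarrow> (\<integral>u. deriv (\<lambda>z. f z u) z0 \<partial>M)"
      unfolding Y_def o_def by (rule LIMSEQ_offset)
  qed
  thus ?thesis by (simp add: has_field_derivative_iff)
qed

lemma holomorphic_on_integral_dominated:
  fixes f :: "complex \<Rightarrow> 'a \<Rightarrow> complex"
  assumes S: "open S"
    and hol: "\<And>u. u \<in> space M \<Longrightarrow> (\<lambda>z. f z u) holomorphic_on S"
    and meas: "\<And>z. z \<in> S \<Longrightarrow> f z \<in> borel_measurable M"
    and bound: "\<And>z0. z0 \<in> S \<Longrightarrow> \<exists>r>0. \<exists>h. integrable M h \<and>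
        (\<forall>z\<in>ball z0 r \<inter> S. \<forall>u\<in>space M. norm (f z u) \<le> h u)"
  shows "(\<lambda>z. \<integral>u. f z u \<partial>M) holomorphic_on S"
  unfolding holomorphic_on_def
proof
  fix z0 assume z0: "z0 \<in> S"
  from bound[OF z0] obtain r h where r: "r > 0" "integrable M h"
    "\<And>z u. z \<in> ball z0 r \<Longrightarrow> z \<in> S \<Longrightarrow> u \<in> space M \<Longrightarrow> norm (f z u) \<le> h u" by blast
  obtain s where s: "s > 0" "ball z0 s \<subseteq> S" using S z0 open_contains_ball by blast
  have "((\<lambda>z. \<integral>u. f z u \<partial>M) has_field_derivative (\<integral>u. deriv (\<lambda>z. f z u) z0 \<partial>M)) (at z0)"
  proof (rule has_field_derivative_integral_dominated[of "min r s", OF _ _ _ r(2)])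
    show "(\<lambda>z. f z u) holomorphic_on ball z0 (min r s)" if "u \<in> space M" for u
      by (rule holomorphic_on_subset[OF hol[OF that]]) (use s(2) in auto)
  qed (use r s meas in auto)
  thus "(\<lambda>z. \<integral>u. f z u \<partial>M) field_differentiable at z0 within S"
    using field_differentiable_at_within field_differentiable_def by blast
qed

text \<open>Weierstrass M-test and locally uniform limits. The majorant may start at an index that
  depends on the point, because reciprocal Gamma values are controlled only after their argument has
  moved far enough to the right.\<close>

lemma holomorphic_on_suminf:
  fixes f :: "nat \<Rightarrow> complex \<Rightarrow> complex"
  assumes S: "open S"
    and hol: "\<And>n. f n holomorphic_on S"
    and bound: "\<And>z0. z0 \<in> S \<Longrightarrow> \<exists>r>0. \<exists>M N. summable M \<and>
        (\<forall>z\<in>ball z0 r \<inter> S. \<forall>n\<ge>N. norm (f n z) \<le> M n)"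
  shows "(\<lambda>z. \<Sum>n. f n z) holomorphic_on S"
proof (rule holomorphic_uniform_sequence[OF S, where f = "\<lambda>N z. \<Sum>n<N. f n z"])
  show "(\<lambda>z. \<Sum>n<N. f n z) holomorphic_on S" for N
    by (intro holomorphic_intros hol)
next
  fix z0 assume z0: "z0 \<in> S"
  from bound[OF z0] obtain r M N where r: "r > 0" "summable M"
    "\<And>z n. z \<in> ball z0 r \<Longrightarrow> z \<in> S \<Longrightarrow> n \<ge> N \<Longrightarrow> norm (f n z) \<le> M n" by blast
  obtain s where s: "s > 0" "ball z0 s \<subseteq> S" using S z0 open_contains_ball by blast
  define d where "d = min r s / 2"
  have d: "d > 0" "cball z0 d \<subseteq> ball z0 r" "cball z0 d \<subseteq> S"
    using r s by (auto simp: d_def)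
  have "uniform_limit (cball z0 d) (\<lambda>n z. \<Sum>i<n. f i z) (\<lambda>z. suminf (\<lambda>i. f i z)) sequentially"
  proof (rule Weierstrass_m_test_ev[of _ _ M])
    show "\<forall>\<^sub>F n in sequentially. \<forall>z\<in>cball z0 d. norm (f n z) \<le> M n"
      unfolding eventually_sequentially using r(3) d by blast
  qed (rule r(2))
  with d show "\<exists>d>0. cball z0 d \<subseteq> S \<and>
       uniform_limit (cball z0 d) (\<lambda>N z. \<Sum>n<N. f n z) (\<lambda>z. \<Sum>n. f n z) sequentially" by blast
qed

section \<open>Lebesgue integrals over the positive half-line and Euler's Gamma integral\<close>

abbreviation pos_lborel :: "real measure" where
  "pos_lborel \<equiv> restrict_space lborel {0<..}"

lemma borel_measurable_pos_lborel:
  "continuous_on {0<..} f \<Longrightarrow> f \<in> borel_measurable pos_lborel"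
  using borel_measurable_continuous_on_restrict[of "{0<..}" f]
  by (simp cong: measurable_cong_sets sets_restrict_space_cong)

text \<open>This geometric series appears as the weight in the integral for zeta, as the sum over k
  of the kernels, and as the inner sum of the Lambert series.\<close>

lemma sums_exp_minus:
  fixes z :: complex
  assumes "Re z > 0"
  shows "(\<lambda>k. exp (- (of_nat (Suc k) * z))) sums (1 / (exp z - 1))"
    and "summable (\<lambda>k. norm (exp (- (of_nat (Suc k) * z))))"
proof -
  define q where "q = exp (- z)"
  have q: "norm q < 1" "q \<noteq> 0" using assms by (auto simp: q_def)
  have qk: "q * q ^ k = exp (- (of_nat (Suc k) * z))" for k
    unfolding q_def by (simp add: exp_of_nat_mult [symmetric] exp_add [symmetric] algebra_simps)
  have "(\<lambda>k. q * q ^ k) sums (q * (1 / (1 - q)))" using q by (intro sums_mult geometric_sums)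
  moreover have "q * (1 / (1 - q)) = 1 / (exp z - 1)"
  proof -
    have "exp z * q = 1" by (simp add: q_def exp_minus)
    moreover have "exp z \<noteq> 1" "q \<noteq> 1" using q calculation by auto
    ultimately show ?thesis by (simp add: divide_simps) (simp add: algebra_simps)
  qed
  ultimately show "(\<lambda>k. exp (- (of_nat (Suc k) * z))) sums (1 / (exp z - 1))" by (simp only: qk)
  show "summable (\<lambda>k. norm (exp (- (of_nat (Suc k) * z))))"
    unfolding qk[symmetric] norm_mult norm_power using q by (intro summable_mult summable_geometric) auto
qed

text \<open>Integrability of powers near 0 and near infinity comes from the gauge integral, which
  lives on the completed measure; Borel measurability brings it back to
  \<open>lborel\<close>.\<close>

lemma integrable_pos_lborel_indicator:
  fixes f :: "real \<Rightarrow> real"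
  assumes "f absolutely_integrable_on A" "f \<in> borel_measurable borel" "A \<in> sets borel" "A \<subseteq> {0<..}"
  shows "integrable pos_lborel (\<lambda>u. indicator A u * f u)"
proof -
  have "integrable lebesgue (\<lambda>u. indicator A u *\<^sub>R f u)" using assms(1) by (simp add: set_integrable_def)
  hence "integrable lborel (\<lambda>u. indicator A u *\<^sub>R f u)"
    by (subst (asm) integrable_completion) (use assms in auto)
  moreover have "(\<lambda>u. indicator A u *\<^sub>R f u) = (\<lambda>u. indicat_real {0<..} u *\<^sub>R (indicator A u * f u))"
    using assms(4) by (intro ext) (auto split: split_indicator)
  ultimately have "integrable lborel (\<lambda>u. indicat_real {0<..} u *\<^sub>R (indicator A u * f u))" by (simp only:)
  thus ?thesis by (simp add: integrable_restrict_space)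
qed

lemma integral_pos_lborel_scale:
  fixes f :: "real \<Rightarrow> 'b::euclidean_space"
  assumes c: "c > 0"
  shows "(\<integral>u. f (c * u) \<partial>pos_lborel) = (\<integral>u. f u \<partial>pos_lborel) /\<^sub>R c"
proof -
  have eq: "indicat_real {0<..} (c * x) = indicat_real {0<..} x" for x
    using c by (auto simp: indicator_def zero_less_mult_iff)
  have "(\<integral>u. f u \<partial>pos_lborel) = (\<integral>u. indicat_real {0<..} u *\<^sub>R f u \<partial>lborel)"
    by (simp add: integral_restrict_space)
  also have "\<dots> = c *\<^sub>R (\<integral>u. indicat_real {0<..} (c * u) *\<^sub>R f (c * u) \<partial>lborel)"
    using c by (subst lborel_integral_real_affine[of c _ 0]) auto
  also have "\<dots> = c *\<^sub>R (\<integral>u. f (c * u) \<partial>pos_lborel)"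
    by (simp add: integral_restrict_space eq)
  finally show ?thesis using c by simp
qed

lemma integrable_pos_lborel_scale:
  fixes f :: "real \<Rightarrow> 'b::euclidean_space"
  assumes c: "c > 0" and f: "integrable pos_lborel f"
  shows "integrable pos_lborel (\<lambda>u. f (c * u))"
proof -
  have eq: "indicat_real {0<..} (c * x) = indicat_real {0<..} x" for x
    using c by (auto simp: indicator_def zero_less_mult_iff)
  have "integrable lborel (\<lambda>u. indicat_real {0<..} u *\<^sub>R f u)"
    using f by (simp add: integrable_restrict_space)
  from lborel_integrable_real_affine[OF this, of c 0] c show ?thesis
    by (simp add: integrable_restrict_space eq)
qed

lemma Gamma_integral_pos_lborel:
  assumes s: "Re s > 0"
  shows "integrable pos_lborel (\<lambda>u. of_real u powr (s - 1) * exp (- of_real u))" (is "integrable _ ?f")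
    and "(\<integral>u. of_real u powr (s - 1) * exp (- of_real u) \<partial>pos_lborel) = Gamma s"
proof -
  have eq: "?f u = of_real u powr (s - 1) / of_real (exp u)" for u
    by (simp add: exp_minus exp_of_real field_simps)
  have int: "?f absolutely_integrable_on {0<..}"
    using absolutely_integrable_Gamma_integral'[OF s] by (simp only: eq)
  have meas: "?f \<in> borel_measurable pos_lborel"
    by (intro borel_measurable_pos_lborel continuous_intros) auto
  hence meas': "(\<lambda>u. indicat_real {0<..} u *\<^sub>R ?f u) \<in> borel_measurable lborel"
    by (subst (asm) borel_measurable_restrict_space_iff) auto
  have "integrable lebesgue (\<lambda>u. indicat_real {0<..} u *\<^sub>R ?f u)"
    using int by (simp add: set_integrable_def)
  hence *: "integrable lborel (\<lambda>u. indicat_real {0<..} u *\<^sub>R ?f u)"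
    using meas' by (simp add: integrable_completion)
  thus "integrable pos_lborel ?f" by (simp add: integrable_restrict_space)
  have "(\<integral>u. ?f u \<partial>pos_lborel) = integral\<^sup>L lebesgue (\<lambda>u. indicat_real {0<..} u *\<^sub>R ?f u)"
    using meas' by (simp add: integral_restrict_space integral_completion)
  also have "\<dots> = integral {0<..} ?f"
    using set_lebesgue_integral_eq_integral(2)[OF int] by (simp add: set_lebesgue_integral_def)
  also have "\<dots> = Gamma s"
    using Gamma_integral_complex'[OF s] by (simp only: eq integral_unique)
  finally show "(\<integral>u. ?f u \<partial>pos_lborel) = Gamma s" .
qed

text \<open>A positive real factor changes only the real part of the logarithm, so no branch
  correction arises, as it can for two complex factors.\<close>

lemma powr_mult_of_real:
  fixes s z :: complex
  assumes "c > 0"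
  shows "(of_real c * z) powr s = of_real c powr s * z powr s"
proof (cases "z = 0")
  case False
  have "Ln (of_real c * z) = of_real (ln c) + Ln z"
    using assms False by (simp add: Ln_times_of_real Ln_of_real)
  thus ?thesis using assms False by (simp add: powr_def Ln_of_real ring_distribs exp_add)
qed auto

lemma Gamma_integral_real_scale:
  assumes s: "Re s > 0" and c: "c > 0"
  shows "integrable pos_lborel (\<lambda>u. of_real u powr (s - 1) * exp (- (of_real c * of_real u)))"
    and "(\<integral>u. of_real u powr (s - 1) * exp (- (of_real c * of_real u)) \<partial>pos_lborel) = Gamma s * of_real c powr (- s)"
proof -
  have eq: "of_real u powr (s - 1) * exp (- (of_real c * of_real u)) =
      of_real c powr (1 - s) * (of_real (c * u) powr (s - 1) * exp (- of_real (c * u)))" for u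
    using c by (simp add: powr_mult_of_real powr_diff field_simps)
  show "integrable pos_lborel (\<lambda>u. of_real u powr (s - 1) * exp (- (of_real c * of_real u)))"
    unfolding eq using integrable_pos_lborel_scale[OF c Gamma_integral_pos_lborel(1)[OF s]] by simp
  show "(\<integral>u. of_real u powr (s - 1) * exp (- (of_real c * of_real u)) \<partial>pos_lborel) = Gamma s * of_real c powr (- s)"
  proof -
    define g :: "real \<Rightarrow> complex" where "g u = of_real u powr (s - 1) * exp (- of_real u)" for u
    have "(\<integral>u. of_real c powr (1 - s) * g (c * u) \<partial>pos_lborel) = of_real c powr (1 - s) * (Gamma s /\<^sub>R c)"
      using integral_pos_lborel_scale[OF c, of g] Gamma_integral_pos_lborel(2)[OF s]
      unfolding g_def by simp
    also have "\<dots> = Gamma s * of_real c powr (- s)"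
      using c by (simp add: scaleR_conv_of_real powr_diff powr_minus field_simps)
    finally show ?thesis unfolding eq g_def .
  qed
qed

lemma Gamma_integral_powr_exp:
  fixes \<alpha> c :: real
  assumes "\<alpha> > -1" and c: "c > 0"
  shows "integrable pos_lborel (\<lambda>u. u powr \<alpha> * exp (- (c * u)))"
    and "(\<integral>u. u powr \<alpha> * exp (- (c * u)) \<partial>pos_lborel) = Gamma (\<alpha> + 1) * c powr (- \<alpha> - 1)"
proof -
  let ?s = "complex_of_real (\<alpha> + 1)"
  have s: "Re ?s > 0" using assms by simp
  have eq: "of_real u powr (?s - 1) * exp (- (of_real c * of_real u)) =
     complex_of_real (u powr \<alpha> * exp (- (c * u)))" if "u \<in> space pos_lborel" for u
    using that by (simp add: powr_of_real exp_of_real flip: of_real_mult of_real_minus)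
  note I = Gamma_integral_real_scale[OF s c]
  have i: "integrable pos_lborel (\<lambda>u. complex_of_real (u powr \<alpha> * exp (- (c * u))))"
    using I(1) by (subst (asm) Bochner_Integration.integrable_cong[OF refl eq])
  from integrable_Re[OF this] show "integrable pos_lborel (\<lambda>u. u powr \<alpha> * exp (- (c * u)))" by simp
  have "(\<integral>u. complex_of_real (u powr \<alpha> * exp (- (c * u))) \<partial>pos_lborel) = Gamma ?s * of_real c powr (- ?s)"
    using I(2) by (subst (asm) Bochner_Integration.integral_cong[OF refl eq])
  also have "\<dots> = of_real (Gamma (\<alpha> + 1) * c powr (- \<alpha> - 1))"
    using c by (simp add: Gamma_complex_of_real powr_of_real flip: of_real_minus of_real_add of_real_diff)
  finally show "(\<integral>u. u powr \<alpha> * exp (- (c * u)) \<partial>pos_lborel) = Gamma (\<alpha> + 1) * c powr (- \<alpha> - 1)"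
    by (simp only: integral_complex_of_real of_real_eq_iff)
qed

lemma norm_powr_exp:
  fixes s z :: complex
  assumes "u > 0"
  shows "norm (of_real u powr s * exp (- (z * of_real u))) = u powr Re s * exp (- (Re z * u))"
  using assms by (simp add: norm_mult norm_powr_real_powr)

lemma integrable_powr_exp:
  fixes s z :: complex
  assumes "Re s > -1" "Re z > 0"
  shows "integrable pos_lborel (\<lambda>u. of_real u powr s * exp (- (z * of_real u)))"
proof (rule Bochner_Integration.integrable_bound[OF Gamma_integral_powr_exp(1)[of "Re s" "Re z"]])
  show "(\<lambda>u. of_real u powr s * exp (- (z * of_real u))) \<in> borel_measurable pos_lborel"
    by (intro borel_measurable_pos_lborel continuous_intros) auto
qed (use assms in \<open>auto simp: norm_powr_exp intro!: AE_I2\<close>)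

text \<open>Instead of rotating the ray of integration: both sides are holomorphic in
  \<open>z\<close> on the right half-plane and agree on the positive reals, which accumulate at
  1.\<close>

lemma Gamma_integral_complex_scale:
  assumes s: "Re s > 0" and z: "Re z > 0"
  shows "(\<integral>u. of_real u powr (s - 1) * exp (- (z * of_real u)) \<partial>pos_lborel) = Gamma s * z powr (- s)"
proof -
  define F where "F z = (\<integral>u. of_real u powr (s - 1) * exp (- (z * of_real u)) \<partial>pos_lborel)" for z
  have op: "open {z. Re z > 0}" by (rule open_halfspace_Re_gt)
  have hol: "F holomorphic_on {z. Re z > 0}"
    unfolding F_def
  proof (rule holomorphic_on_integral_dominated[OF op])
    fix z0 assume "z0 \<in> {z. Re z > 0}"
    hence z0: "Re z0 > 0" by simp
    \<comment> \<open>On the ball of radius \<open>Re z0 / 2\<close> the real part stays above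
      \<open>Re z0 / 2\<close>, so one real exponential dominates all integrands.\<close>
    have "norm (of_real u powr (s - 1) * exp (- (z * of_real u))) \<le> u powr Re (s - 1) * exp (- (Re z0 / 2 * u))"
      if z: "z \<in> ball z0 (Re z0 / 2)" and u: "u > 0" for z u
    proof -
      have "\<bar>Re z0 - Re z\<bar> < Re z0 / 2"
        using z abs_Re_le_cmod[of "z0 - z"] by (simp add: dist_norm)
      hence "Re z0 / 2 \<le> Re z" by linarith
      hence "Re z0 / 2 * u \<le> Re z * u" using u by (intro mult_right_mono) auto
      thus ?thesis using u by (subst norm_powr_exp) (auto intro!: mult_left_mono)
    qed
    thus "\<exists>r>0. \<exists>h. integrable pos_lborel h \<and>
             (\<forall>z\<in>ball z0 r \<inter> {z. 0 < Re z}. \<forall>u\<in>space pos_lborel.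
                 cmod (complex_of_real u powr (s - 1) * exp (- (z * complex_of_real u))) \<le> h u)"
      using z0 s by (intro exI[of _ "Re z0 / 2"] conjI exI[of _ "\<lambda>u. u powr Re (s - 1) * exp (- (Re z0 / 2 * u))"]
          Gamma_integral_powr_exp(1)) auto
  qed (auto intro!: holomorphic_intros borel_measurable_pos_lborel continuous_intros)
  have "F z - Gamma s * z powr (- s) = 0"
  proof (rule analytic_continuation[where f = "\<lambda>z. F z - Gamma s * z powr (- s)" and w = z and S = "{z. Re z > 0}" and U = "complex_of_real ` {0<..}" and \<xi> = 1])
    show "(\<lambda>z. F z - Gamma s * z powr (- s)) holomorphic_on {z. Re z > 0}"
      by (intro holomorphic_intros hol) (auto simp: complex_nonpos_Reals_iff)
    show "connected {z. Re z > 0}" by (intro convex_connected convex_halfspace_Re_gt)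
    show "(1::complex) islimpt complex_of_real ` {0<..}"
      unfolding islimpt_approachable
    proof (intro allI impI)
      fix e :: real assume "e > 0"
      thus "\<exists>x'\<in>complex_of_real ` {0<..}. x' \<noteq> 1 \<and> dist x' 1 < e"
        by (intro bexI[of _ "complex_of_real (1 + e/2)"] conjI imageI) (auto simp: dist_norm)
    qed
  next
    fix z assume "z \<in> complex_of_real ` {0<..}"
    thus "F z - Gamma s * z powr (- s) = 0"
      using Gamma_integral_real_scale(2)[OF s] by (auto simp: F_def)
  qed (use z op in auto)
  thus ?thesis by (simp add: F_def)
qed

section \<open>Mellin integrals\<close>

text \<open>The ray from \<open>Z\<close> to the right avoids 0 and moves away from it linearly. The
  bound is uniform near \<open>Z\<close>, as differentiation under the integral in \<open>Z\<close>
  requires.\<close>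

lemma norm_add_of_real_ge:
  fixes Z :: complex
  assumes "Z \<notin> \<real>\<^sub>\<le>\<^sub>0"
  obtains \<kappa> where "\<kappa> > 0" "\<And>w u. w \<in> ball Z \<kappa> \<Longrightarrow> u \<ge> 0 \<Longrightarrow> norm (of_real u + w) \<ge> \<kappa> * (1 + u)"
proof -
  have "\<exists>\<kappa>>0. \<forall>u\<ge>0. norm (of_real u + Z) \<ge> \<kappa> * (1 + u)"
  proof (cases "Re Z > 0")
    case True
    have "min 1 (Re Z) * (1 + u) \<le> norm (of_real u + Z)" if "u \<ge> 0" for u
    proof -
      have "min 1 (Re Z) * (1 + u) = min 1 (Re Z) + min 1 (Re Z) * u" by (simp add: ring_distribs)
      also have "\<dots> \<le> Re Z + 1 * u" using that by (intro add_mono mult_right_mono) auto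
      also have "\<dots> = Re (of_real u + Z)" by simp
      also have "\<dots> \<le> norm (of_real u + Z)" by (rule complex_Re_le_cmod)
      finally show ?thesis .
    qed
    with True show ?thesis by (intro exI[of _ "min 1 (Re Z)"]) auto
  next
    case False
    hence im: "\<bar>Im Z\<bar> > 0" using assms by (auto simp: complex_nonpos_Reals_iff)
    \<comment> \<open>Write 1 + u as (1 + |Z|) + (u - |Z|). The first part is paid for by |u + Z| >=
      |Im Z|, the second by |u + Z| >= u - |Z|.\<close>
    define C where "C = (1 + norm Z) / \<bar>Im Z\<bar> + 1"
    have C: "C > 0" using im by (auto simp: C_def intro!: add_nonneg_pos divide_nonneg_pos)
    have "1 / C * (1 + u) \<le> norm (of_real u + Z)" if "u \<ge> 0" for u
    proof -
      have 1: "\<bar>Im Z\<bar> \<le> norm (of_real u + Z)" using abs_Im_le_cmod[of "of_real u + Z"] by simp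
      have 2: "u - norm Z \<le> norm (of_real u + Z)"
        using norm_triangle_ineq4[of "of_real u + Z" Z] that by simp
      have "1 + norm Z = (1 + norm Z) / \<bar>Im Z\<bar> * \<bar>Im Z\<bar>" using im by simp
      also have "\<dots> \<le> (1 + norm Z) / \<bar>Im Z\<bar> * norm (of_real u + Z)"
        using 1 im by (intro mult_left_mono) auto
      finally have "1 + u \<le> C * norm (of_real u + Z)" using 2 by (simp add: C_def ring_distribs)
      thus ?thesis using C by (simp add: field_simps)
    qed
    with C show ?thesis by (intro exI[of _ "1 / C"]) auto
  qed
  then obtain \<kappa> where \<kappa>: "\<kappa> > 0" "\<And>u. u \<ge> 0 \<Longrightarrow> norm (of_real u + Z) \<ge> \<kappa> * (1 + u)" by blast
  \<comment> \<open>Moving the point by at most half of the constant costs at most half of the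
    bound, because 1 + u >= 1.\<close>
  show thesis
  proof (rule that[of "\<kappa> / 2"])
    fix w u assume w: "w \<in> ball Z (\<kappa> / 2)" and u: "u \<ge> (0::real)"
    have "\<kappa> * (1 + u) \<le> norm (of_real u + Z)" by (rule \<kappa>(2)[OF u])
    also have "\<dots> \<le> norm (of_real u + w) + norm (w - Z)"
      using norm_triangle_ineq4[of "of_real u + w" "w - Z"] by simp
    also have "norm (w - Z) \<le> \<kappa> / 2 * 1"
      using w by (simp add: dist_norm norm_minus_commute)
    also have "\<kappa> / 2 * 1 \<le> \<kappa> / 2 * (1 + u)" using u \<kappa>(1) by (intro mult_left_mono) auto
    finally show "\<kappa> / 2 * (1 + u) \<le> norm (of_real u + w)" by simp
  qed (use \<kappa> in auto)
qed

lemma integrable_powr_over: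
  fixes \<alpha> \<beta> :: real
  assumes "\<alpha> > -1" "\<beta> > \<alpha> + 1"
  shows "integrable pos_lborel (\<lambda>u. u powr \<alpha> / (1 + u) powr \<beta>)"
proof -
  have 1: "integrable pos_lborel (\<lambda>u. indicator {0<..1} u * u powr \<alpha>)"
    using integrable_on_powr_from_0'[of \<alpha> 1] assms
    by (intro integrable_pos_lborel_indicator nonnegative_absolutely_integrable_1) auto
  have 2: "integrable pos_lborel (\<lambda>u. indicator {1..} u * u powr (\<alpha> - \<beta>))"
    using assms
    by (intro integrable_pos_lborel_indicator nonnegative_absolutely_integrable_1
        has_integral_integrable[OF has_integral_powr_to_inf]) auto
  show ?thesis
  proof (rule Bochner_Integration.integrable_bound[OF Bochner_Integration.integrable_add[OF 1 2]])
    show "(\<lambda>u. u powr \<alpha> / (1 + u) powr \<beta>) \<in> borel_measurable pos_lborel"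
      by (intro borel_measurable_pos_lborel continuous_intros) auto
    have "u powr \<alpha> / (1 + u) powr \<beta> \<le> indicator {0<..1} u * u powr \<alpha> + indicator {1..} u * u powr (\<alpha> - \<beta>)"
      if u: "u > 0" for u
    proof (cases "u \<le> 1")
      case True
      have "1 \<le> (1 + u) powr \<beta>" using u assms by (intro ge_one_powr_ge_zero) auto
      hence "u powr \<alpha> / (1 + u) powr \<beta> \<le> u powr \<alpha> / 1" by (intro divide_left_mono) auto
      hence "u powr \<alpha> / (1 + u) powr \<beta> \<le> indicator {0<..1} u * u powr \<alpha>" using True u by simp
      thus ?thesis by (rule add_increasing2[rotated]) auto
    next
      case False
      have "u powr \<beta> \<le> (1 + u) powr \<beta>" using u assms by (intro powr_mono2) auto
      hence "u powr \<alpha> / (1 + u) powr \<beta> \<le> u powr \<alpha> / u powr \<beta>" using u by (intro divide_left_mono) auto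
      thus ?thesis using False u by (simp add: powr_diff)
    qed
    thus "AE u in pos_lborel. norm (u powr \<alpha> / (1 + u) powr \<beta>) \<le>
        norm (indicator {0<..1} u * u powr \<alpha> + indicator {1..} u * u powr (\<alpha> - \<beta>))"
      by (intro AE_I2) (force intro: order_trans)
  qed
qed

lemma integral_exp_pos_lborel:
  fixes z :: complex
  assumes "Re z > 0"
  shows "integrable pos_lborel (\<lambda>v. exp (- (z * of_real v)))"
    and "(\<integral>v. exp (- (z * of_real v)) \<partial>pos_lborel) = 1 / z"
proof -
  have eq: "exp (- (z * of_real v)) = of_real v powr (1 - 1) * exp (- (z * of_real v))"
    if "v \<in> space pos_lborel" for v using that by simp
  show "integrable pos_lborel (\<lambda>v. exp (- (z * of_real v)))"
    using integrable_powr_exp[of "1 - 1" z] assms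
    by (subst Bochner_Integration.integrable_cong[OF refl eq]) auto
  have "z \<noteq> 0" using assms by auto
  thus "(\<integral>v. exp (- (z * of_real v)) \<partial>pos_lborel) = 1 / z"
    using Gamma_integral_complex_scale[of 1 z] assms
    by (subst Bochner_Integration.integral_cong[OF refl eq]) (auto simp: powr_minus field_simps)
qed

lemma sigma_finite_pos_lborel: "sigma_finite_measure pos_lborel"
  by (intro sigma_finite_measure_restrict_space lborel.sigma_finite_measure_axioms) auto

text \<open>Fubini applied to \<open>1 / (u + Z) = \<integral>exp (- v * (u + Z)) dv\<close>.\<close>

lemma Mellin_integral_Re_pos:
  fixes a Z :: complex
  assumes a: "-1 < Re a" "Re a < 0" and Z: "Re Z > 0"
  shows "(\<integral>u. of_real u powr a / (of_real u + Z) \<partial>pos_lborel) = Gamma (a + 1) * Gamma (- a) * Z powr a"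
proof -
  interpret P: pair_sigma_finite pos_lborel pos_lborel
    by (intro pair_sigma_finite.intro sigma_finite_pos_lborel)
  define f where "f u v = of_real u powr a * exp (- ((of_real u + Z) * of_real v))" for u v :: real
  \<comment> \<open>The power is rewritten through \<open>exp\<close> and the real logarithm to make
    joint measurability on the product space immediate; both forms agree for positive
    \<open>u\<close>.\<close>
  define f' where "f' u v = exp (a * of_real (ln u)) * exp (- ((of_real u + Z) * of_real v))" for u v :: real
  have ff': "f u v = f' u v" if "u > 0" for u v
    using that by (simp add: f_def f'_def powr_def Ln_of_real)
  have id[measurable]: "(\<lambda>x. x) \<in> borel_measurable pos_lborel"
    by (intro borel_measurable_pos_lborel continuous_intros)
  have meas': "(\<lambda>(u, v). f' u v) \<in> borel_measurable (pos_lborel \<Otimes>\<^sub>M pos_lborel)"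
    unfolding f'_def by measurable
  have nf: "norm (f u v) = u powr Re a * exp (- ((u + Re Z) * v))" if "u > 0" "v > 0" for u v
    using that by (simp add: f_def norm_mult norm_powr_real_powr)
  have intv: "integrable pos_lborel (\<lambda>v. f u v)" if "u > 0" for u
    using integral_exp_pos_lborel(1)[of "of_real u + Z"] that Z unfolding f_def
    by (intro Bochner_Integration.integrable_mult_right) auto
  have iv: "(\<integral>v. exp (- (c * v)) \<partial>pos_lborel) = 1 / c" if "c > 0" for c :: real
  proof -
    have "(\<integral>v. exp (- (c * v)) \<partial>pos_lborel) = (\<integral>v. v powr 0 * exp (- (c * v)) \<partial>pos_lborel)"
      by (intro Bochner_Integration.integral_cong) auto
    thus ?thesis using Gamma_integral_powr_exp(2)[of 0 c] that by (simp add: powr_minus field_simps)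
  qed
  have nint: "(\<integral>v. norm (f u v) \<partial>pos_lborel) = u powr Re a / (u + Re Z)" if u: "u > 0" for u
  proof -
    have "(\<integral>v. norm (f u v) \<partial>pos_lborel) = (\<integral>v. u powr Re a * exp (- ((u + Re Z) * v)) \<partial>pos_lborel)"
      by (intro Bochner_Integration.integral_cong refl nf u) auto
    also have "\<dots> = u powr Re a / (u + Re Z)" using iv[of "u + Re Z"] u Z by simp
    finally show ?thesis .
  qed
  have "complex_of_real (Re Z) \<notin> \<real>\<^sub>\<le>\<^sub>0" using Z by (simp add: complex_nonpos_Reals_iff)
  then obtain \<kappa> where \<kappa>: "\<kappa> > 0" "\<And>w u. w \<in> ball (complex_of_real (Re Z)) \<kappa> \<Longrightarrow> u \<ge> 0 \<Longrightarrow> norm (of_real u + w) \<ge> \<kappa> * (1 + u)"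
    by (rule norm_add_of_real_ge) blast
  have \<kappa>': "\<kappa> * (1 + u) \<le> u + Re Z" if "u > 0" for u
    using \<kappa>(2)[of "of_real (Re Z)" u] \<kappa>(1) that Z by (simp flip: of_real_add)
  have int1: "integrable pos_lborel (\<lambda>u. u powr Re a / (u + Re Z))"
  proof (rule Bochner_Integration.integrable_bound)
    show "integrable pos_lborel (\<lambda>u. 1 / \<kappa> * (u powr Re a / (1 + u) powr 1))"
      using a by (intro Bochner_Integration.integrable_mult_right integrable_powr_over) auto
    show "(\<lambda>u. u powr Re a / (u + Re Z)) \<in> borel_measurable pos_lborel"
      using Z by (intro borel_measurable_pos_lborel continuous_intros) auto
    have "u powr Re a / (u + Re Z) \<le> u powr Re a / (\<kappa> * (1 + u))" if "u > 0" for u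
      using \<kappa>'[OF that] \<kappa>(1) that Z by (intro divide_left_mono) auto
    thus "AE u in pos_lborel. norm (u powr Re a / (u + Re Z)) \<le> norm (1 / \<kappa> * (u powr Re a / (1 + u) powr 1))"
      using Z \<kappa>(1) by (intro AE_I2) (auto simp: mult.commute)
  qed
  have int': "integrable (pos_lborel \<Otimes>\<^sub>M pos_lborel) (case_prod f')"
  proof (rule P.Fubini_integrable)
    show "case_prod f' \<in> borel_measurable (pos_lborel \<Otimes>\<^sub>M pos_lborel)" using meas' by simp
    show "AE u in pos_lborel. integrable pos_lborel (\<lambda>v. case_prod f' (u, v))"
      using intv by (intro AE_I2) (simp add: ff')
    show "integrable pos_lborel (\<lambda>u. \<integral>v. norm (case_prod f' (u, v)) \<partial>pos_lborel)"
      using int1 by (rule Bochner_Integration.integrable_cong[THEN iffD1, OF refl, rotated])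
        (simp add: nint flip: ff')
  qed
  have "(\<integral>u. of_real u powr a / (of_real u + Z) \<partial>pos_lborel) = (\<integral>u. (\<integral>v. f' u v \<partial>pos_lborel) \<partial>pos_lborel)"
  proof (intro Bochner_Integration.integral_cong refl)
    fix u assume "u \<in> space pos_lborel"
    hence u: "u > 0" by simp
    have "(\<integral>v. exp (- ((of_real u + Z) * of_real v)) \<partial>pos_lborel) = 1 / (of_real u + Z)"
      using integral_exp_pos_lborel(2)[of "of_real u + Z"] u Z by simp
    thus "of_real u powr a / (of_real u + Z) = (\<integral>v. f' u v \<partial>pos_lborel)"
      by (simp add: f_def flip: ff'[OF u])
  qed
  also have "\<dots> = (\<integral>v. (\<integral>u. f' u v \<partial>pos_lborel) \<partial>pos_lborel)"
    by (rule P.Fubini_integral[OF int', symmetric])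
  also have "\<dots> = (\<integral>v. Gamma (a + 1) * (of_real v powr (- a - 1) * exp (- (Z * of_real v))) \<partial>pos_lborel)"
  proof (intro Bochner_Integration.integral_cong refl)
    fix v assume "v \<in> space pos_lborel"
    hence v: "v > 0" by simp
    have "(\<integral>u. f' u v \<partial>pos_lborel) = (\<integral>u. exp (- (Z * of_real v)) * (of_real u powr (a + 1 - 1) * exp (- (of_real v * of_real u))) \<partial>pos_lborel)"
      by (intro Bochner_Integration.integral_cong refl)
         (auto simp: f_def ring_distribs exp_diff exp_minus field_simps exp_add simp flip: ff')
    also have "\<dots> = exp (- (Z * of_real v)) * (Gamma (a + 1) * of_real v powr (- (a + 1)))"
      by (subst Gamma_integral_complex_scale[of "a + 1" "of_real v", symmetric]) (use a v in simp_all)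
    finally show "(\<integral>u. f' u v \<partial>pos_lborel) = Gamma (a + 1) * (of_real v powr (- a - 1) * exp (- (Z * of_real v)))"
      by simp
  qed
  also have "\<dots> = Gamma (a + 1) * (Gamma (- a) * Z powr a)"
    using Gamma_integral_complex_scale[of "- a" Z] a Z by simp
  finally show ?thesis by simp
qed

lemma Gamma_mult_Gamma_minus:
  "Gamma (a + 1) * Gamma (- a) = - of_real pi / sin (of_real pi * a)" for a :: complex
  using Gamma_reflection_complex[of "- a"] by (simp add: mult_ac add.commute)

lemma holomorphic_on_Mellin_integral:
  assumes a: "-1 < Re a" "Re a < 0"
  shows "(\<lambda>Z. \<integral>u. of_real u powr a / (of_real u + Z) \<partial>pos_lborel) holomorphic_on (- \<real>\<^sub>\<le>\<^sub>0)"
proof (rule holomorphic_on_integral_dominated)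
  have nz: "of_real u + Z \<noteq> 0" if "u > 0" "Z \<notin> \<real>\<^sub>\<le>\<^sub>0" for u and Z :: complex
    using that by (auto simp: complex_nonpos_Reals_iff complex_eq_iff)
  show "(\<lambda>Z. of_real u powr a / (of_real u + Z)) holomorphic_on (- \<real>\<^sub>\<le>\<^sub>0)" if "u \<in> space pos_lborel" for u
    using that nz by (intro holomorphic_intros) auto
  show "(\<lambda>u. of_real u powr a / (of_real u + Z)) \<in> borel_measurable pos_lborel" if "Z \<in> - \<real>\<^sub>\<le>\<^sub>0" for Z
    using that nz by (intro borel_measurable_pos_lborel continuous_intros) auto
  fix Z assume "Z \<in> - (\<real>\<^sub>\<le>\<^sub>0 :: complex set)"
  then obtain \<kappa> where \<kappa>: "\<kappa> > 0" "\<And>w u. w \<in> ball Z \<kappa> \<Longrightarrow> u \<ge> 0 \<Longrightarrow> norm (of_real u + w) \<ge> \<kappa> * (1 + u)"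
    using norm_add_of_real_ge[of Z] by blast
  have "norm (of_real u powr a / (of_real u + w)) \<le> 1 / \<kappa> * (u powr Re a / (1 + u) powr 1)"
    if w: "w \<in> ball Z \<kappa>" and u: "u > 0" for w u
  proof -
    have "norm (of_real u powr a / (of_real u + w)) = u powr Re a / norm (of_real u + w)"
      using u by (simp add: norm_divide norm_powr_real_powr)
    also have "\<dots> \<le> u powr Re a / (\<kappa> * (1 + u))"
      using \<kappa>(2)[OF w, of u] \<kappa>(1) u
      by (intro divide_left_mono mult_pos_pos less_le_trans[OF mult_pos_pos \<kappa>(2)[OF w]]) auto
    finally show ?thesis using u by (simp add: mult.commute)
  qed
  moreover have "integrable pos_lborel (\<lambda>u. 1 / \<kappa> * (u powr Re a / (1 + u) powr 1))"
    using a by (intro Bochner_Integration.integrable_mult_right integrable_powr_over) auto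
  ultimately show "\<exists>r>0. \<exists>h. integrable pos_lborel h \<and> (\<forall>z\<in>ball Z r \<inter> - \<real>\<^sub>\<le>\<^sub>0. \<forall>u\<in>space pos_lborel.
      norm (of_real u powr a / (of_real u + z)) \<le> h u)"
    using \<kappa>(1) by (intro exI[of _ \<kappa>] conjI exI[of _ "\<lambda>u. 1 / \<kappa> * (u powr Re a / (1 + u) powr 1)"]) auto
qed (auto simp: open_Compl)

text \<open>Continuation from the right half-plane to the slit plane. The larger domain is
  essential: partial fractions of 1 / (u^2 - W^2) need the values at both \<open>W\<close> and
  \<open>- W\<close>, and these cannot both lie in the right half-plane.\<close>

lemma Mellin_integral:
  fixes a Z :: complex
  assumes a: "-1 < Re a" "Re a < 0" and Z: "Z \<notin> \<real>\<^sub>\<le>\<^sub>0"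
  shows "(\<integral>u. of_real u powr a / (of_real u + Z) \<partial>pos_lborel) = - of_real pi / sin (of_real pi * a) * Z powr a"
proof (rule analytic_continuation_open[where s = "{Z. Re Z > 0}" and s' = "- \<real>\<^sub>\<le>\<^sub>0" and z = Z])
  show "{Z::complex. Re Z > 0} \<noteq> {}" by (auto intro!: exI[of _ 1])
  have "(\<real>\<^sub>\<le>\<^sub>0 :: complex set) = complex_of_real ` {..0}"
    unfolding nonpos_Reals_def by blast
  thus "connected (- \<real>\<^sub>\<le>\<^sub>0 :: complex set)"
    using starlike_imp_connected[OF starlike_slotted_complex_plane_left[of 0]] by simp
  show "(\<integral>u. of_real u powr a / (of_real u + Z) \<partial>pos_lborel) = - of_real pi / sin (of_real pi * a) * Z powr a"
    if "Z \<in> {Z. Re Z > 0}" for Z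
    using Mellin_integral_Re_pos[OF a, of Z] that by (simp add: Gamma_mult_Gamma_minus)
  show "(\<lambda>Z. - of_real pi / sin (of_real pi * a) * Z powr a) holomorphic_on (- \<real>\<^sub>\<le>\<^sub>0)"
    by (intro holomorphic_intros) auto
qed (use Z a in \<open>auto simp: open_halfspace_Re_gt open_Compl complex_nonpos_Reals_iff
       intro: holomorphic_on_Mellin_integral\<close>)

section \<open>Continuation of the Riemann zeta function\<close>

lemma borel_measurable_indicator_pos_lborel:
  "A \<in> sets borel \<Longrightarrow> (indicator A :: real \<Rightarrow> real) \<in> borel_measurable pos_lborel"
  by (rule measurable_restrict_space1) auto

lemma norm_of_nat_powr: "norm (of_nat (Suc n) powr s) = real (Suc n) powr Re s" for s :: complex
  using norm_powr_real_powr[of "of_nat (Suc n)" s] by simp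

text \<open>Termwise integration of the geometric series; the integrals of the norms are multiples
  of n^(- Re s), which sum because Re s > 1.\<close>

lemma zeta_integral:
  assumes s: "Re s > 1"
  shows "integrable pos_lborel (\<lambda>u. of_real u powr (s - 1) / (exp (of_real u) - 1))"
    and "(\<integral>u. of_real u powr (s - 1) / (exp (of_real u) - 1) \<partial>pos_lborel) = Gamma s * (\<Sum>n. 1 / of_nat (Suc n) powr s)"
    and "summable (\<lambda>n. norm (1 / complex_of_nat (Suc n) powr s))"
proof -
  define f where "f n u = of_real u powr (s - 1) * exp (- (of_real (real (Suc n)) * of_real u))" for n and u :: real
  have int: "integrable pos_lborel (f n)" "integral\<^sup>L pos_lborel (f n) = Gamma s * (1 / of_nat (Suc n) powr s)" for n
    using Gamma_integral_real_scale[of s "real (Suc n)"] s unfolding f_def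
    by (simp_all add: powr_minus divide_inverse del: of_nat_Suc)
  have sums: "(\<lambda>n. f n u) sums (of_real u powr (s - 1) / (exp (of_real u) - 1))"
    and summ: "summable (\<lambda>n. norm (f n u))" if u: "u > 0" for u
  proof -
    have Reu: "Re (complex_of_real u) > 0" using u by simp
    show "(\<lambda>n. f n u) sums (of_real u powr (s - 1) / (exp (of_real u) - 1))"
      using sums_mult[OF sums_exp_minus(1)[OF Reu], of "of_real u powr (s - 1)"] by (simp add: f_def del: of_nat_Suc)
    show "summable (\<lambda>n. norm (f n u))"
      using summable_mult[OF sums_exp_minus(2)[OF Reu], of "norm (of_real u powr (s - 1))"]
      by (simp add: f_def norm_mult del: of_nat_Suc)
  qed
  have norm_int: "(\<integral>u. norm (f n u) \<partial>pos_lborel) = Gamma (Re s) * real (Suc n) powr (- Re s)" for n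
  proof -
    have "(\<integral>u. norm (f n u) \<partial>pos_lborel) = (\<integral>u. u powr (Re s - 1) * exp (- (real (Suc n) * u)) \<partial>pos_lborel)"
      unfolding f_def by (intro Bochner_Integration.integral_cong refl, subst norm_powr_exp) auto
    thus ?thesis using Gamma_integral_powr_exp(2)[of "Re s - 1" "real (Suc n)"] s by (simp del: of_nat_Suc)
  qed
  have summ': "summable (\<lambda>n. real (Suc n) powr (- Re s))"
    using s by (subst summable_Suc_iff) (simp add: summable_real_powr_iff)
  thus "summable (\<lambda>n. norm (1 / complex_of_nat (Suc n) powr s))"
    by (simp only: norm_divide norm_one norm_of_nat_powr powr_minus inverse_eq_divide)
  have si: "summable (\<lambda>n. \<integral>u. norm (f n u) \<partial>pos_lborel)"
    unfolding norm_int by (intro summable_mult summ')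
  have ae: "AE u in pos_lborel. summable (\<lambda>n. norm (f n u))" using summ by (intro AE_I2) auto
  have eq: "(\<Sum>n. f n u) = of_real u powr (s - 1) / (exp (of_real u) - 1)" if "u \<in> space pos_lborel" for u
    using sums[of u] that by (simp add: sums_iff)
  show "integrable pos_lborel (\<lambda>u. of_real u powr (s - 1) / (exp (of_real u) - 1))"
    using integrable_suminf[OF int(1) ae si] by (subst (asm) Bochner_Integration.integrable_cong[OF refl eq])
  have "(\<integral>u. of_real u powr (s - 1) / (exp (of_real u) - 1) \<partial>pos_lborel) = (\<integral>u. (\<Sum>n. f n u) \<partial>pos_lborel)"
    by (intro Bochner_Integration.integral_cong refl) (use eq in auto)
  also have "\<dots> = (\<Sum>n. Gamma s * (1 / of_nat (Suc n) powr s))"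
    using integral_suminf[OF int(1) ae si] by (simp only: int)
  also have "\<dots> = Gamma s * (\<Sum>n. 1 / of_nat (Suc n) powr s)"
    by (rule suminf_mult) (rule summable_norm_cancel, fact)
  finally show "(\<integral>u. of_real u powr (s - 1) / (exp (of_real u) - 1) \<partial>pos_lborel) = \<dots>" .
qed

text \<open>The coefficients are the Bernoulli numbers divided by factorials. The nearest
  singularities are at distance 2 pi, so a disc of radius 2 is safely inside, and absolute
  summability up to u = 1 follows.\<close>

lemma bernoulli_expansion:
  obtains c :: "nat \<Rightarrow> complex" where "summable (\<lambda>n. norm (c n))"
    and "\<And>u::real. 0 < u \<Longrightarrow> u \<le> 1 \<Longrightarrow> (\<lambda>n. c n * of_real u ^ n) sums (of_real u / (exp (of_real u) - 1))"
proof -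
  define e where "e z = (if z = 0 then 1 else (exp z - 1) / z)" for z :: complex
  have hol: "e holomorphic_on UNIV"
  proof (rule no_isolated_singularity[where K = "{0}"])
    have ev: "(\<lambda>z. (exp z - 1) / z) holomorphic_on UNIV - {0}" by (intro holomorphic_intros) auto
    thus e: "e holomorphic_on UNIV - {0}"
      by (rule holomorphic_transform) (auto simp: e_def)
    have "isCont e z" for z
    proof (cases "z = 0")
      case True
      have "((\<lambda>h. (exp (0 + h) - exp 0) / h) \<longlongrightarrow> exp (0::complex)) (at 0)"
        using DERIV_exp[of "0::complex"] by (simp add: DERIV_def)
      hence "((\<lambda>h::complex. (exp h - 1) / h) \<longlongrightarrow> 1) (at 0)" by simp
      hence "(e \<longlongrightarrow> 1) (at 0)"
        by (rule Lim_transform_eventually) (auto simp: e_def eventually_at_filter)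
      thus ?thesis using True by (simp add: isCont_def e_def)
    next
      case False
      thus ?thesis using holomorphic_on_imp_continuous_on[OF e]
        by (simp add: continuous_on_eq_continuous_at open_delete)
    qed
    thus "continuous_on UNIV e" by (simp add: continuous_at_imp_continuous_on)
  qed auto
  \<comment> \<open>The zeros of exp z - 1 other than 0 are nonzero multiples of 2 pi i, hence of
    modulus at least 4.\<close>
  have nz: "e z \<noteq> 0" if "z \<in> ball 0 2" for z
  proof
    assume "e z = 0"
    hence z: "z \<noteq> 0" "exp z = 1" by (auto simp: e_def split: if_splits)
    from z(2) obtain n :: int where n: "Re z = 0" "Im z = of_int (2 * n) * pi" by (auto simp: exp_eq_1)
    with z(1) have "n \<noteq> 0" by (auto simp: complex_eq_iff)
    hence "1 \<le> \<bar>real_of_int n\<bar>" by linarith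
    hence "2 * pi * 1 \<le> 2 * pi * \<bar>of_int n\<bar>" by (intro mult_left_mono) auto
    also have "\<dots> = \<bar>Im z\<bar>" using n by (simp add: abs_mult)
    also have "\<dots> \<le> norm z" by (rule abs_Im_le_cmod)
    finally show False using that pi_ge_two by simp
  qed
  define g where "g z = 1 / e z" for z
  have g: "g holomorphic_on ball 0 2"
    unfolding g_def using nz by (intro holomorphic_intros holomorphic_on_subset[OF hol]) auto
  define c where "c n = (deriv ^^ n) g 0 / fact n" for n
  have ps: "(\<lambda>n. c n * z ^ n) sums g z" if "z \<in> ball 0 2" for z
    using holomorphic_power_series[OF g that] by (simp add: c_def)
  show thesis
  proof (rule that[of c])
    \<comment> \<open>Any point strictly between 1 and the radius 2 would do: convergence there
      gives absolute convergence at 1.\<close>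
    have "summable (\<lambda>n. c n * (3/2) ^ n)" using ps[of "3/2"] by (auto simp: sums_iff)
    from powser_insidea[OF this, of 1] show "summable (\<lambda>n. norm (c n))" by simp
    show "(\<lambda>n. c n * of_real u ^ n) sums (of_real u / (exp (of_real u) - 1))" if "0 < u" "u \<le> 1" for u :: real
      using ps[of "of_real u"] that by (simp add: g_def e_def)
  qed
qed

text \<open>On the positive half-line the indicator of \<open>{..1}\<close> stands for (0, 1]. After
  termwise integration of the Bernoulli series, the value 1 / w is what produces the poles to be
  cancelled by \<open>rGamma\<close>.\<close>

lemma integral_powr_unit:
  assumes w: "Re w > 0"
  shows "integrable pos_lborel (\<lambda>u. indicator {..1} u *\<^sub>R of_real u powr (w - 1))" (is "integrable _ ?f")
    and "(\<integral>u. indicator {..1} u *\<^sub>R of_real u powr (w - 1) \<partial>pos_lborel) = 1 / w"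
proof -
  have hi: "((\<lambda>t. complex_of_real t powr (w - 1)) has_integral
          (of_real 1 powr w / w - of_real 0 powr w / w)) {0..1}" using w
    by (intro fundamental_theorem_of_calculus_interior)
       (auto intro!: continuous_intros derivative_eq_intros has_vector_derivative_real_field)
  hence hi': "((\<lambda>t. complex_of_real t powr (w - 1)) has_integral 1 / w) {0<..1}"
    using w by (subst has_integral_spike_set_eq[of _ "{0..1}"])
      (auto intro: negligible_subset[of "{0}"])
  have real: "integrable pos_lborel (\<lambda>u. indicator {0<..1} u * u powr (Re w - 1))"
    using integrable_on_powr_from_0'[of "Re w - 1" 1] w
    by (intro integrable_pos_lborel_indicator nonnegative_absolutely_integrable_1) auto
  have "(\<lambda>u. complex_of_real u powr (w - 1)) \<in> borel_measurable pos_lborel"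
    by (intro borel_measurable_pos_lborel continuous_intros) auto
  hence meas: "?f \<in> borel_measurable pos_lborel"
    by (intro borel_measurable_scaleR borel_measurable_indicator_pos_lborel) auto
  show int: "integrable pos_lborel ?f"
    by (rule Bochner_Integration.integrable_bound[OF real meas])
       (auto intro!: AE_I2 simp: indicator_def norm_powr_real_powr)
  have eq: "(\<lambda>u. indicat_real {0<..} u *\<^sub>R ?f u) = (\<lambda>u. indicat_real {0<..1} u *\<^sub>R of_real u powr (w - 1))"
    by (auto simp: indicator_def)
  have "set_integrable lborel {0<..1} (\<lambda>u. complex_of_real u powr (w - 1))"
    using int unfolding set_integrable_def eq[symmetric] by (simp add: integrable_restrict_space)
  from set_borel_integral_eq_integral(2)[OF this] hi'
  have "(LINT u:{0<..1}|lborel. complex_of_real u powr (w - 1)) = 1 / w" by (simp add: integral_unique)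
  thus "(\<integral>u. ?f u \<partial>pos_lborel) = 1 / w"
    by (simp add: integral_restrict_space set_lebesgue_integral_def eq del: scaleR_scaleR)
qed

lemma integral_powr_unit_real:
  fixes r :: real
  assumes r: "r > 0"
  shows "integrable pos_lborel (\<lambda>u. indicator {..1} u * u powr (r - 1))"
    and "(\<integral>u. indicator {..1} u * u powr (r - 1) \<partial>pos_lborel) = 1 / r"
proof -
  have p: "Re (complex_of_real r) > 0" using r by simp
  have eq: "indicator {..1} u *\<^sub>R complex_of_real u powr (of_real r - 1) = of_real (indicator {..1} u * u powr (r - 1))"
    if "u \<in> space pos_lborel" for u :: real
    using that powr_of_real[of u "r - 1"] by (simp add: scaleR_conv_of_real)
  have i: "integrable pos_lborel (\<lambda>u. complex_of_real (indicator {..1} u * u powr (r - 1)))"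
    using integral_powr_unit(1)[OF p] by (subst (asm) Bochner_Integration.integrable_cong[OF refl eq])
  from integrable_Re[OF this] show "integrable pos_lborel (\<lambda>u. indicator {..1} u * u powr (r - 1))" by simp
  have "(\<integral>u. complex_of_real (indicator {..1} u * u powr (r - 1)) \<partial>pos_lborel) = 1 / of_real r"
    using integral_powr_unit(2)[OF p] by (subst (asm) Bochner_Integration.integral_cong[OF refl eq])
  also have "\<dots> = of_real (1 / r)" by simp
  finally show "(\<integral>u. indicator {..1} u * u powr (r - 1) \<partial>pos_lborel) = 1 / r"
    by (simp only: integral_complex_of_real of_real_eq_iff)
qed

text \<open>Riemann's argument: the Mellin integral of 1 / (exp u - 1) is split at 1. The tail is
  entire in \<open>s\<close>. Near 0 the Bernoulli series integrates to a series of simple poles,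
  and \<open>rGamma s\<close> cancels all of them except the one at 1.\<close>

lemma ex_is_zeta: "\<exists>f. is_zeta f"
proof -
  obtain c :: "nat \<Rightarrow> complex" where c: "summable (\<lambda>n. norm (c n))"
    "\<And>u::real. 0 < u \<Longrightarrow> u \<le> 1 \<Longrightarrow> (\<lambda>n. c n * of_real u ^ n) sums (of_real u / (exp (of_real u) - 1))"
    by (rule bernoulli_expansion) blast
  define k where "k s u = indicator {1<..} u *\<^sub>R (of_real u powr (s - 1) / (exp (of_real u) - 1))" for s :: complex and u :: real
  define I where "I s = (\<integral>u. k s u \<partial>pos_lborel)" for s
  \<comment> \<open>This is rGamma s / (s + n), written without the division: in the product formula
    for \<open>rGamma s\<close> with n + 1 factors the factor s + n is left out. So it is
    entire.\<close>
  define g where "g n s = pochhammer s n * rGamma (s + of_nat (Suc n))" for n and s :: complex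
  have meask: "k s \<in> borel_measurable pos_lborel" for s
  proof -
    have "exp (complex_of_real u) \<noteq> 1" if "u > 0" for u using that by (simp add: exp_of_real)
    hence "(\<lambda>u. of_real u powr (s - 1) / (exp (complex_of_real u) - 1)) \<in> borel_measurable pos_lborel"
      by (intro borel_measurable_pos_lborel continuous_intros) auto
    thus ?thesis unfolding k_def
      by (intro borel_measurable_scaleR borel_measurable_indicator_pos_lborel) auto
  qed
  \<comment> \<open>Beyond 1 the exponential is at least 2, so exp u - 1 >= exp u / 2; the factor 2
    is this loss.\<close>
  have kbound: "norm (k s u) \<le> 2 * (u powr R * exp (- (1 * u)))" if "Re s \<le> R" "0 \<le> R" "u > 0" for s u R
  proof (cases "u > 1")
    case True
    have "2 \<le> exp u" using exp_ge_add_one_self[of u] True by linarith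
    hence e: "exp u / 2 \<le> exp u - 1" "0 < exp u - 1" using True by auto
    have "exp (complex_of_real u) - 1 = of_real (exp u - 1)" by (simp add: exp_of_real)
    hence "norm (exp (complex_of_real u) - 1) = exp u - 1" using e by (simp only: norm_of_real)
    hence "norm (k s u) = u powr (Re s - 1) / (exp u - 1)"
      using True by (simp add: k_def norm_divide norm_powr_real_powr)
    also have "\<dots> \<le> u powr R / (exp u / 2)"
      using True that e by (intro frac_le powr_mono) auto
    finally show ?thesis by (simp add: exp_minus field_simps)
  qed (auto simp: k_def)
  have I: "I holomorphic_on UNIV"
    unfolding I_def
  proof (rule holomorphic_on_integral_dominated)
    show "(\<lambda>s. k s u) holomorphic_on UNIV" if "u \<in> space pos_lborel" for u
      using that unfolding k_def scaleR_conv_of_real by (intro holomorphic_intros) (auto simp: exp_of_real)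
    fix s0 :: complex
    define R where "R = max 0 (Re s0 + 1)"
    have R: "Re s \<le> R" if "s \<in> ball s0 1" for s
      using that abs_Re_le_cmod[of "s0 - s"] by (simp add: dist_norm R_def)
    have "norm (k s u) \<le> 2 * (u powr R * exp (- (1 * u)))" if "s \<in> ball s0 1" "u > 0" for s u
      by (rule kbound) (use R that in \<open>auto simp: R_def\<close>)
    thus "\<exists>r>0. \<exists>h. integrable pos_lborel h \<and> (\<forall>z\<in>ball s0 r \<inter> UNIV. \<forall>u\<in>space pos_lborel. norm (k z u) \<le> h u)"
      by (intro exI[of _ 1] conjI exI[of _ "\<lambda>u. 2 * (u powr R * exp (- (1 * u)))"] Bochner_Integration.integrable_mult_right
          Gamma_integral_powr_exp(1)) (auto simp: R_def)
  qed (use meask in auto)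
  have intk: "integrable pos_lborel (k s)" for s
  proof (rule Bochner_Integration.integrable_bound[OF _ meask])
    show "integrable pos_lborel (\<lambda>u. 2 * (u powr max 0 (Re s) * exp (- (1 * u))))"
      by (intro Bochner_Integration.integrable_mult_right Gamma_integral_powr_exp(1)) auto
  qed (use kbound[of s "max 0 (Re s)"] in \<open>auto intro!: AE_I2\<close>)
  have gs: "rGamma s = (s + of_nat n) * g n s" for n s
    using pochhammer_rGamma[of s "Suc n"] by (simp add: g_def pochhammer_Suc mult_ac)
  have G: "(\<lambda>s. \<Sum>n. c (Suc n) * g n s) holomorphic_on UNIV"
  proof (rule holomorphic_on_suminf)
    show "(\<lambda>s. c (Suc n) * g n s) holomorphic_on UNIV" for n
      unfolding g_def pochhammer_prod by (intro holomorphic_intros)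
    fix s0 :: complex
    have "compact (rGamma ` cball s0 1)"
      by (intro compact_continuous_image holomorphic_on_imp_continuous_on holomorphic_rGamma) auto
    hence "bounded (rGamma ` cball s0 1)" by (rule compact_imp_bounded)
    then obtain B where "\<forall>x\<in>rGamma ` cball s0 1. norm x \<le> B" unfolding bounded_iff by (elim exE)
    hence B: "\<And>s. s \<in> cball s0 1 \<Longrightarrow> norm (rGamma s) \<le> B" by blast
    \<comment> \<open>On the unit disc around \<open>s0\<close> this makes |s + n| >= 1 for n >= N,
      so dividing \<open>rGamma s\<close> by s + n does not enlarge it.\<close>
    obtain N where N: "real N \<ge> norm s0 + 2" using real_arch_simple by blast
    have "norm (c (Suc n) * g n s) \<le> norm (c (Suc n)) * B" if s: "s \<in> ball s0 1" and n: "n \<ge> N" for s n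
    proof -
      have "norm s \<le> norm s0 + 1" using s norm_triangle_ineq2[of s s0] by (simp add: dist_norm norm_minus_commute)
      hence "1 \<le> norm (s + of_nat n)"
        using norm_triangle_ineq4[of "s + of_nat n" s] N n by simp
      hence "1 * norm (g n s) \<le> norm (s + of_nat n) * norm (g n s)" by (intro mult_right_mono) auto
      also have "\<dots> = norm (rGamma s)" by (subst gs[of s n]) (simp add: norm_mult)
      also have "\<dots> \<le> B" using B s by auto
      finally show ?thesis by (auto simp: norm_mult intro!: mult_left_mono)
    qed
    moreover have "summable (\<lambda>n. norm (c (Suc n)) * B)"
      using c(1) by (intro summable_mult2) (subst summable_Suc_iff)
    ultimately show "\<exists>r>0. \<exists>M N. summable M \<and> (\<forall>z\<in>ball s0 r \<inter> UNIV. \<forall>n\<ge>N. norm (c (Suc n) * g n z) \<le> M n)"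
      by (intro exI[of _ 1] conjI exI[of _ "\<lambda>n. norm (c (Suc n)) * B"] exI[of _ N]) auto
  qed auto
  \<comment> \<open>The tail, the term n = 0 with the only surviving pole, and the remaining terms
    with their poles cancelled.\<close>
  define F where "F s = rGamma s * I s + rGamma s * c 0 / (s - 1) + (\<Sum>n. c (Suc n) * g n s)" for s
  have F: "F holomorphic_on - {1}"
    unfolding F_def by (intro holomorphic_intros holomorphic_on_subset[OF I] holomorphic_on_subset[OF G]) auto
  have F_eq: "F s = (\<Sum>n. 1 / of_nat (Suc n) powr s)" if s: "Re s > 1" for s
  proof -
    define f where "f n u = c n * (indicator {..1} u *\<^sub>R of_real u powr (s - 1 + of_nat n - 1))" for n and u :: real
    have pos: "Re (s - 1 + of_nat n) > 0" for n using s by simp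
    have intf: "integrable pos_lborel (f n)" for n
      unfolding f_def by (intro Bochner_Integration.integrable_mult_right integral_powr_unit(1) pos)
    have intf2: "integral\<^sup>L pos_lborel (f n) = c n / (s - 1 + of_nat n)" for n
      unfolding f_def by (subst integral_mult_right_zero, subst integral_powr_unit(2)[OF pos]) simp
    have fu: "f n u = of_real u powr (s - 2) * (c n * of_real u ^ n)" if "0 < u" "u \<le> 1" for n u
    proof -
      have "of_real u powr (s - 1 + of_nat n - 1) = of_real u powr (s - 2) * complex_of_real u powr (of_nat n)"
        by (simp add: algebra_simps flip: powr_add)
      thus ?thesis using that by (simp add: f_def powr_nat)
    qed
    have sums: "(\<lambda>n. f n u) sums (indicator {..1} u *\<^sub>R (of_real u powr (s - 1) / (exp (of_real u) - 1)))" if u: "u > 0" for u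
    proof (cases "u \<le> 1")
      case True
      have "(\<lambda>n. of_real u powr (s - 2) * (c n * of_real u ^ n)) sums (of_real u powr (s - 2) * (of_real u / (exp (of_real u) - 1)))"
        using u True by (intro sums_mult c(2))
      moreover have "of_real u powr (s - 2) * complex_of_real u = of_real u powr (s - 1)"
        using u powr_add[of "complex_of_real u" "s - 2" 1] by simp
      ultimately show ?thesis using fu[OF u True] True by (simp add: mult.assoc [symmetric])
    qed (auto simp: f_def)
    have nint: "(\<integral>u. norm (f n u) \<partial>pos_lborel) \<le> norm (c n) * (1 / (Re s - 1))" for n
    proof -
      have i': "integrable pos_lborel (\<lambda>u. indicator {..1} u * u powr (Re s - 2))"
        and val: "(\<integral>u. indicator {..1} u * u powr (Re s - 2) \<partial>pos_lborel) = 1 / (Re s - 1)"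
        using integral_powr_unit_real[of "Re s - 1"] s by simp_all
      have "(\<integral>u. norm (f n u) \<partial>pos_lborel) \<le> (\<integral>u. norm (c n) * (indicator {..1} u * u powr (Re s - 2)) \<partial>pos_lborel)"
      proof (rule integral_mono)
        show "integrable pos_lborel (\<lambda>u. norm (f n u))" using intf by simp
        show "integrable pos_lborel (\<lambda>u. norm (c n) * (indicator {..1} u * u powr (Re s - 2)))" using i' by simp
        fix u assume "u \<in> space pos_lborel"
        hence u: "u > 0" by simp
        show "norm (f n u) \<le> norm (c n) * (indicator {..1} u * u powr (Re s - 2))"
        proof (cases "u \<le> 1")
          case True
          have "norm (f n u) = u powr (Re s - 2) * (norm (c n) * u ^ n)"
            using u True by (simp add: fu norm_mult norm_power norm_powr_real_powr)
          also have "\<dots> \<le> u powr (Re s - 2) * (norm (c n) * 1)"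
            using u True by (intro mult_left_mono power_le_one) auto
          finally show ?thesis using True by (simp add: mult_ac)
        qed (auto simp: f_def)
      qed
      thus ?thesis using val by simp
    qed
    have si: "summable (\<lambda>n. \<integral>u. norm (f n u) \<partial>pos_lborel)"
    proof (rule summable_comparison_test')
      show "summable (\<lambda>n. norm (c n) * (1 / (Re s - 1)))" using c(1) by (rule summable_mult2)
      show "norm (\<integral>u. norm (f n u) \<partial>pos_lborel) \<le> norm (c n) * (1 / (Re s - 1))" for n
        using nint[of n] by (simp add: integral_nonneg_AE)
    qed
    have ae: "AE u in pos_lborel. summable (\<lambda>n. norm (f n u))"
    proof (intro AE_I2)
      fix u assume "u \<in> space pos_lborel"
      hence u: "u > 0" by simp
      show "summable (\<lambda>n. norm (f n u))"
      proof (cases "u \<le> 1")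
        case True
        show ?thesis
        proof (rule summable_comparison_test')
          show "summable (\<lambda>n. norm (of_real u powr (s - 2)) * norm (c n))" using c(1) by (rule summable_mult)
          show "norm (norm (f n u)) \<le> norm (of_real u powr (s - 2)) * norm (c n)" for n
            using u True by (auto simp: fu norm_mult norm_power intro!: mult_left_mono mult_left_le power_le_one)
        qed
      qed (simp add: f_def)
    qed
    have summ: "summable (\<lambda>n. c n / (s - 1 + of_nat n))"
    proof -
      have "norm (c n / (s - 1 + of_nat n)) \<le> (\<integral>u. norm (f n u) \<partial>pos_lborel)" for n
        using integral_norm_bound[of pos_lborel "f n"] by (simp add: intf2)
      thus ?thesis by (intro summable_comparison_test'[OF si])
    qed
    have "Gamma s * (\<Sum>n. 1 / of_nat (Suc n) powr s) = (\<integral>u. of_real u powr (s - 1) / (exp (of_real u) - 1) \<partial>pos_lborel)"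
      using zeta_integral(2)[OF s] by simp
    also have "\<dots> = (\<integral>u. k s u + (\<Sum>n. f n u) \<partial>pos_lborel)"
    proof (intro Bochner_Integration.integral_cong refl)
      fix u assume "u \<in> space pos_lborel"
      thus "of_real u powr (s - 1) / (exp (of_real u) - 1) = k s u + (\<Sum>n. f n u)"
        using sums[of u] by (auto simp: sums_iff k_def indicator_def)
    qed
    also have "\<dots> = I s + (\<integral>u. (\<Sum>n. f n u) \<partial>pos_lborel)"
      unfolding I_def by (intro Bochner_Integration.integral_add intk integrable_suminf[OF intf ae si])
    also have "(\<integral>u. (\<Sum>n. f n u) \<partial>pos_lborel) = (\<Sum>n. c n / (s - 1 + of_nat n))"
      using integral_suminf[OF intf ae si] by (simp only: intf2)
    also have "\<dots> = c 0 / (s - 1) + (\<Sum>n. c (Suc n) / (s + of_nat n))"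
      using suminf_split_head[OF summ] by (simp add: algebra_simps)
    finally have eq: "Gamma s * (\<Sum>n. 1 / of_nat (Suc n) powr s) = I s + (c 0 / (s - 1) + (\<Sum>n. c (Suc n) / (s + of_nat n)))" .
    have "s \<notin> \<int>\<^sub>\<le>\<^sub>0" using s by (auto elim!: nonpos_Ints_cases)
    hence rG: "rGamma s * Gamma s = 1" by (simp add: rGamma_inverse_Gamma Gamma_eq_zero_iff)
    have summ2: "summable (\<lambda>n. c (Suc n) / (s + of_nat n))"
      using summ by (subst (asm) summable_Suc_iff[symmetric]) (simp add: algebra_simps)
    have "rGamma s * (\<Sum>n. c (Suc n) / (s + of_nat n)) = (\<Sum>n. c (Suc n) * g n s)"
    proof (subst suminf_mult[OF summ2, symmetric], rule suminf_cong)
      fix n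
      have "s + of_nat n \<noteq> 0" using s by (auto simp: complex_eq_iff)
      thus "rGamma s * (c (Suc n) / (s + of_nat n)) = c (Suc n) * g n s"
        by (subst gs[of s n]) simp
    qed
    hence "F s = rGamma s * (I s + (c 0 / (s - 1) + (\<Sum>n. c (Suc n) / (s + of_nat n))))"
      by (simp add: F_def ring_distribs)
    also have "\<dots> = (rGamma s * Gamma s) * (\<Sum>n. 1 / of_nat (Suc n) powr s)" by (simp only: eq [symmetric] mult.assoc)
    finally show ?thesis by (simp only: rG mult_1)
  qed
  have "is_zeta (\<lambda>s. if s = 1 then 0 else F s)"
    unfolding is_zeta_def
  proof (intro conjI allI impI)
    show "(\<lambda>s. if s = 1 then 0 else F s) holomorphic_on - {1}"
      using F by (rule holomorphic_transform) auto
  qed (use F_eq in auto)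
  thus ?thesis by blast
qed

text \<open>Uniqueness is analytic continuation from Re s > 1 over the punctured plane, which is
  connected; the prescribed value at 1 settles the last point.\<close>

lemma is_zeta_zeta: "is_zeta zeta"
proof -
  have "f = g" if f: "is_zeta f" and g: "is_zeta g" for f g
  proof
    fix s show "f s = g s"
    proof (cases "s = 1")
      case False
      show ?thesis
      proof (rule analytic_continuation_open[where s = "{s. Re s > 1}" and s' = "- {1}" and z = s])
        show "{s. Re s > 1} \<noteq> {}" by (auto intro!: exI[of _ 2])
        show "connected (- {1::complex})" by (intro connected_punctured_universe) auto
      qed (use f g False in \<open>auto simp: is_zeta_def open_halfspace_Re_gt\<close>)
    qed (use f g in \<open>auto simp: is_zeta_def\<close>)
  qed
  with ex_is_zeta have "\<exists>!f. is_zeta f" by blast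
  thus ?thesis unfolding zeta_def by (rule theI')
qed

lemma holomorphic_on_zeta: "1 \<notin> A \<Longrightarrow> zeta holomorphic_on A"
  using is_zeta_zeta holomorphic_on_subset unfolding is_zeta_def by blast

lemma zeta_eq_suminf: "Re s > 1 \<Longrightarrow> zeta s = (\<Sum>n. 1 / of_nat (Suc n) powr s)"
  using is_zeta_zeta unfolding is_zeta_def by blast

section \<open>Reciprocal Gamma series and the hypergeometric term\<close>

text \<open>
  The even part in \<open>x\<close> is, up to the factor \<open>Gamma (1 - a)\<close>, the hypergeometric series of the
  theorem at \<open>x\<^sup>2 / 4\<close>. Unlike these two, it is entire in \<open>a\<close>.
\<close>

definition rGamma_series_exp :: "complex \<Rightarrow> complex \<Rightarrow> complex" where
  "rGamma_series_exp a x = (\<Sum>n. rGamma (of_nat n + 1 - a) * x ^ n)"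

text \<open>The factor z + k has real part at least k + 1. This is the source of the factorial decay
  of reciprocal Gamma values.\<close>

lemma norm_pochhammer_ge_fact:
  fixes z :: complex
  assumes "Re z \<ge> 1"
  shows "norm (pochhammer z n) \<ge> fact n"
proof (induction n)
  case (Suc n)
  have "real (Suc n) \<le> Re (z + of_nat n)" using assms by simp
  also have "\<dots> \<le> norm (z + of_nat n)" by (rule complex_Re_le_cmod)
  finally have "fact n * real (Suc n) \<le> norm (pochhammer z n) * norm (z + of_nat n)"
    using Suc.IH by (intro mult_mono) auto
  thus ?case by (simp add: pochhammer_Suc norm_mult mult.commute)
qed auto

text \<open>Starting from an index \<open>N\<close> at which the argument has real part at least 1
  on the whole ball, the functional equation divides by a Pochhammer symbol of size at least (n -
  N)!. Compactness bounds the starting value.\<close>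

lemma norm_rGamma_bound:
  fixes a0 :: complex
  obtains C N where "C \<ge> 0" "\<And>a n. a \<in> ball a0 1 \<Longrightarrow> n \<ge> N \<Longrightarrow> norm (rGamma (of_nat n + 1 - a)) \<le> C / fact (n - N)"
proof -
  obtain N where N: "real N \<ge> norm a0 + 2" using real_arch_simple by blast
  have "compact ((\<lambda>a. rGamma (of_nat N + 1 - a)) ` cball a0 1)"
    by (intro compact_continuous_image holomorphic_on_imp_continuous_on holomorphic_intros) auto
  hence "bounded ((\<lambda>a. rGamma (of_nat N + 1 - a)) ` cball a0 1)" by (rule compact_imp_bounded)
  then obtain C where C: "\<forall>x\<in>(\<lambda>a. rGamma (of_nat N + 1 - a)) ` cball a0 1. norm x \<le> C"
    unfolding bounded_iff by (elim exE)
  show thesis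
  proof (rule that[of "max C 0" N])
    fix a n assume a: "a \<in> ball a0 1" and n: "n \<ge> N"
    define z where "z = of_nat N + 1 - a"
    have "norm a \<le> norm a0 + 1" using a norm_triangle_ineq2[of a a0] by (simp add: dist_norm norm_minus_commute)
    hence z: "Re z \<ge> 1" using N complex_Re_le_cmod[of a] by (simp add: z_def)
    have eq: "of_nat n + 1 - a = z + of_nat (n - N)" using n by (simp add: z_def of_nat_diff)
    have "fact (n - N) * norm (rGamma (of_nat n + 1 - a)) \<le> norm (pochhammer z (n - N)) * norm (rGamma (of_nat n + 1 - a))"
      by (intro mult_right_mono norm_pochhammer_ge_fact z) auto
    also have "\<dots> = norm (rGamma z)"
      unfolding eq by (metis norm_mult pochhammer_rGamma)
    also have "\<dots> \<le> max C 0" using C a by (auto simp: z_def less_imp_le intro: max.coboundedI1)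
    finally show "norm (rGamma (of_nat n + 1 - a)) \<le> max C 0 / fact (n - N)"
      by (simp add: field_simps)
  qed auto
qed

lemma summable_pow_over_fact_shift: "summable (\<lambda>n. C / fact (n - N) * x ^ n)" for x C :: real
proof -
  have "summable (\<lambda>n. C * x ^ N * (inverse (fact n) * x ^ n))" by (intro summable_mult summable_exp)
  hence "summable (\<lambda>n. C / fact (n + N - N) * x ^ (n + N))"
    by (simp add: power_add divide_inverse mult_ac)
  thus ?thesis by (rule summable_offset)
qed

lemma summable_rGamma_series_exp:
  fixes a x :: complex
  shows "summable (\<lambda>n. norm (rGamma (of_nat n + 1 - a) * x ^ n))"
proof -
  obtain C N where C: "C \<ge> 0" "\<And>b n. b \<in> ball a 1 \<Longrightarrow> n \<ge> N \<Longrightarrow> norm (rGamma (of_nat n + 1 - b)) \<le> C / fact (n - N)"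
    by (rule norm_rGamma_bound[of a]) blast
  show ?thesis
  proof (rule summable_comparison_test'[OF summable_pow_over_fact_shift[of C N "norm x"], of N])
    show "norm (norm (rGamma (of_nat n + 1 - a) * x ^ n)) \<le> C / fact (n - N) * norm x ^ n" if "n \<ge> N" for n
      using mult_right_mono[OF C(2)[of a n], of "norm x ^ n"] that by (simp add: norm_mult norm_power)
  qed
qed

lemma holomorphic_on_rGamma_series_exp: "(\<lambda>a. rGamma_series_exp a x) holomorphic_on UNIV"
  unfolding rGamma_series_exp_def
proof (rule holomorphic_on_suminf)
  fix a0 :: complex
  obtain C N where C: "C \<ge> 0" "\<And>b n. b \<in> ball a0 1 \<Longrightarrow> n \<ge> N \<Longrightarrow> norm (rGamma (of_nat n + 1 - b)) \<le> C / fact (n - N)"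
    by (rule norm_rGamma_bound[of a0]) blast
  have "norm (rGamma (of_nat n + 1 - b) * x ^ n) \<le> C / fact (n - N) * norm x ^ n" if "b \<in> ball a0 1" "n \<ge> N" for b n
    using mult_right_mono[OF C(2)[OF that], of "norm x ^ n"] by (simp add: norm_mult norm_power)
  thus "\<exists>r>0. \<exists>M N. summable M \<and> (\<forall>z\<in>ball a0 r \<inter> UNIV. \<forall>n\<ge>N. norm (rGamma (of_nat n + 1 - z) * x ^ n) \<le> M n)"
    by (intro exI[of _ 1] conjI exI[of _ "\<lambda>n. C / fact (n - N) * norm x ^ n"] exI[of _ N] summable_pow_over_fact_shift) auto
qed (auto intro!: holomorphic_intros)

text \<open>Since (n - a) / Gamma (n + 1 - a) = 1 / Gamma (n - a), the operator x d/dx - a shifts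
  the coefficients by one. The result is a linear first-order equation for this Mittag-Leffler
  function, which is exp for a = 0.\<close>

lemma DERIV_rGamma_series_exp:
  "\<exists>D. (rGamma_series_exp a has_field_derivative D) (at x) \<and> x * D - a * rGamma_series_exp a x = rGamma (- a) + x * rGamma_series_exp a x"
proof -
  define c where "c n = rGamma (of_nat n + 1 - a)" for n
  have summ: "summable (\<lambda>n. c n * y ^ n)" for y
    unfolding c_def by (rule summable_norm_cancel, rule summable_rGamma_series_exp)
  have D: "(rGamma_series_exp a has_field_derivative (\<Sum>n. diffs c n * x ^ n)) (at x)"
    using termdiffs_strong_converges_everywhere[OF summ] by (simp add: rGamma_series_exp_def[abs_def] c_def[abs_def])
  have summ_d: "summable (\<lambda>n. diffs c n * x ^ n)"
    by (rule termdiff_converges_all[OF summ])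
  have "x * (\<Sum>n. diffs c n * x ^ n) = (\<Sum>n. of_nat (Suc n) * c (Suc n) * x ^ Suc n)"
    using suminf_mult[OF summ_d, of x] by (simp add: diffs_def mult_ac)
  also have "\<dots> = (\<Sum>n. of_nat n * c n * x ^ n)"
  proof -
    have "summable (\<lambda>n. of_nat (Suc n) * c (Suc n) * x ^ Suc n)"
      using summable_mult[OF summ_d, of x] by (simp add: diffs_def mult_ac)
    hence "summable (\<lambda>n. of_nat n * c n * x ^ n)" by (subst (asm) summable_Suc_iff)
    from suminf_split_head[OF this] show ?thesis by simp
  qed
  finally have 1: "x * (\<Sum>n. diffs c n * x ^ n) = (\<Sum>n. of_nat n * c n * x ^ n)" .
  have summ_n: "summable (\<lambda>n. of_nat n * c n * x ^ n)"
  proof -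
    have "summable (\<lambda>n. of_nat (Suc n) * c (Suc n) * x ^ Suc n)"
      using summable_mult[OF summ_d, of x] by (simp add: diffs_def mult_ac)
    thus ?thesis by (subst (asm) summable_Suc_iff)
  qed
  have 2: "(of_nat n - a) * c n = rGamma (of_nat n - a)" for n
    using rGamma_plus1[of "of_nat n - a"] by (simp add: c_def algebra_simps)
  have s3: "summable (\<lambda>n. rGamma (of_nat n - a) * x ^ n)"
    using summable_diff[OF summ_n summable_mult[OF summ, of a]]
    by (simp add: algebra_simps flip: 2)
  have "x * (\<Sum>n. diffs c n * x ^ n) - a * rGamma_series_exp a x = (\<Sum>n. rGamma (of_nat n - a) * x ^ n)"
    unfolding 1 rGamma_series_exp_def c_def[symmetric]
    using suminf_diff[OF summ_n summable_mult[OF summ, of a x]] suminf_mult[OF summ, of a x]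
    by (simp add: algebra_simps flip: 2)
  also have "\<dots> = rGamma (- a) + (\<Sum>n. x * (c n * x ^ n))"
    using suminf_split_head[OF s3] by (simp add: c_def algebra_simps)
  also have "(\<Sum>n. x * (c n * x ^ n)) = x * rGamma_series_exp a x"
    unfolding rGamma_series_exp_def c_def[symmetric] by (rule suminf_mult[OF summ])
  finally show ?thesis using D by blast
qed

section \<open>Stieltjes integrals and the reciprocal Gamma series\<close>

lemma sin_pi_neq_0: "-1 < Re a \<Longrightarrow> Re a < 0 \<Longrightarrow> sin (of_real pi * a) \<noteq> (0::complex)"
proof
  assume a: "-1 < Re a" "Re a < 0" "sin (of_real pi * a) = 0"
  then obtain n :: int where "of_real pi * a = of_real (of_int n * pi)" by (auto simp: sin_eq_0)
  hence "of_real pi * a = of_real pi * of_int n" by (simp add: mult.commute)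
  hence "a = of_int n" by (subst (asm) mult_cancel_left) auto
  with a show False by auto
qed

text \<open>The Laplace transform in \<open>z\<close> of u^a / (u + Z). At z = 0 it becomes the
  Mellin integral, which supplies the initial value for a differential equation in
  \<open>z\<close>.\<close>

definition Stieltjes_integral :: "complex \<Rightarrow> complex \<Rightarrow> complex \<Rightarrow> complex" where
  "Stieltjes_integral a Z z = (\<integral>u. of_real u powr a * exp (- (z * of_real u)) / (of_real u + Z) \<partial>pos_lborel)"

text \<open>One majorant serves the whole closed half-plane Re z >= 0. It justifies both
  differentiation in \<open>z\<close> and the limit z -> 0.\<close>

lemma integrable_Stieltjes_bound:
  assumes a: "-1 < Re a" "Re a < 0" and Z: "Z \<notin> \<real>\<^sub>\<le>\<^sub>0"
  obtains h where "integrable pos_lborel h"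
    "\<And>z u. Re z \<ge> 0 \<Longrightarrow> u > 0 \<Longrightarrow> norm (of_real u powr a * exp (- (z * of_real u)) / (of_real u + Z)) \<le> h u"
proof -
  from Z obtain \<kappa> where \<kappa>: "\<kappa> > 0" "\<And>w u. w \<in> ball Z \<kappa> \<Longrightarrow> u \<ge> 0 \<Longrightarrow> norm (of_real u + w) \<ge> \<kappa> * (1 + u)"
    by (rule norm_add_of_real_ge) blast
  show thesis
  proof (rule that[of "\<lambda>u. 1 / \<kappa> * (u powr Re a / (1 + u) powr 1)"])
    show "integrable pos_lborel (\<lambda>u. 1 / \<kappa> * (u powr Re a / (1 + u) powr 1))"
      using a by (intro Bochner_Integration.integrable_mult_right integrable_powr_over) auto
    fix z :: complex and u :: real assume z: "Re z \<ge> 0" and u: "u > 0"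
    have 1: "0 < \<kappa> * (1 + u)" "\<kappa> * (1 + u) \<le> norm (of_real u + Z)"
      using \<kappa>(2)[of Z u] \<kappa>(1) u by auto
    have "norm (of_real u powr a * exp (- (z * of_real u)) / (of_real u + Z)) =
        u powr Re a * exp (- (Re z * u)) / norm (of_real u + Z)"
      using u by (simp only: norm_divide norm_powr_exp)
    also have "\<dots> \<le> u powr Re a * 1 / (\<kappa> * (1 + u))"
      using 1 z u by (intro frac_le mult_left_mono) auto
    finally show "norm (of_real u powr a * exp (- (z * of_real u)) / (of_real u + Z)) \<le> 1 / \<kappa> * (u powr Re a / (1 + u) powr 1)"
      using u by (simp add: mult.commute)
  qed
qed

lemma add_of_real_neq_0: "u > 0 \<Longrightarrow> Z \<notin> \<real>\<^sub>\<le>\<^sub>0 \<Longrightarrow> of_real u + Z \<noteq> 0" for Z :: complex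
  by (auto simp: complex_nonpos_Reals_iff complex_eq_iff)

text \<open>Differentiation brings down -u = Z - (u + Z). The first part reproduces the integral;
  the second cancels the denominator and leaves a Gamma integral.\<close>

lemma DERIV_Stieltjes_integral:
  assumes a: "-1 < Re a" "Re a < 0" and Z: "Z \<notin> \<real>\<^sub>\<le>\<^sub>0" and z: "Re z > 0"
  shows "(Stieltjes_integral a Z has_field_derivative (Z * Stieltjes_integral a Z z - Gamma (a + 1) * z powr (- a - 1))) (at z)"
proof -
  define f where "f z u = of_real u powr a * exp (- (z * of_real u)) / (of_real u + Z)" for z and u :: real
  obtain h where h: "integrable pos_lborel h"
    "\<And>z u. Re z \<ge> 0 \<Longrightarrow> u > 0 \<Longrightarrow> norm (of_real u powr a * exp (- (z * of_real u)) / (of_real u + Z)) \<le> h u"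
    by (rule integrable_Stieltjes_bound[OF a Z]) blast
  have meas: "f w \<in> borel_measurable pos_lborel" for w
    using Z unfolding f_def by (intro borel_measurable_pos_lborel continuous_intros) (auto simp: add_of_real_neq_0)
  have Re: "Re w \<ge> 0" if "w \<in> ball z (Re z)" for w
    using that abs_Re_le_cmod[of "z - w"] by (simp add: dist_norm)
  have int: "integrable pos_lborel (f z)"
    by (rule Bochner_Integration.integrable_bound[OF h(1) meas])
       (use h(2)[of z] z in \<open>auto intro!: AE_I2 order_trans[OF _ abs_ge_self] simp: f_def\<close>)
  have d: "((\<lambda>z. f z u) has_field_derivative (Z * f w u - of_real u powr (a + 1 - 1) * exp (- (w * of_real u)))) (at w)"
    if "u > 0" for u w
  proof -
    have "of_real u + Z \<noteq> 0" using that Z by (rule add_of_real_neq_0)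
    define P where "P = complex_of_real u powr a"
    have "((\<lambda>z. exp (- (z * of_real u))) has_field_derivative exp (- (w * of_real u)) * (- of_real u)) (at w)"
      by (auto intro!: derivative_eq_intros)
    hence "((\<lambda>z. P * exp (- (z * of_real u)) / (of_real u + Z)) has_field_derivative
        P * (exp (- (w * of_real u)) * (- of_real u)) / (of_real u + Z)) (at w)"
      by (intro DERIV_cdivide DERIV_cmult)
    also have "P * (exp (- (w * of_real u)) * (- of_real u)) / (of_real u + Z) =
        Z * (P * exp (- (w * of_real u)) / (of_real u + Z)) - P * exp (- (w * of_real u))"
      using \<open>of_real u + Z \<noteq> 0\<close> by (simp add: field_simps)
    finally show ?thesis by (simp add: f_def P_def)
  qed
  have "((\<lambda>w. \<integral>u. f w u \<partial>pos_lborel) has_field_derivative (\<integral>u. deriv (\<lambda>w. f w u) z \<partial>pos_lborel)) (at z)"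
  proof (rule has_field_derivative_integral_dominated[OF z _ meas h(1)])
    show "(\<lambda>w. f w u) holomorphic_on ball z (Re z)" if "u \<in> space pos_lborel" for u
      using d[of u] that by (intro holomorphic_onI) (auto simp: field_differentiable_def intro: has_field_derivative_at_within)
    show "norm (f w u) \<le> h u" if "w \<in> ball z (Re z)" "u \<in> space pos_lborel" for w u
      using h(2)[OF Re[OF that(1)], of u] that(2) by (simp add: f_def)
  qed
  also have "(\<integral>u. deriv (\<lambda>w. f w u) z \<partial>pos_lborel) = (\<integral>u. Z * f z u - of_real u powr (a + 1 - 1) * exp (- (z * of_real u)) \<partial>pos_lborel)"
    by (intro Bochner_Integration.integral_cong refl DERIV_imp_deriv d) auto
  also have "\<dots> = Z * (\<integral>u. f z u \<partial>pos_lborel) - (\<integral>u. of_real u powr (a + 1 - 1) * exp (- (z * of_real u)) \<partial>pos_lborel)"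
    using a z int by (subst Bochner_Integration.integral_diff) (auto intro!: integrable_powr_exp)
  also have "(\<integral>u. of_real u powr (a + 1 - 1) * exp (- (z * of_real u)) \<partial>pos_lborel) = Gamma (a + 1) * z powr (- (a + 1))"
    using a z by (intro Gamma_integral_complex_scale) auto
  finally show ?thesis by (simp add: Stieltjes_integral_def[abs_def] f_def)
qed

text \<open>Up to a constant factor, z^(-a) times the series and the Stieltjes integral solve the
  same inhomogeneous linear equation in \<open>z\<close>. They therefore differ by a multiple of exp
  (z Z), and letting z -> 0 along the positive reals determines it: z^(-a) vanishes there because Re
  a < 0.\<close>

lemma rGamma_series_exp_eq_Stieltjes:
  assumes a: "-1 < Re a" "Re a < 0" and Z: "Z \<notin> \<real>\<^sub>\<le>\<^sub>0" and z: "Re z > 0"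
  shows "z powr (- a) * rGamma_series_exp a (z * Z) = Z powr a * exp (z * Z) + sin (of_real pi * a) / of_real pi * Stieltjes_integral a Z z"
proof -
  define s where "s = of_real pi / sin (of_real pi * a)"
  have s0: "sin (of_real pi * a) \<noteq> 0" by (rule sin_pi_neq_0[OF a])
  \<comment> \<open>The reflection formula makes the inhomogeneous terms of the two differential
    equations agree.\<close>
  have GG: "Gamma (a + 1) = - s * rGamma (- a)"
  proof -
    have "- a \<notin> \<int>\<^sub>\<le>\<^sub>0" using a by (auto elim!: nonpos_Ints_cases simp: complex_eq_iff)
    hence "Gamma (- a) * rGamma (- a) = 1" by (simp add: rGamma_inverse_Gamma Gamma_eq_zero_iff)
    hence "Gamma (a + 1) = Gamma (a + 1) * Gamma (- a) * rGamma (- a)" by simp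
    thus ?thesis by (simp add: Gamma_mult_Gamma_minus s_def)
  qed
  \<comment> \<open>The factor exp (- z Z) is the integrating factor of the homogeneous equation, so
    \<open>W\<close> has derivative 0.\<close>
  define W where "W z = exp (- z * Z) * (Stieltjes_integral a Z z - s * (z powr (- a) * rGamma_series_exp a (z * Z)))" for z
  have DW: "(W has_field_derivative 0) (at z)" if z: "Re z > 0" for z
  proof -
    obtain D where D: "(rGamma_series_exp a has_field_derivative D) (at (z * Z))"
      "z * Z * D - a * rGamma_series_exp a (z * Z) = rGamma (- a) + z * Z * rGamma_series_exp a (z * Z)"
      using DERIV_rGamma_series_exp by blast
    have nz: "z \<notin> \<real>\<^sub>\<le>\<^sub>0" "z \<noteq> 0" using z by (auto simp: complex_nonpos_Reals_iff)
    have "((\<lambda>w. w * Z) has_field_derivative Z) (at z)" by (auto intro!: derivative_eq_intros)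
    from DERIV_chain2[OF D(1) this]
    have D': "((\<lambda>z. rGamma_series_exp a (z * Z)) has_field_derivative D * Z) (at z)" by simp
    define P where "P = z powr (- a - 1)"
    have P: "z powr (- a) = z * P" using nz powr_add[of z "- a - 1" 1] by (simp add: P_def mult.commute)
    have "((\<lambda>z. z powr (- a) * rGamma_series_exp a (z * Z)) has_field_derivative
        (- a * P * rGamma_series_exp a (z * Z) + D * Z * (z * P))) (at z)"
      unfolding P[symmetric] unfolding P_def by (rule DERIV_mult D' has_field_derivative_powr nz)+
    also have "- a * P * rGamma_series_exp a (z * Z) + D * Z * (z * P) = P * (z * Z * D - a * rGamma_series_exp a (z * Z))"
      by (simp add: algebra_simps)
    also have "\<dots> = P * rGamma (- a) + Z * (z powr (- a) * rGamma_series_exp a (z * Z))"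
      unfolding D(2) P by (simp add: algebra_simps)
    finally have 1: "((\<lambda>z. z powr (- a) * rGamma_series_exp a (z * Z)) has_field_derivative
        (P * rGamma (- a) + Z * (z powr (- a) * rGamma_series_exp a (z * Z)))) (at z)" .
    have 2: "((\<lambda>z. exp (- z * Z)) has_field_derivative (- Z * exp (- z * Z))) (at z)"
      by (auto intro!: derivative_eq_intros)
    have "(W has_field_derivative (- Z * exp (- z * Z)) * (Stieltjes_integral a Z z - s * (z powr (- a) * rGamma_series_exp a (z * Z)))
        + ((Z * Stieltjes_integral a Z z - Gamma (a + 1) * z powr (- a - 1)) - s * (P * rGamma (- a) + Z * (z powr (- a) * rGamma_series_exp a (z * Z)))) * exp (- z * Z)) (at z)"
      unfolding W_def[abs_def]
      by (rule DERIV_mult[OF 2] DERIV_diff DERIV_cmult DERIV_Stieltjes_integral[OF a Z z] 1)+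
    also have "(- Z * exp (- z * Z)) * (Stieltjes_integral a Z z - s * (z powr (- a) * rGamma_series_exp a (z * Z)))
        + ((Z * Stieltjes_integral a Z z - Gamma (a + 1) * z powr (- a - 1)) - s * (P * rGamma (- a) + Z * (z powr (- a) * rGamma_series_exp a (z * Z)))) * exp (- z * Z) = 0"
      unfolding GG P_def by (simp add: algebra_simps)
    finally show ?thesis .
  qed
  obtain C where C: "\<And>z. Re z > 0 \<Longrightarrow> W z = C"
  proof -
    have "\<exists>c. \<forall>x\<in>{z. Re z > 0}. W x = c"
      by (rule has_field_derivative_zero_constant[OF convex_halfspace_Re_gt])
         (use DW in \<open>auto intro: has_field_derivative_at_within\<close>)
    thus ?thesis using that by blast
  qed
  define X where "X n = complex_of_real (1 / real (Suc n))" for n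
  have ReX: "Re (X n) > 0" for n by (simp add: X_def)
  have "(\<lambda>n. complex_of_real (1 / real (Suc n))) \<longlonglongrightarrow> complex_of_real 0"
    using LIMSEQ_inverse_real_of_nat by (intro tendsto_of_real) (simp add: inverse_eq_divide)
  hence X0: "X \<longlonglongrightarrow> 0" by (simp add: X_def[abs_def])
  have "(\<lambda>n. W (X n)) \<longlonglongrightarrow> exp (- 0 * Z) * (- of_real pi / sin (of_real pi * a) * Z powr a - s * (0 * rGamma_series_exp a (0 * Z)))"
    unfolding W_def
  proof (intro tendsto_intros X0)
    obtain h where h: "integrable pos_lborel h"
      "\<And>z u. Re z \<ge> 0 \<Longrightarrow> u > 0 \<Longrightarrow> norm (of_real u powr a * exp (- (z * of_real u)) / (of_real u + Z)) \<le> h u"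
      by (rule integrable_Stieltjes_bound[OF a Z]) blast
    have "(\<lambda>n. Stieltjes_integral a Z (X n)) \<longlonglongrightarrow> (\<integral>u. of_real u powr a / (of_real u + Z) \<partial>pos_lborel)"
      unfolding Stieltjes_integral_def
    proof (rule integral_dominated_convergence[OF _ _ h(1)])
      show "AE u in pos_lborel. (\<lambda>n. of_real u powr a * exp (- (X n * of_real u)) / (of_real u + Z)) \<longlonglongrightarrow> of_real u powr a / (of_real u + Z)"
      proof (intro AE_I2)
        fix u assume "u \<in> space pos_lborel"
        hence "of_real u + Z \<noteq> 0" using Z by (intro add_of_real_neq_0) auto
        hence "(\<lambda>n. of_real u powr a * exp (- (X n * of_real u)) / (of_real u + Z)) \<longlonglongrightarrow> of_real u powr a * exp (- (0 * of_real u)) / (of_real u + Z)"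
          by (intro tendsto_intros X0)
        thus "(\<lambda>n. of_real u powr a * exp (- (X n * of_real u)) / (of_real u + Z)) \<longlonglongrightarrow> of_real u powr a / (of_real u + Z)" by simp
      qed
      show "AE u in pos_lborel. norm (of_real u powr a * exp (- (X n * of_real u)) / (of_real u + Z)) \<le> h u" for n
        using h(2)[of "X n"] ReX[of n] by (intro AE_I2) auto
    qed (use Z in \<open>auto intro!: borel_measurable_pos_lborel continuous_intros simp: add_of_real_neq_0\<close>)
    thus "(\<lambda>n. Stieltjes_integral a Z (X n)) \<longlonglongrightarrow> - of_real pi / sin (of_real pi * a) * Z powr a"
      by (simp only: Mellin_integral[OF a Z])
    have "(\<lambda>n. (1 / real (Suc n)) powr (- Re a)) \<longlonglongrightarrow> 0 powr (- Re a)"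
      using LIMSEQ_inverse_real_of_nat a by (intro tendsto_powr' tendsto_intros) (auto simp: inverse_eq_divide)
    hence "(\<lambda>n. norm (X n powr (- a))) \<longlonglongrightarrow> 0"
      by (simp add: X_def norm_powr_real_powr del: of_nat_Suc)
    thus "(\<lambda>n. X n powr (- a)) \<longlonglongrightarrow> 0" by (rule tendsto_norm_zero_cancel)
    have "isCont (rGamma_series_exp a) (0 * Z)"
      using DERIV_rGamma_series_exp DERIV_isCont by blast
    moreover have "(\<lambda>n. X n * Z) \<longlonglongrightarrow> 0 * Z" by (intro tendsto_intros X0)
    ultimately show "(\<lambda>n. rGamma_series_exp a (X n * Z)) \<longlonglongrightarrow> rGamma_series_exp a (0 * Z)"
      by (rule isCont_tendsto_compose)
  qed
  hence "C = - s * Z powr a" using C[OF ReX] by (simp add: LIMSEQ_const_iff s_def)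
  hence "W z = - s * Z powr a" using C z by simp
  hence "exp (z * Z) * W z = - s * Z powr a * exp (z * Z)" by (simp add: mult_ac)
  hence "Stieltjes_integral a Z z - s * (z powr (- a) * rGamma_series_exp a (z * Z)) = - s * Z powr a * exp (z * Z)"
    unfolding W_def by (simp add: exp_minus mult.assoc [symmetric])
  hence "s * (z powr (- a) * rGamma_series_exp a (z * Z)) = s * (Z powr a * exp (z * Z) + Stieltjes_integral a Z z / s)"
    using s0 by (simp add: s_def field_simps)
  hence "z powr (- a) * rGamma_series_exp a (z * Z) = Z powr a * exp (z * Z) + Stieltjes_integral a Z z / s"
    using s0 by (simp add: s_def)
  thus ?thesis by (simp add: s_def field_simps)
qed

section \<open>Quadratic denominators and the even part of the Stieltjes integral\<close>

lemma norm_add_mult_of_real_ge: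
  fixes Z :: complex
  assumes "Z \<notin> \<real>\<^sub>\<le>\<^sub>0"
  obtains \<kappa> where "\<kappa> > 0" "\<And>u d. u \<ge> 0 \<Longrightarrow> d > 0 \<Longrightarrow> norm (of_real u + of_real d * Z) \<ge> \<kappa> * (u + d)"
proof -
  from assms obtain \<kappa> where \<kappa>: "\<kappa> > 0" "\<And>w u. w \<in> ball Z \<kappa> \<Longrightarrow> u \<ge> 0 \<Longrightarrow> norm (of_real u + w) \<ge> \<kappa> * (1 + u)"
    by (rule norm_add_of_real_ge) blast
  show thesis
  proof (rule that[OF \<kappa>(1)])
    fix u d :: real assume u: "u \<ge> 0" and d: "d > 0"
    have "\<kappa> * (u + d) = d * (\<kappa> * (1 + u / d))" using d by (simp add: field_simps)
    also have "\<dots> \<le> d * norm (of_real (u / d) + Z)"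
      using \<kappa>(2)[of Z "u / d"] \<kappa>(1) u d by (intro mult_left_mono) auto
    also have "\<dots> = norm (of_real d * (of_real (u / d) + Z))" using d by (simp add: norm_mult)
    also have "of_real d * (of_real (u / d) + Z) = of_real u + of_real d * Z" using d by (simp add: field_simps)
    finally show "\<kappa> * (u + d) \<le> norm (of_real u + of_real d * Z)" .
  qed
qed

text \<open>The difference of squares factors into u + d Z and u - d Z; each factor is bounded below
  linearly, which is why both \<open>Z\<close> and \<open>- Z\<close> have to avoid the negative
  axis.\<close>

lemma norm_diff_squares_ge:
  fixes Z :: complex
  assumes "Z \<notin> \<real>\<^sub>\<le>\<^sub>0" "- Z \<notin> \<real>\<^sub>\<le>\<^sub>0"
  obtains \<kappa> where "\<kappa> > 0" "\<And>u d. u \<ge> 0 \<Longrightarrow> d > 0 \<Longrightarrow> norm (of_real u ^ 2 - (of_real d * Z) ^ 2) \<ge> \<kappa> * (u + d) ^ 2"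
proof -
  obtain \<kappa>1 where 1: "\<kappa>1 > 0" "\<And>u d. u \<ge> 0 \<Longrightarrow> d > 0 \<Longrightarrow> norm (of_real u + of_real d * Z) \<ge> \<kappa>1 * (u + d)"
    using assms(1) by (rule norm_add_mult_of_real_ge) blast
  obtain \<kappa>2 where 2: "\<kappa>2 > 0" "\<And>u d. u \<ge> 0 \<Longrightarrow> d > 0 \<Longrightarrow> norm (of_real u + of_real d * (- Z)) \<ge> \<kappa>2 * (u + d)"
    using assms(2) by (rule norm_add_mult_of_real_ge) blast
  show thesis
  proof (rule that[of "\<kappa>1 * \<kappa>2"])
    fix u d :: real assume u: "u \<ge> 0" and d: "d > 0"
    have "\<kappa>1 * \<kappa>2 * (u + d) ^ 2 = \<kappa>1 * (u + d) * (\<kappa>2 * (u + d))" by (simp add: power2_eq_square)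
    also have "\<dots> \<le> norm (of_real u + of_real d * Z) * norm (of_real u + of_real d * (- Z))"
      using 1(1) 2(1) u d by (intro mult_mono 1(2) 2(2)) auto
    also have "\<dots> = norm (of_real u ^ 2 - (of_real d * Z) ^ 2)"
      by (simp add: norm_mult [symmetric] power2_eq_square algebra_simps)
    finally show "\<kappa>1 * \<kappa>2 * (u + d) ^ 2 \<le> norm (of_real u ^ 2 - (of_real d * Z) ^ 2)" .
  qed (use 1 2 in auto)
qed

text \<open>The even part in \<open>Z\<close> of the Stieltjes integral, from 1 / (u + Z) + 1 / (u -
  Z) = 2 u / (u^2 - Z^2). The gained factor u extends convergence at 0 to Re a > -2.\<close>

definition Phi :: "complex \<Rightarrow> complex \<Rightarrow> complex \<Rightarrow> complex" where
  "Phi a Z z = (\<integral>u. of_real u powr (a + 1) * exp (- (z * of_real u)) / (of_real u ^ 2 - Z ^ 2) \<partial>pos_lborel)"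

lemma not_nonpos_Reals_Im: "Im Z \<noteq> 0 \<Longrightarrow> Z \<notin> \<real>\<^sub>\<le>\<^sub>0"
  by (auto simp: complex_nonpos_Reals_iff)

lemma diff_squares_neq_0:
  fixes Z :: complex
  assumes "Im Z \<noteq> 0" "u > 0" shows "of_real u ^ 2 - Z ^ 2 \<noteq> 0"
proof -
  have "of_real u + Z \<noteq> 0" "of_real u + - Z \<noteq> 0"
    using assms by (intro add_of_real_neq_0 not_nonpos_Reals_Im; simp)+
  moreover have "of_real u ^ 2 - Z ^ 2 = (of_real u + Z) * (of_real u + - Z)"
    by (simp add: power2_eq_square algebra_simps)
  ultimately show ?thesis by simp
qed

lemma Phi_integrand_measurable:
  assumes Z: "Im Z \<noteq> 0"
  shows "(\<lambda>u. of_real u powr (a + 1) * exp (- (z * of_real u)) / (of_real u ^ 2 - Z ^ 2)) \<in> borel_measurable pos_lborel"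
  using diff_squares_neq_0[OF Z] by (intro borel_measurable_pos_lborel continuous_intros) auto

text \<open>The smaller exponent serves on (0, 1], the larger one beyond. This gives majorants that
  are uniform for exponents in an interval.\<close>

lemma powr_le_sum_powr:
  fixes u :: real
  assumes "\<alpha>1 \<le> \<alpha>" "\<alpha> \<le> \<alpha>2" "u > 0"
  shows "u powr \<alpha> \<le> u powr \<alpha>1 + u powr \<alpha>2"
proof (cases "u \<le> 1")
  case True
  hence "u powr \<alpha> \<le> u powr \<alpha>1" using assms by (intro powr_mono') auto
  thus ?thesis by (simp add: add_increasing2)
next
  case False
  hence "u powr \<alpha> \<le> u powr \<alpha>2" using assms by (intro powr_mono) auto
  thus ?thesis by (simp add: add_increasing)
qed

text \<open>The denominator stays above a positive constant, so Gamma integrals bound everything.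
  The three forms serve holomorphy in \<open>a\<close>, decay in \<open>z\<close> uniformly in
  \<open>a\<close>, and exchange of series and integral.\<close>

lemma Phi_bound:
  assumes Z: "Im Z \<noteq> 0"
  obtains \<kappa> where "\<kappa> > 0"
    "\<And>a z u \<alpha>1 \<alpha>2. \<alpha>1 \<le> Re a \<Longrightarrow> Re a \<le> \<alpha>2 \<Longrightarrow> u > 0 \<Longrightarrow>
       norm (of_real u powr (a + 1) * exp (- (z * of_real u)) / (of_real u ^ 2 - Z ^ 2))
         \<le> (u powr (\<alpha>1 + 1) * exp (- (Re z * u)) + u powr (\<alpha>2 + 1) * exp (- (Re z * u))) / \<kappa>"
    "\<And>a z \<alpha>1 \<alpha>2. -2 < \<alpha>1 \<Longrightarrow> \<alpha>1 \<le> Re a \<Longrightarrow> Re a \<le> \<alpha>2 \<Longrightarrow> Re z > 0 \<Longrightarrow>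
       norm (Phi a Z z) \<le> (Gamma (\<alpha>1 + 2) * Re z powr (- \<alpha>1 - 2) + Gamma (\<alpha>2 + 2) * Re z powr (- \<alpha>2 - 2)) / \<kappa>"
    "\<And>a z. -2 < Re a \<Longrightarrow> Re z > 0 \<Longrightarrow>
       (\<integral>u. norm (of_real u powr (a + 1) * exp (- (z * of_real u)) / (of_real u ^ 2 - Z ^ 2)) \<partial>pos_lborel)
         \<le> 2 * Gamma (Re a + 2) * Re z powr (- Re a - 2) / \<kappa>"
proof -
  have nn: "Z \<notin> \<real>\<^sub>\<le>\<^sub>0" "- Z \<notin> \<real>\<^sub>\<le>\<^sub>0" by (rule not_nonpos_Reals_Im; use Z in simp)+
  obtain \<kappa> where \<kappa>: "\<kappa> > 0" "\<And>u d. u \<ge> 0 \<Longrightarrow> d > 0 \<Longrightarrow> norm (of_real u ^ 2 - (of_real d * Z) ^ 2) \<ge> \<kappa> * (u + d) ^ 2"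
    using nn by (rule norm_diff_squares_ge) blast
  have *: "norm (of_real u powr (a + 1) * exp (- (z * of_real u)) / (of_real u ^ 2 - Z ^ 2))
         \<le> (u powr (\<alpha>1 + 1) * exp (- (Re z * u)) + u powr (\<alpha>2 + 1) * exp (- (Re z * u))) / \<kappa>"
    if "\<alpha>1 \<le> Re a" "Re a \<le> \<alpha>2" and u: "u > 0" for a z u \<alpha>1 \<alpha>2
  proof -
    have 1: "1 \<le> (u + 1) ^ 2" using u by (intro one_le_power) auto
    have "\<kappa> * 1 \<le> \<kappa> * (u + 1) ^ 2" using 1 \<kappa>(1) by (intro mult_left_mono) auto
    also have "\<dots> \<le> norm (of_real u ^ 2 - Z ^ 2)" using \<kappa>(2)[of u 1] u by simp
    finally have 2: "\<kappa> \<le> norm (of_real u ^ 2 - Z ^ 2)" by simp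
    have "norm (of_real u powr (a + 1) * exp (- (z * of_real u)) / (of_real u ^ 2 - Z ^ 2)) =
       u powr (Re a + 1) * exp (- (Re z * u)) / norm (of_real u ^ 2 - Z ^ 2)"
      using u by (simp only: norm_divide norm_powr_exp) simp
    also have "\<dots> \<le> (u powr (\<alpha>1 + 1) + u powr (\<alpha>2 + 1)) * exp (- (Re z * u)) / \<kappa>"
      using 2 \<kappa>(1) that by (intro frac_le mult_right_mono powr_le_sum_powr) auto
    finally show ?thesis by (simp add: ring_distribs)
  qed
  have **: "norm (Phi a Z z) \<le> (Gamma (\<alpha>1 + 2) * Re z powr (- \<alpha>1 - 2) + Gamma (\<alpha>2 + 2) * Re z powr (- \<alpha>2 - 2)) / \<kappa>
     \<and> (\<integral>u. norm (of_real u powr (a + 1) * exp (- (z * of_real u)) / (of_real u ^ 2 - Z ^ 2)) \<partial>pos_lborel)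
       \<le> (Gamma (\<alpha>1 + 2) * Re z powr (- \<alpha>1 - 2) + Gamma (\<alpha>2 + 2) * Re z powr (- \<alpha>2 - 2)) / \<kappa>"
    if "-2 < \<alpha>1" "\<alpha>1 \<le> Re a" "Re a \<le> \<alpha>2" and z: "Re z > 0" for a z \<alpha>1 \<alpha>2
  proof -
    let ?f = "\<lambda>u. of_real u powr (a + 1) * exp (- (z * of_real u)) / (of_real u ^ 2 - Z ^ 2)"
    let ?h = "\<lambda>u. (u powr (\<alpha>1 + 1) * exp (- (Re z * u)) + u powr (\<alpha>2 + 1) * exp (- (Re z * u))) / \<kappa>"
    have h: "integrable pos_lborel ?h"
      using that by (intro Bochner_Integration.integrable_divide Bochner_Integration.integrable_add Gamma_integral_powr_exp(1)) auto
    have f: "integrable pos_lborel ?f"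
      by (rule Bochner_Integration.integrable_bound[OF h Phi_integrand_measurable[OF Z]])
         (use *[OF that(2,3)] \<kappa>(1) in \<open>auto intro!: AE_I2 order_trans[OF _ abs_ge_self]\<close>)
    have "norm (Phi a Z z) \<le> (\<integral>u. norm (?f u) \<partial>pos_lborel)" unfolding Phi_def by (rule integral_norm_bound)
    moreover have "(\<integral>u. norm (?f u) \<partial>pos_lborel) \<le> (\<integral>u. ?h u \<partial>pos_lborel)"
      using f h *[OF that(2,3)] by (intro integral_mono) auto
    moreover have "(\<integral>u. ?h u \<partial>pos_lborel) = (Gamma (\<alpha>1 + 1 + 1) * Re z powr (- (\<alpha>1 + 1) - 1) + Gamma (\<alpha>2 + 1 + 1) * Re z powr (- (\<alpha>2 + 1) - 1)) / \<kappa>"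
      using that by (subst integral_divide_zero, subst Bochner_Integration.integral_add)
        (auto simp only: Gamma_integral_powr_exp intro!: Gamma_integral_powr_exp(1))
    moreover have "\<alpha>1 + 1 + 1 = \<alpha>1 + 2" "\<alpha>2 + 1 + 1 = \<alpha>2 + 2" "- (\<alpha>1 + 1) - 1 = - \<alpha>1 - 2" "- (\<alpha>2 + 1) - 1 = - \<alpha>2 - 2" by auto
    ultimately show ?thesis by (metis (no_types, lifting) order_trans)
  qed
  show thesis
  proof (rule that[OF \<kappa>(1) *])
    \<comment> \<open>Both end exponents are taken to be \<open>Re a\<close>; hence the factor
      2.\<close>
    fix a z assume a: "-2 < Re a" "Re z > 0"
    show "(\<integral>u. norm (of_real u powr (a + 1) * exp (- (z * of_real u)) / (of_real u ^ 2 - Z ^ 2)) \<partial>pos_lborel)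
         \<le> 2 * Gamma (Re a + 2) * Re z powr (- Re a - 2) / \<kappa>"
      using **[of "Re a" a "Re a" z] a by simp
  qed (use ** in blast)+
qed

lemma integrable_Phi:
  assumes Z: "Im Z \<noteq> 0" and a: "Re a > -2" and z: "Re z > 0"
  shows "integrable pos_lborel (\<lambda>u. of_real u powr (a + 1) * exp (- (z * of_real u)) / (of_real u ^ 2 - Z ^ 2))"
proof -
  obtain \<kappa> where \<kappa>: "\<kappa> > 0"
    "\<And>a z u \<alpha>1 \<alpha>2. \<alpha>1 \<le> Re a \<Longrightarrow> Re a \<le> \<alpha>2 \<Longrightarrow> u > 0 \<Longrightarrow>
       norm (of_real u powr (a + 1) * exp (- (z * of_real u)) / (of_real u ^ 2 - Z ^ 2))
         \<le> (u powr (\<alpha>1 + 1) * exp (- (Re z * u)) + u powr (\<alpha>2 + 1) * exp (- (Re z * u))) / \<kappa>"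
    using Z by (rule Phi_bound) blast
  show ?thesis
  proof (rule Bochner_Integration.integrable_bound[OF _ Phi_integrand_measurable[OF Z]])
    show "integrable pos_lborel (\<lambda>u. (u powr (Re a + 1) * exp (- (Re z * u)) + u powr (Re a + 1) * exp (- (Re z * u))) / \<kappa>)"
      using a z by (intro Bochner_Integration.integrable_divide Bochner_Integration.integrable_add Gamma_integral_powr_exp(1)) auto
  qed (use \<kappa>(1) \<kappa>(2)[of "Re a" a "Re a"] in \<open>auto intro!: AE_I2 order_trans[OF _ abs_ge_self]\<close>)
qed

lemma holomorphic_on_Phi:
  assumes Z: "Im Z \<noteq> 0" and z: "Re z > 0"
  shows "(\<lambda>a. Phi a Z z) holomorphic_on {a. Re a > -2}"
  unfolding Phi_def
proof (rule holomorphic_on_integral_dominated)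
  obtain \<kappa> where \<kappa>: "\<kappa> > 0"
    "\<And>a z u \<alpha>1 \<alpha>2. \<alpha>1 \<le> Re a \<Longrightarrow> Re a \<le> \<alpha>2 \<Longrightarrow> u > 0 \<Longrightarrow>
       norm (of_real u powr (a + 1) * exp (- (z * of_real u)) / (of_real u ^ 2 - Z ^ 2))
         \<le> (u powr (\<alpha>1 + 1) * exp (- (Re z * u)) + u powr (\<alpha>2 + 1) * exp (- (Re z * u))) / \<kappa>"
    using Z by (rule Phi_bound) blast
  fix a0 assume "a0 \<in> {a. Re a > -2}"
  hence a0: "Re a0 > -2" by simp
  define r where "r = (Re a0 + 2) / 2"
  have r: "r > 0" "Re a0 - r > -2" using a0 by (auto simp: r_def field_simps)
  define h where "h u = (u powr (Re a0 - r + 1) * exp (- (Re z * u)) + u powr (Re a0 + r + 1) * exp (- (Re z * u))) / \<kappa>" for u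
  have "Re a0 - r \<le> Re a \<and> Re a \<le> Re a0 + r" if "a \<in> ball a0 r" for a
    using that abs_Re_le_cmod[of "a0 - a"] by (simp add: dist_norm abs_le_iff)
  hence "norm (of_real u powr (a + 1) * exp (- (z * of_real u)) / (of_real u ^ 2 - Z ^ 2)) \<le> h u"
    if "a \<in> ball a0 r" "u > 0" for a u
    unfolding h_def using that by (intro \<kappa>(2)) auto
  moreover have "integrable pos_lborel h" unfolding h_def
    using r z by (intro Bochner_Integration.integrable_divide Bochner_Integration.integrable_add Gamma_integral_powr_exp(1)) auto
  ultimately show "\<exists>r>0. \<exists>h. integrable pos_lborel h \<and> (\<forall>a\<in>ball a0 r \<inter> {a. Re a > -2}. \<forall>u\<in>space pos_lborel.
      norm (of_real u powr (a + 1) * exp (- (z * of_real u)) / (of_real u ^ 2 - Z ^ 2)) \<le> h u)"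
    using r(1) by (intro exI[of _ r] conjI exI[of _ h]) auto
qed (use diff_squares_neq_0[OF Z] Phi_integrand_measurable[OF Z] in \<open>auto intro!: holomorphic_intros open_halfspace_Re_gt\<close>)

text \<open>For Re a < 0 this is the average of the Stieltjes formula at \<open>Z\<close> and
  \<open>- Z\<close>; both sides stay holomorphic for Re a > -1. The growing exponential is now
  explicit, and the remainder \<open>Phi\<close> decays.\<close>

lemma rGamma_series_exp_even_part:
  assumes Z: "Im Z \<noteq> 0" and a: "Re a > -1" and z: "Re z > 0"
  shows "z powr (- a) * ((rGamma_series_exp a (z * Z) + rGamma_series_exp a (- (z * Z))) / 2) =
     (Z powr a * exp (z * Z) + (- Z) powr a * exp (- (z * Z))) / 2 + sin (of_real pi * a) / of_real pi * Phi a Z z"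
proof (rule analytic_continuation_open[where s = "{a. Re a > -1} \<inter> {a. Re a < 0}" and s' = "{a. Re a > -1}" and z = a])
  have nz: "Z \<noteq> 0" "z \<noteq> 0" using Z z by auto
  have "-1/2 \<in> {a::complex. Re a > -1} \<inter> {a. Re a < 0}" by simp
  thus "{a::complex. Re a > -1} \<inter> {a. Re a < 0} \<noteq> {}" by blast
  show "connected {a. Re a > -1}" by (intro convex_connected convex_halfspace_Re_gt)
  have E: "(\<lambda>a. rGamma_series_exp a x) holomorphic_on {a. Re a > -1}" for x
    by (rule holomorphic_on_subset[OF holomorphic_on_rGamma_series_exp]) auto
  show "(\<lambda>a. z powr (- a) * ((rGamma_series_exp a (z * Z) + rGamma_series_exp a (- (z * Z))) / 2)) holomorphic_on {a. Re a > -1}"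
    using nz by (intro holomorphic_intros E) auto
  have "(\<lambda>a. Phi a Z z) holomorphic_on {a. Re a > -1}"
    by (rule holomorphic_on_subset[OF holomorphic_on_Phi[OF Z z]]) auto
  thus "(\<lambda>a. (Z powr a * exp (z * Z) + (- Z) powr a * exp (- (z * Z))) / 2 + sin (of_real pi * a) / of_real pi * Phi a Z z) holomorphic_on {a. Re a > -1}"
    using nz by (intro holomorphic_intros) auto
next
  fix a assume "a \<in> {a. Re a > -1} \<inter> {a. Re a < 0}"
  hence a: "-1 < Re a" "Re a < 0" by auto
  have nn: "Z \<notin> \<real>\<^sub>\<le>\<^sub>0" "- Z \<notin> \<real>\<^sub>\<le>\<^sub>0" by (rule not_nonpos_Reals_Im; use Z in simp)+
  have int: "integrable pos_lborel (\<lambda>u. of_real u powr a * exp (- (z * of_real u)) / (of_real u + W))"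
    if W: "W \<notin> \<real>\<^sub>\<le>\<^sub>0" for W
  proof -
    obtain h where h: "integrable pos_lborel h"
      "\<And>z u. Re z \<ge> 0 \<Longrightarrow> u > 0 \<Longrightarrow> norm (of_real u powr a * exp (- (z * of_real u)) / (of_real u + W)) \<le> h u"
      by (rule integrable_Stieltjes_bound[OF a W]) blast
    show ?thesis
      by (rule Bochner_Integration.integrable_bound[OF h(1)])
         (use h(2)[of z] z W in \<open>auto intro!: AE_I2 order_trans[OF _ abs_ge_self] borel_measurable_pos_lborel continuous_intros
            simp: add_of_real_neq_0\<close>)
  qed
  have "Stieltjes_integral a Z z + Stieltjes_integral a (- Z) z = 2 * Phi a Z z"
    unfolding Stieltjes_integral_def Phi_def integral_mult_right_zero[symmetric]
    unfolding Bochner_Integration.integral_add[OF int[OF nn(1)] int[OF nn(2)], symmetric]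
  proof (intro Bochner_Integration.integral_cong refl)
    fix u assume "u \<in> space pos_lborel"
    hence u: "u > 0" by simp
    have 1: "of_real u + Z \<noteq> 0" "of_real u + - Z \<noteq> 0" by (rule add_of_real_neq_0[OF u nn(1)], rule add_of_real_neq_0[OF u nn(2)])
    have 2: "of_real u powr (a + 1) = of_real u powr a * of_real u" using u by (simp add: powr_add)
    have 3: "of_real u ^ 2 - Z ^ 2 = (of_real u + Z) * (of_real u + - Z)" by (simp add: power2_eq_square algebra_simps)
    have 4: "P / A + P / B = 2 * (P * u' / (A * B))" if "A \<noteq> 0" "B \<noteq> 0" "A + B = 2 * u'" for P A B u' :: complex
    proof -
      have "P / A + P / B = P * (A + B) / (A * B)" using that(1,2) by (simp add: field_simps)
      thus ?thesis by (simp add: that(3) mult_ac)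
    qed
    show "of_real u powr a * exp (- (z * of_real u)) / (of_real u + Z) + of_real u powr a * exp (- (z * of_real u)) / (of_real u + - Z) =
       2 * (of_real u powr (a + 1) * exp (- (z * of_real u)) / (of_real u ^ 2 - Z ^ 2))"
      unfolding 2 3 using 4[OF 1, of "of_real u" "of_real u powr a * exp (- (z * of_real u))"] by (simp add: mult_ac)
  qed
  hence "Phi a Z z = (Stieltjes_integral a Z z + Stieltjes_integral a (- Z) z) / 2" by simp
  thus "z powr (- a) * ((rGamma_series_exp a (z * Z) + rGamma_series_exp a (- (z * Z))) / 2) =
     (Z powr a * exp (z * Z) + (- Z) powr a * exp (- (z * Z))) / 2 + sin (of_real pi * a) / of_real pi * Phi a Z z"
    using rGamma_series_exp_eq_Stieltjes[OF a nn(1) z] rGamma_series_exp_eq_Stieltjes[OF a nn(2) z]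
    by (simp add: ring_distribs add_divide_distrib)
qed (use a in \<open>auto simp: open_halfspace_Re_gt open_halfspace_Re_lt\<close>)

text \<open>
  A term of the right-hand side divided by \<open>sin (\<pi> a / 2)\<close>, in a form without singularities in \<open>a\<close>.
  Here \<open>x\<close> is split as \<open>z * Z\<close> with \<open>Z\<close> slightly below the positive real axis, so that
  the Laplace integral in \<open>Phi\<close> runs along a ray that misses its pole.
\<close>

definition kern :: "complex \<Rightarrow> complex \<Rightarrow> complex \<Rightarrow> complex" where
  "kern a Z x = 2 * cos (of_real pi * a / 2) / of_real pi * Z powr (- a) * Phi a Z (x / Z)
     + \<i> * exp (\<i> * of_real pi * a / 2) * exp (- x)"

text \<open>Below the real axis, passing from \<open>Z\<close> to \<open>- Z\<close> raises the
  principal logarithm by i pi. The sign condition on Im Z selects this branch.\<close>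

lemma powr_minus_neg:
  assumes "Im Z < 0"
  shows "(- Z) powr a = Z powr a * exp (\<i> * of_real pi * a)"
proof -
  have "Z \<noteq> 0" using assms by auto
  moreover have "Ln (- Z) = Ln Z + \<i> * pi" using assms \<open>Z \<noteq> 0\<close> by (subst Ln_minus) auto
  ultimately show ?thesis by (simp add: powr_def ring_distribs exp_add mult_ac)
qed

text \<open>The exponential part of the even part is (exp x + exp (i pi a) exp (-x)) / 2.
  Subtracting cosh x removes exp x and leaves (exp (i pi a) - 1) / 2 times exp (-x). Both this
  factor and sin (pi a) are divisible by sin (pi a / 2), and the quotients are the coefficients in
  \<open>kern\<close>.\<close>

lemma sin_mult_kern:
  assumes Z: "Im Z < 0" "Re Z > 0" and a: "Re a > -1" and x: "Re x > 0" "Re (x / Z) > 0"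
  shows "sin (of_real pi * a / 2) * kern a Z x =
    x powr (- a) * ((rGamma_series_exp a x + rGamma_series_exp a (- x)) / 2) - cosh x"
proof -
  define z where "z = x / Z"
  have nz: "Z \<noteq> 0" "x \<noteq> 0" "z \<noteq> 0" using assms by (auto simp: z_def)
  have x_eq: "x = z * Z" using nz by (simp add: z_def)
  \<comment> \<open>Both \<open>z\<close> and \<open>Z\<close> lie in the right half-plane, so their
    arguments add up to less than pi in modulus.\<close>
  have Ln: "Ln z = Ln x - Ln Z"
  proof -
    have "\<bar>Im (Ln z)\<bar> < pi / 2" "\<bar>Im (Ln Z)\<bar> < pi / 2"
      by (rule Re_Ln_pos_lt_imp; use assms in \<open>simp add: z_def\<close>)+
    hence "Ln (z * Z) = Ln z + Ln Z" using nz by (intro Ln_times_simple) auto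
    thus ?thesis by (simp add: x_eq [symmetric])
  qed
  have xp: "x powr (- a) = Z powr (- a) * z powr (- a)"
    using nz by (simp add: powr_def Ln ring_distribs exp_add [symmetric] algebra_simps)
  have ZZ: "Z powr (- a) * Z powr a = 1" using nz by (simp add: powr_minus)
  have "x powr (- a) * ((rGamma_series_exp a x + rGamma_series_exp a (- x)) / 2) =
      Z powr (- a) * (z powr (- a) * ((rGamma_series_exp a (z * Z) + rGamma_series_exp a (- (z * Z))) / 2))"
    by (simp add: xp x_eq [symmetric])
  also have "\<dots> = Z powr (- a) * ((Z powr a * exp x + (- Z) powr a * exp (- x)) / 2 + sin (of_real pi * a) / of_real pi * Phi a Z z)"
    using Z a x by (subst rGamma_series_exp_even_part) (auto simp: x_eq [symmetric] z_def)
  also have "\<dots> = (Z powr (- a) * Z powr a) * (exp x + exp (\<i> * of_real pi * a) * exp (- x)) / 2 + sin (of_real pi * a) / of_real pi * (Z powr (- a) * Phi a Z z)"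
    unfolding powr_minus_neg[OF Z(1)] by (simp add: field_simps)
  finally have 1: "x powr (- a) * ((rGamma_series_exp a x + rGamma_series_exp a (- x)) / 2) =
     (exp x + exp (\<i> * of_real pi * a) * exp (- x)) / 2 + sin (of_real pi * a) / of_real pi * (Z powr (- a) * Phi a Z z)"
    by (simp only: ZZ mult_1)
  define h where "h = of_real pi * a / 2"
  have h: "of_real pi * a = 2 * h" "\<i> * of_real pi * a = 2 * (\<i> * h)" "\<i> * of_real pi * a / 2 = \<i> * h" by (simp_all add: h_def)
  have e2: "(exp (2 * (\<i> * h)) - 1) / 2 = \<i> * exp (\<i> * h) * sin h"
    unfolding exp_double sin_exp_eq exp_minus by (simp add: field_simps power2_eq_square)
  show ?thesis
    unfolding 1 kern_def h z_def[symmetric] h_def[symmetric] sin_double cosh_field_def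
    using e2 by (simp add: field_simps)
qed

section \<open>Comparison with the hypergeometric series\<close>

lemma sums_even_part:
  fixes f :: "nat \<Rightarrow> complex"
  assumes "summable (\<lambda>n. f n * x ^ n)"  "summable (\<lambda>n. f n * (- x) ^ n)"
  shows "(\<lambda>n. f (2 * n) * x ^ (2 * n)) sums (((\<Sum>n. f n * x ^ n) + (\<Sum>n. f n * (- x) ^ n)) / 2)"
proof -
  have "(\<lambda>n. (f n * x ^ n + f n * (- x) ^ n) / 2) sums (((\<Sum>n. f n * x ^ n) + (\<Sum>n. f n * (- x) ^ n)) / 2)"
    using assms by (intro sums_divide sums_add summable_sums)
  moreover have "(f n * x ^ n + f n * (- x) ^ n) / 2 = 0" if "n \<notin> range (\<lambda>n::nat. 2 * n)" for n
  proof -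
    from that have "odd n" by (auto elim: evenE)
    thus ?thesis by simp
  qed
  ultimately have "(\<lambda>n. (f (2 * n) * x ^ (2 * n) + f (2 * n) * (- x) ^ (2 * n)) / 2) sums
      (((\<Sum>n. f n * x ^ n) + (\<Sum>n. f n * (- x) ^ n)) / 2)"
    by (subst sums_mono_reindex[of "\<lambda>n. 2 * n"]) (auto simp: strict_mono_def)
  thus ?thesis by simp
qed

text \<open>The duplication formula merges the two lower parameters into
  \<open>pochhammer (1 - a) (2 * n)\<close>. Its power of 4 is absorbed by the quarter in the
  argument, and the upper parameter 1 cancels the factorial.\<close>

lemma hypergeo_1F2_eq_rGamma_series:
  assumes a: "a \<notin> \<nat>"
  shows "hypergeo_1F2 1 ((1 - a) / 2) (1 - a / 2) (x ^ 2 / 4) / Gamma (1 - a) =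
    (rGamma_series_exp a x + rGamma_series_exp a (- x)) / 2"
proof -
  have nonpos: "1 - a \<notin> \<int>\<^sub>\<le>\<^sub>0"
  proof
    assume "1 - a \<in> \<int>\<^sub>\<le>\<^sub>0"
    then obtain n where "1 - a = - of_nat n" by (elim nonpos_Ints_cases')
    hence "a = of_nat (Suc n)" by (simp add: algebra_simps)
    thus False using a by (metis of_nat_in_Nats)
  qed
  have coeff: "fps_nth (fps_hypergeo [1] [(1 - a) / 2, 1 - a / 2] 1) n * (x ^ 2 / 4) ^ n =
      Gamma (1 - a) * (rGamma (of_nat (2 * n) + 1 - a) * x ^ (2 * n))" for n
  proof -
    define P where "P = pochhammer (1 - a) (2 * n)"
    have P: "P = 4 ^ n * (pochhammer ((1 - a) / 2) n * pochhammer (1 - a / 2) n)"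
    proof -
      have "(1 - a) / 2 + 1 / 2 = 1 - a / 2" "2 * ((1 - a) / 2) = 1 - a" by (simp_all add: field_simps)
      from pochhammer_double[of "(1 - a) / 2" n, unfolded this] show ?thesis
        by (simp add: P_def power_mult mult.assoc)
    qed
    have P0: "P \<noteq> 0"
      unfolding P_def using nonpos by (auto simp: pochhammer_eq_0_iff)
    have "1 - a + of_nat (2 * n) = of_nat (2 * n) + 1 - a" by simp
    hence "rGamma (1 - a) = P * rGamma (of_nat (2 * n) + 1 - a)"
      using pochhammer_rGamma[of "1 - a" "2 * n"] by (simp only: P_def)
    moreover have "Gamma (1 - a) * rGamma (1 - a) = 1"
      using nonpos by (simp add: rGamma_inverse_Gamma Gamma_eq_zero_iff)
    ultimately have "Gamma (1 - a) * rGamma (of_nat (2 * n) + 1 - a) * P = 1" by (simp only: mult_ac)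
    hence "Gamma (1 - a) * rGamma (of_nat (2 * n) + 1 - a) = 1 / (4 ^ n * (pochhammer ((1 - a) / 2) n * pochhammer (1 - a / 2) n))"
      unfolding P[symmetric] using P0 by (simp only: nonzero_eq_divide_eq not_False_eq_True)
    hence "Gamma (1 - a) * (rGamma (of_nat (2 * n) + 1 - a) * x ^ (2 * n)) =
        1 / (4 ^ n * (pochhammer ((1 - a) / 2) n * pochhammer (1 - a / 2) n)) * x ^ (2 * n)"
      by (simp only: mult.assoc [symmetric])
    moreover have "fps_nth (fps_hypergeo [1] [(1 - a) / 2, 1 - a / 2] 1) n =
        1 / (pochhammer ((1 - a) / 2) n * pochhammer (1 - a / 2) n)"
    proof -
      have "pochhammer 1 n \<noteq> (0 :: complex)" by (metis fact_nonzero pochhammer_fact)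
      thus ?thesis using pochhammer_fact[of n, where 'a = complex] by simp
    qed
    moreover have "(x ^ 2 / 4) ^ n = x ^ (2 * n) / 4 ^ n" by (simp only: power_divide power_mult)
    moreover have "1 / Q * (X / F) = 1 / (F * Q) * X" for Q X F :: complex by simp
    ultimately show ?thesis by metis
  qed
  have summ: "summable (\<lambda>n. rGamma (of_nat n + 1 - a) * y ^ n)" for y
    by (rule summable_norm_cancel, rule summable_rGamma_series_exp)
  have "(\<lambda>n. rGamma (of_nat (2 * n) + 1 - a) * x ^ (2 * n)) sums ((rGamma_series_exp a x + rGamma_series_exp a (- x)) / 2)"
    unfolding rGamma_series_exp_def by (rule sums_even_part[OF summ summ])
  from sums_mult[OF this, of "Gamma (1 - a)"]
  have "hypergeo_1F2 1 ((1 - a) / 2) (1 - a / 2) (x ^ 2 / 4) =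
      Gamma (1 - a) * ((rGamma_series_exp a x + rGamma_series_exp a (- x)) / 2)"
    unfolding hypergeo_1F2_def eval_fps_def coeff by (simp only: sums_iff)
  thus ?thesis using nonpos by (simp add: Gamma_eq_zero_iff)
qed

text \<open>The value of \<open>x\<close> fits both parts of the term: it is the argument of cosh,
  and x^2 / 4 is the hypergeometric argument. Since \<open>x\<close> is 2 pi / y times the positive
  real 2 pi n, the powers split without branch trouble.\<close>

lemma rhs_term_eq_kern:
  assumes Z: "Im Z < 0" "Re Z > 0" and a: "Re a > -1" "a \<notin> \<nat>" and y: "Re y > 0" "Re (1 / (y * Z)) > 0" and n: "n > 0"
  defines "x \<equiv> 4 * of_real pi ^ 2 * of_nat n / y"
  shows "rhs_term y n a = divisor_sigma a n * (2 * of_real pi / y) powr a * sin (of_real pi * a / 2) * kern a Z x"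
proof -
  have y0: "y \<noteq> 0" using y by auto
  have x_eq: "x = of_real (2 * pi * real n) * (2 * of_real pi / y)" by (simp add: x_def power2_eq_square)
  have inv: "Re (1 / y) > 0" using y(1) y0 by (simp add: Re_divide zero_less_divide_iff sum_power2_gt_zero_iff)
  have "x = (4 * pi ^ 2 * real n) *\<^sub>R (1 / y)" by (simp add: x_def scaleR_conv_of_real)
  hence Rex: "Re x > 0" using inv n by (simp only: scaleR_complex.simps) simp
  have "x / Z = (4 * pi ^ 2 * real n) *\<^sub>R (1 / (y * Z))" by (simp add: x_def scaleR_conv_of_real)
  hence RexZ: "Re (x / Z) > 0" using y(2) n by (simp only: scaleR_complex.simps) simp
  have "x powr (- a) = of_real (2 * pi * real n) powr (- a) * (2 * of_real pi / y) powr (- a)"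
    unfolding x_eq using n by (intro powr_mult_of_real) auto
  hence p: "(2 * of_real pi * of_nat n) powr (- a) = (2 * of_real pi / y) powr a * x powr (- a)"
    using y0 by (simp add: powr_minus)
  have arg: "4 * of_real pi ^ 4 * of_nat n ^ 2 / y ^ 2 = x ^ 2 / 4"
    using y0 by (simp add: x_def power_divide power_mult_distrib power_mult[symmetric])
  have "rhs_term y n a = divisor_sigma a n * ((2 * of_real pi * of_nat n) powr (- a) *
       (hypergeo_1F2 1 ((1 - a) / 2) (1 - a / 2) (x ^ 2 / 4) / Gamma (1 - a)) - (2 * of_real pi / y) powr a * cosh x)"
    by (simp add: rhs_term_def arg x_def)
  also have "\<dots> = divisor_sigma a n * (2 * of_real pi / y) powr a *
     (x powr (- a) * ((rGamma_series_exp a x + rGamma_series_exp a (- x)) / 2) - cosh x)"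
    unfolding hypergeo_1F2_eq_rGamma_series[OF a(2)] p by (simp add: algebra_simps)
  also have "\<dots> = divisor_sigma a n * (2 * of_real pi / y) powr a * sin (of_real pi * a / 2) * kern a Z x"
    unfolding sin_mult_kern[OF Z a(1) Rex RexZ, symmetric] by (simp only: mult.assoc)
  finally show ?thesis .
qed

text \<open>The zeros are the even integers, and those to the right of -2 are naturals.\<close>

lemma sin_half_neq_0_Nats:
  fixes a :: complex
  assumes a: "Re a > -2" "a \<notin> \<nat>"
  shows "sin (of_real pi * a / 2) \<noteq> 0"
proof
  assume "sin (of_real pi * a / 2) = 0"
  then obtain k :: int where "of_real pi * a / 2 = of_real (of_int k * pi)" by (auto simp: sin_eq_0)
  hence "of_real pi * a = of_real pi * of_int (2 * k)" by (simp add: field_simps)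
  hence k: "a = of_int (2 * k)" by (subst (asm) mult_cancel_left) auto
  with a(1) have "k \<ge> 0" by (simp flip: of_int_mult)
  hence "a = of_nat (nat (2 * k))" using k by simp
  with a(2) show False by (metis of_nat_in_Nats)
qed

text \<open>The sine in the factor cancels the one in the term. The resulting expression makes sense
  at the naturals as well, so it provides the limits there.\<close>

lemma rhs_factor_mult_rhs_term:
  assumes Z: "Im Z < 0" "Re Z > 0" and a: "Re a > -1" "a \<notin> \<nat>" and y: "Re y > 0" "Re (1 / (y * Z)) > 0" and n: "n > 0"
  shows "rhs_factor y a * rhs_term y n a =
    divisor_sigma a n * ((2 * of_real pi / y) powr (1 + a) * kern a Z (4 * of_real pi ^ 2 * of_nat n / y))"
proof -
  have s0: "sin (of_real pi * a / 2) \<noteq> 0" using a by (intro sin_half_neq_0_Nats) auto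
  have "2 * of_real pi / y \<noteq> 0" using y by auto
  hence "(2 * of_real pi / y) powr (1 + a) = (2 * of_real pi / y) * (2 * of_real pi / y) powr a"
    by (simp add: powr_add)
  thus ?thesis
    unfolding rhs_term_eq_kern[OF Z a y n] rhs_factor_def using s0 by simp
qed

section \<open>Lattice sums of the kernel\<close>

text \<open>Partial fractions of the cotangent in disguise. The logarithmic derivative of the
  reflection formula gives Digamma (1 - z) - Digamma z = pi cot (pi z), and the defining series of
  Digamma supplies the fractions.\<close>

lemma coth_partial_fractions:
  assumes w: "Re w > 0"
  shows "(\<lambda>d. 2 * w / (w ^ 2 + 4 * of_real pi ^ 2 * of_nat (Suc d) ^ 2)) sums (1 / (exp w - 1) - 1 / w + 1 / 2)"
proof -
  \<comment> \<open>This rotation turns exp w into exp (-2 pi i z), and hence 1 / (exp w - 1) into a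
    cotangent of pi z.\<close>
  define z where "z = \<i> * w / (2 * of_real pi)"
  have Imz: "Im z > 0" using w by (simp add: z_def)
  have np: "z \<notin> \<int>\<^sub>\<le>\<^sub>0" "1 - z \<notin> \<int>\<^sub>\<le>\<^sub>0" "1 + z \<notin> \<int>\<^sub>\<le>\<^sub>0"
    using Imz by (auto elim!: nonpos_Ints_cases simp: complex_eq_iff)
  have nz: "z \<noteq> 0" "1 + z \<noteq> 0" "1 - z \<noteq> 0" "w \<noteq> 0" using np w by auto
  have sn: "sin (of_real pi * z) \<noteq> 0"
  proof
    assume "sin (of_real pi * z) = 0"
    then obtain n :: int where "of_real pi * z = of_real (of_int n * pi)" by (auto simp: sin_eq_0)
    hence "Im (of_real pi * z) = Im (of_real (of_int n * pi))" by (rule arg_cong)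
    thus False using Imz by simp
  qed
  have D1: "((\<lambda>z. rGamma z * rGamma (1 - z)) has_field_derivative
      (- rGamma z * Digamma z) * rGamma (1 - z) + ((- rGamma (1 - z) * Digamma (1 - z)) * (- 1)) * rGamma z) (at z)"
    using np by (intro DERIV_mult has_field_derivative_rGamma_no_nonpos_int
         DERIV_chain2[where f = rGamma and g = "\<lambda>z. 1 - z"]) (auto intro!: derivative_eq_intros)
  have "((\<lambda>z. sin (of_real pi * z) / of_real pi) has_field_derivative cos (of_real pi * z)) (at z)"
    by (auto intro!: derivative_eq_intros)
  hence D2: "((\<lambda>z. rGamma z * rGamma (1 - z)) has_field_derivative cos (of_real pi * z)) (at z)"
    by (simp only: rGamma_reflection_complex)
  have "(sin (of_real pi * z) / of_real pi) * (Digamma (1 - z) - Digamma z) = cos (of_real pi * z)"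
    using DERIV_unique[OF D1 D2] by (simp only: rGamma_reflection_complex[symmetric]) (simp add: algebra_simps)
  hence "Digamma (1 - z) - Digamma z = of_real pi * cos (of_real pi * z) / sin (of_real pi * z)"
    using sn by (simp add: field_simps)
  moreover have "Digamma (1 + z) = Digamma z + 1 / z"
    using Digamma_plus1[OF nz(1)] by (simp add: add.commute)
  ultimately have dig: "Digamma (1 + z) - Digamma (1 - z) = 1 / z - of_real pi * cos (of_real pi * z) / sin (of_real pi * z)"
    by (simp add: algebra_simps)
  have "(\<lambda>k. (inverse (of_nat (Suc k)) - inverse (1 + z + of_nat k)) - (inverse (of_nat (Suc k)) - inverse (1 - z + of_nat k)))
     sums ((Digamma (1 + z) + euler_mascheroni) - (Digamma (1 - z) + euler_mascheroni))"
    unfolding Digamma_def using summable_Digamma[OF nz(2)] summable_Digamma[OF nz(3)]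
    by (intro sums_diff) (simp_all add: summable_sums)
  hence S: "(\<lambda>k. inverse (1 - z + of_nat k) - inverse (1 + z + of_nat k)) sums (1 / z - of_real pi * cos (of_real pi * z) / sin (of_real pi * z))"
    by (simp add: dig)
  have t: "inverse (1 - z + of_nat k) - inverse (1 + z + of_nat k) =
      2 * of_real pi * \<i> * (2 * w / (w ^ 2 + 4 * of_real pi ^ 2 * of_nat (Suc k) ^ 2))" for k
  proof -
    have A: "1 - z + of_nat k \<noteq> 0" "1 + z + of_nat k \<noteq> 0" using Imz by (auto simp: complex_eq_iff)
    hence "inverse (1 - z + of_nat k) - inverse (1 + z + of_nat k) = 2 * z / ((1 - z + of_nat k) * (1 + z + of_nat k))"
      by (simp add: field_simps)
    also have "(1 - z + of_nat k) * (1 + z + of_nat k) = of_nat (Suc k) ^ 2 - z ^ 2"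
      by (simp add: algebra_simps power2_eq_square)
    also have "of_nat (Suc k) ^ 2 - z ^ 2 = (w ^ 2 + 4 * of_real pi ^ 2 * of_nat (Suc k) ^ 2) / (4 * of_real pi ^ 2)"
      by (simp add: z_def power_divide power_mult_distrib field_simps)
    finally show ?thesis by (simp add: z_def power2_eq_square)
  qed
  define e where "e = exp w"
  have e1: "e \<noteq> 1" "e \<noteq> 0"
  proof -
    have "norm e > 1" using w by (simp add: e_def)
    thus "e \<noteq> 1" "e \<noteq> 0" by auto
  qed
  have pz: "\<i> * (of_real pi * z) = - w / 2" by (simp add: z_def)
  define q where "q = exp (w / 2)"
  have q: "q \<noteq> 0" "q * q = e" by (simp_all add: q_def e_def exp_add [symmetric])
  have "sin (of_real pi * z) = (1 / q - q) / (2 * \<i>)" "cos (of_real pi * z) = (1 / q + q) / 2"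
    unfolding sin_exp_eq cos_exp_eq pz q_def by (simp_all add: exp_minus inverse_eq_divide)
  moreover have "1 / q + q = (1 + e) / q" "1 / q - q = (1 - e) / q" using q by (simp_all add: field_simps)
  ultimately have "cos (of_real pi * z) / sin (of_real pi * z) = (1 + e) / q / 2 / ((1 - e) / q / (2 * \<i>))" by (simp only:)
  also have "\<dots> = \<i> * (1 + e) / (1 - e)" using q(1) e1(1) by (simp add: field_simps)
  also have "\<dots> = - \<i> * ((e + 1) / (e - 1))" using e1 by (simp add: field_simps)
  finally have c: "cos (of_real pi * z) / sin (of_real pi * z) = - \<i> * ((e + 1) / (e - 1))" .
  have cot: "of_real pi * cos (of_real pi * z) / sin (of_real pi * z) = of_real pi * (- \<i> * ((e + 1) / (e - 1)))"
    unfolding c[symmetric] by simp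
  have "1 / z - of_real pi * cos (of_real pi * z) / sin (of_real pi * z) = 2 * of_real pi * \<i> * (1 / (e - 1) - 1 / w + 1 / 2)"
  proof -
    have "1 / z = - 2 * of_real pi * \<i> / w" using nz(4) by (simp add: z_def field_simps)
    moreover have "(e + 1) / (e - 1) = 1 + 2 * (1 / (e - 1))" using e1 by (simp add: field_simps)
    ultimately show ?thesis unfolding cot by (simp only:) (simp add: algebra_simps)
  qed
  with S have "(\<lambda>k. 2 * of_real pi * \<i> * (2 * w / (w ^ 2 + 4 * of_real pi ^ 2 * of_nat (Suc k) ^ 2))) sums
      (2 * of_real pi * \<i> * (1 / (e - 1) - 1 / w + 1 / 2))"
    by (simp only: t)
  thus ?thesis by (subst (asm) sums_mult_iff) (auto simp: e_def)
qed

lemma integrable_powr_over_diff_squares: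
  fixes b W :: complex
  assumes W: "Im W \<noteq> 0" and b: "-1 < Re b" "Re b < 1"
  shows "integrable pos_lborel (\<lambda>u. of_real u powr b / (of_real u ^ 2 - W ^ 2))"
proof -
  have nn: "W \<notin> \<real>\<^sub>\<le>\<^sub>0" "- W \<notin> \<real>\<^sub>\<le>\<^sub>0" by (rule not_nonpos_Reals_Im; use W in simp)+
  obtain \<kappa> where \<kappa>: "\<kappa> > 0" "\<And>u d. u \<ge> 0 \<Longrightarrow> d > 0 \<Longrightarrow> norm (of_real u ^ 2 - (of_real d * W) ^ 2) \<ge> \<kappa> * (u + d) ^ 2"
    using nn by (rule norm_diff_squares_ge) blast
  show ?thesis
  proof (rule Bochner_Integration.integrable_bound)
    show "integrable pos_lborel (\<lambda>u. 1 / \<kappa> * (u powr Re b / (1 + u) powr 2))"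
      using b by (intro Bochner_Integration.integrable_mult_right integrable_powr_over) auto
    show "(\<lambda>u. of_real u powr b / (of_real u ^ 2 - W ^ 2)) \<in> borel_measurable pos_lborel"
      using diff_squares_neq_0[OF W] by (intro borel_measurable_pos_lborel continuous_intros) auto
    have "norm (of_real u powr b / (of_real u ^ 2 - W ^ 2)) \<le> 1 / \<kappa> * (u powr Re b / (1 + u) powr 2)" if u: "u > 0" for u
    proof -
      have "norm (of_real u powr b / (of_real u ^ 2 - W ^ 2)) = u powr Re b / norm (of_real u ^ 2 - W ^ 2)"
        using u by (simp add: norm_divide norm_powr_real_powr)
      also have "\<dots> \<le> u powr Re b / (\<kappa> * (u + 1) ^ 2)"
        using \<kappa>(2)[of u 1] \<kappa>(1) u by (intro frac_le) auto
      finally show ?thesis using u by (simp add: add.commute mult.commute)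
    qed
    hence "norm (of_real u powr b / (of_real u ^ 2 - W ^ 2)) \<le> norm (1 / \<kappa> * (u powr Re b / (1 + u) powr 2))" if "u > 0" for u
      unfolding real_norm_def by (rule order_trans[OF _ abs_ge_self]) fact
    thus "AE u in pos_lborel. norm (of_real u powr b / (of_real u ^ 2 - W ^ 2)) \<le> norm (1 / \<kappa> * (u powr Re b / (1 + u) powr 2))"
      by (intro AE_I2) auto
  qed
qed

text \<open>Partial fractions reduce both integrals to Mellin integrals at \<open>W\<close> and
  \<open>- W\<close>: exponent \<open>a\<close> yields their difference, exponent
  \<open>a + 1\<close> their sum. The exponential factor is the branch jump of the power between the
  two points.\<close>

lemma integral_powr_over_diff_squares:
  fixes a W :: complex
  assumes W: "Im W < 0" and a: "-1 < Re a" "Re a < 0"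
  shows "(\<integral>u. of_real u powr a / (of_real u ^ 2 - W ^ 2) \<partial>pos_lborel) =
           - of_real pi / (2 * sin (of_real pi * a)) * W powr (a - 1) * (exp (\<i> * of_real pi * a) - 1)"
    and "(\<integral>u. of_real u powr (a + 1) / (of_real u ^ 2 - W ^ 2) \<partial>pos_lborel) =
           - of_real pi / (2 * sin (of_real pi * a)) * W powr a * (exp (\<i> * of_real pi * a) + 1)"
proof -
  have nn: "W \<notin> \<real>\<^sub>\<le>\<^sub>0" "- W \<notin> \<real>\<^sub>\<le>\<^sub>0" by (rule not_nonpos_Reals_Im; use W in simp)+
  have W0: "W \<noteq> 0" using W by auto
  define f where "f V u = of_real u powr a / (of_real u + V)" for V and u :: real
  have int: "integrable pos_lborel (f V)" if V: "V \<notin> \<real>\<^sub>\<le>\<^sub>0" for V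
  proof -
    obtain h where h: "integrable pos_lborel h"
      "\<And>z u. Re z \<ge> 0 \<Longrightarrow> u > 0 \<Longrightarrow> norm (of_real u powr a * exp (- (z * of_real u)) / (of_real u + V)) \<le> h u"
      by (rule integrable_Stieltjes_bound[OF a V]) blast
    show ?thesis unfolding f_def
      by (rule Bochner_Integration.integrable_bound[OF h(1)])
         (use h(2)[of 0] V in \<open>auto intro!: AE_I2 order_trans[OF _ abs_ge_self] borel_measurable_pos_lborel continuous_intros
            simp: add_of_real_neq_0\<close>)
  qed
  have val: "integral\<^sup>L pos_lborel (f V) = - of_real pi / sin (of_real pi * a) * V powr a" if "V \<notin> \<real>\<^sub>\<le>\<^sub>0" for V
    unfolding f_def by (rule Mellin_integral[OF a that])
  have fac: "of_real u + W \<noteq> 0" "of_real u + - W \<noteq> 0" "of_real u ^ 2 - W ^ 2 = (of_real u + W) * (of_real u + - W)"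
    if "u > 0" for u
    by (rule add_of_real_neq_0[OF that nn(1)], rule add_of_real_neq_0[OF that nn(2)],
        simp add: power2_eq_square algebra_simps)
  have alg: "P / (A * B) = (P / B - P / A) / (A - B)" "P * u' / (A * B) = (P / A + P / B) / 2"
    if "A \<noteq> 0" "B \<noteq> 0" "A \<noteq> B" "A + B = 2 * u'" for A B P u' :: complex
  proof -
    have "P / B - P / A = P / (A * B) * (A - B)" using that(1,2) by (simp add: field_simps)
    thus "P / (A * B) = (P / B - P / A) / (A - B)" using that(3) by simp
    have "(P / A + P / B) / 2 = P * (A + B) / (2 * (A * B))" using that(1,2) by (simp add: field_simps)
    thus "P * u' / (A * B) = (P / A + P / B) / 2" unfolding that(4) by simp
  qed
  have "(\<integral>u. of_real u powr a / (of_real u ^ 2 - W ^ 2) \<partial>pos_lborel) = (\<integral>u. (f (- W) u - f W u) / (2 * W) \<partial>pos_lborel)"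
  proof (intro Bochner_Integration.integral_cong refl)
    fix u assume "u \<in> space pos_lborel"
    hence u: "u > 0" by simp
    have ne: "of_real u + W \<noteq> of_real u + - W" using W0 by simp
    have "of_real u + W - (of_real u + - W) = 2 * W" by simp
    thus "of_real u powr a / (of_real u ^ 2 - W ^ 2) = (f (- W) u - f W u) / (2 * W)"
      unfolding f_def fac(3)[OF u] using alg(1)[OF fac(1,2)[OF u] ne, of "of_real u" "of_real u powr a"] by simp
  qed
  also have "\<dots> = - of_real pi / sin (of_real pi * a) * (W powr a * exp (\<i> * of_real pi * a) - W powr a) / (2 * W)"
    using int nn by (simp add: val powr_minus_neg[OF W] right_diff_distrib)
  also have "\<dots> = - of_real pi / sin (of_real pi * a) * (W powr (a - 1) * W * exp (\<i> * of_real pi * a) - W powr (a - 1) * W) / (2 * W)"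
  proof -
    have "W powr a = W powr (a - 1) * W" using W0 powr_add[of W "a - 1" 1] by simp
    thus ?thesis by (simp only:)
  qed
  also have "c * (V * W * E - V * W) / (2 * W) = c / 2 * V * (E - 1)" for c V E :: complex
    using W0 by (simp add: field_simps)
  finally show "(\<integral>u. of_real u powr a / (of_real u ^ 2 - W ^ 2) \<partial>pos_lborel) =
           - of_real pi / (2 * sin (of_real pi * a)) * W powr (a - 1) * (exp (\<i> * of_real pi * a) - 1)"
    by simp
  have "(\<integral>u. of_real u powr (a + 1) / (of_real u ^ 2 - W ^ 2) \<partial>pos_lborel) = (\<integral>u. (f W u + f (- W) u) / 2 \<partial>pos_lborel)"
  proof (intro Bochner_Integration.integral_cong refl)
    fix u assume "u \<in> space pos_lborel"
    hence u: "u > 0" by simp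
    have ne: "of_real u + W \<noteq> of_real u + - W" using W0 by simp
    have p: "of_real u powr (a + 1) = of_real u powr a * of_real u" using u by (simp add: powr_add)
    show "of_real u powr (a + 1) / (of_real u ^ 2 - W ^ 2) = (f W u + f (- W) u) / 2"
      unfolding f_def fac(3)[OF u] p using alg(2)[OF fac(1,2)[OF u] ne, of "of_real u" "of_real u powr a"] by simp
  qed
  also have "\<dots> = - of_real pi / sin (of_real pi * a) * (W powr a + W powr a * exp (\<i> * of_real pi * a)) / 2"
    using int nn by (simp add: val powr_minus_neg[OF W] ring_distribs)
  finally show "(\<integral>u. of_real u powr (a + 1) / (of_real u ^ 2 - W ^ 2) \<partial>pos_lborel) =
           - of_real pi / (2 * sin (of_real pi * a)) * W powr a * (exp (\<i> * of_real pi * a) + 1)"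
    by (simp add: field_simps)
qed

text \<open>Multiplication by i turns the sum of squares into a difference, and Re w > 0 puts i w
  and - i w off the real axis.\<close>

lemma norm_sum_squares_ge:
  fixes w :: complex
  assumes "Re w > 0"
  obtains \<kappa> where "\<kappa> > 0" "\<And>u d. u \<ge> 0 \<Longrightarrow> d > 0 \<Longrightarrow> norm (of_real u ^ 2 + (of_real d * w) ^ 2) \<ge> \<kappa> * (u + d) ^ 2"
proof -
  have nn: "\<i> * w \<notin> \<real>\<^sub>\<le>\<^sub>0" "- (\<i> * w) \<notin> \<real>\<^sub>\<le>\<^sub>0" by (rule not_nonpos_Reals_Im; use assms in simp)+
  obtain \<kappa> where \<kappa>: "\<kappa> > 0" "\<And>u d. u \<ge> 0 \<Longrightarrow> d > 0 \<Longrightarrow> norm (of_real u ^ 2 - (of_real d * (\<i> * w)) ^ 2) \<ge> \<kappa> * (u + d) ^ 2"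
    using nn by (rule norm_diff_squares_ge) blast
  show thesis by (rule that[OF \<kappa>(1)]) (use \<kappa>(2) in \<open>simp add: power_mult_distrib\<close>)
qed

lemma Re_one_over_pos: "Re w > 0 \<Longrightarrow> Re (1 / w) > 0"
  by (cases "w = 0") (auto simp: Re_divide zero_less_divide_iff sum_power2_gt_zero_iff)

text \<open>Splits quadratic decay unevenly between two variables. The exponent 1 + \<eta> makes the
  series in one variable converge, at the price of less decay in the other.\<close>

lemma add_powr_two_ge:
  fixes u d \<eta> :: real
  assumes "u > 0" "d > 0" "0 \<le> \<eta>" "\<eta> \<le> 1"
  shows "(u + d) ^ 2 \<ge> u powr (1 - \<eta>) * d powr (1 + \<eta>)"
proof -
  have "u powr (1 - \<eta>) * d powr (1 + \<eta>) \<le> (u + d) powr (1 - \<eta>) * (u + d) powr (1 + \<eta>)"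
    using assms by (intro mult_mono powr_mono2) auto
  also have "\<dots> = (u + d) powr 2" by (simp flip: powr_add)
  finally show ?thesis using assms by simp
qed

lemma summable_powr_over_sum_squares:
  fixes a c :: complex
  assumes "Re c > 0" "Re a < 0"
  shows "summable (\<lambda>d. norm (of_nat (Suc d) powr (a + 1) / (of_nat (Suc d) ^ 2 + c ^ 2)))"
proof -
  obtain \<kappa> where \<kappa>: "\<kappa> > 0" "\<And>u d. u \<ge> 0 \<Longrightarrow> d > 0 \<Longrightarrow> norm (of_real u ^ 2 + (of_real d * c) ^ 2) \<ge> \<kappa> * (u + d) ^ 2"
    using assms(1) by (rule norm_sum_squares_ge) blast
  show ?thesis
  proof (rule summable_comparison_test')
    show "summable (\<lambda>d. 1 / \<kappa> * real (Suc d) powr (Re a - 1))"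
      using assms by (intro summable_mult, subst summable_Suc_iff) (simp add: summable_real_powr_iff)
    show "norm (norm (of_nat (Suc d) powr (a + 1) / (of_nat (Suc d) ^ 2 + c ^ 2))) \<le> 1 / \<kappa> * real (Suc d) powr (Re a - 1)" for d
    proof -
      define D where "D = real (Suc d)"
      have D: "D > 0" "of_nat (Suc d) = complex_of_real D" by (auto simp: D_def)
      have "norm (of_real D powr (a + 1) / (of_real D ^ 2 + c ^ 2)) = D powr (Re a + 1) / norm (of_real D ^ 2 + c ^ 2)"
        using D by (simp add: norm_divide norm_powr_real_powr)
      also have "\<dots> \<le> D powr (Re a + 1) / (\<kappa> * D ^ 2)"
      proof (intro frac_le)
        have "\<kappa> * D ^ 2 \<le> \<kappa> * (D + 1) ^ 2" using \<kappa>(1) D by (intro mult_left_mono power_mono) auto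
        also have "\<dots> \<le> norm (of_real D ^ 2 + c ^ 2)" using \<kappa>(2)[of D 1] D by simp
        finally show "\<kappa> * D ^ 2 \<le> norm (of_real D ^ 2 + c ^ 2)" .
      qed (use \<kappa> D in auto)
      also have "D powr (Re a + 1) / (\<kappa> * D ^ 2) = 1 / \<kappa> * (D powr (Re a + 1) / D powr 2)" using D by simp
      also have "D powr (Re a + 1) / D powr 2 = D powr (Re a - 1)" by (simp flip: powr_diff)
      finally show ?thesis unfolding D(2) D_def[symmetric] by simp
    qed
  qed
qed

text \<open>
  Summing \<open>Phi\<close> over \<open>k\<close> gives the weight \<open>1 / (exp (z u) - 1)\<close>. Its partial fractions turn the
  integral into a series of Mellin integrals.
\<close>

lemma sums_kern:
  assumes Z: "Im Z < 0" "Re Z > 0" and a: "-1 < Re a" "Re a < 0" and c: "Re c > 0" "Re (c / Z) > 0"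
  shows "(\<lambda>k. kern a Z (2 * of_real pi * c * of_nat (Suc k))) sums
    (1 / (2 * sin (of_real pi * a / 2)) +
     c powr (- a) / of_real pi * (\<Sum>d. of_nat (Suc d) powr (a + 1) / (of_nat (Suc d) ^ 2 + c ^ 2)))"
proof -
  \<comment> \<open>With this value the k-th kernel involves \<open>Phi\<close> at a multiple of
    \<open>z\<close>, so its Laplace weights form a geometric series in k.\<close>
  define z where "z = 2 * of_real pi * c / Z"
  define X where "X = 2 * of_real pi * c"
  \<comment> \<open>Chosen so that z T = -2 pi i: the points d T are the poles of 1 / (exp (z u) -
    1) in the lower half-plane.\<close>
  define T where "T = - \<i> * (Z / c)"
  have nz: "Z \<noteq> 0" "c \<noteq> 0" "X \<noteq> 0" using Z c by (auto simp: X_def)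
  have Rez: "Re z > 0"
  proof -
    have "z = (2 * pi) *\<^sub>R (c / Z)" by (simp add: z_def scaleR_conv_of_real)
    thus ?thesis using c(2) by (simp only: scaleR_complex.simps) simp
  qed
  hence z0: "z \<noteq> 0" by auto
  have ReX: "Re X > 0" using c(1) by (simp add: X_def)
  have ReZc: "Re (Z / c) > 0"
  proof -
    have "Re (1 / (c / Z)) > 0" using c(2) by (rule Re_one_over_pos)
    thus ?thesis by simp
  qed
  have ImT: "Im T < 0" using ReZc by (simp add: T_def del: times_divide_eq_right)
  have T0: "T \<noteq> 0" using ImT by auto
  have zT: "z ^ 2 * T ^ 2 = - 4 * of_real pi ^ 2"
    using nz by (simp add: z_def T_def power_mult_distrib power_divide)
  have zZ: "z * Z = X" using nz by (simp add: z_def X_def)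
  define g where "g u = of_real u powr (a + 1) / (of_real u ^ 2 - Z ^ 2)" for u :: real
  have ImZ: "Im Z \<noteq> 0" using Z by simp
  define f where "f k u = of_real u powr (a + 1) * exp (- (of_nat (Suc k) * z * of_real u)) / (of_real u ^ 2 - Z ^ 2)"
    for k and u :: real
  have Rekz: "Re (of_nat (Suc k) * z) > 0" for k
    using Rez by (simp del: of_nat_Suc)
  have intf: "integrable pos_lborel (f k)" for k
    unfolding f_def using a Rekz by (intro integrable_Phi ImZ) auto
  have valf: "integral\<^sup>L pos_lborel (f k) = Phi a Z (of_nat (Suc k) * z)" for k
    unfolding f_def Phi_def ..
  have fsums: "(\<lambda>k. f k u) sums (g u / (exp (z * of_real u) - 1))" and fsumm: "summable (\<lambda>k. norm (f k u))"
    if u: "u > 0" for u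
  proof -
    have Reu: "Re (z * of_real u) > 0" using u Rez by simp
    have fk: "f k u = g u * exp (- (of_nat (Suc k) * (z * of_real u)))" for k
      by (simp add: f_def g_def mult.assoc del: of_nat_Suc)
    show "(\<lambda>k. f k u) sums (g u / (exp (z * of_real u) - 1))"
      using sums_mult[OF sums_exp_minus(1)[OF Reu], of "g u"] by (simp add: fk del: of_nat_Suc)
    show "summable (\<lambda>k. norm (f k u))"
      using summable_mult[OF sums_exp_minus(2)[OF Reu], of "norm (g u)"] by (simp add: fk norm_mult del: of_nat_Suc)
  qed
  have fint_summ: "summable (\<lambda>k. \<integral>u. norm (f k u) \<partial>pos_lborel)"
  proof -
    obtain \<kappa> where \<kappa>: "\<kappa> > 0" "\<And>a z. -2 < Re a \<Longrightarrow> Re z > 0 \<Longrightarrow>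
       (\<integral>u. norm (of_real u powr (a + 1) * exp (- (z * of_real u)) / (of_real u ^ 2 - Z ^ 2)) \<partial>pos_lborel)
         \<le> 2 * Gamma (Re a + 2) * Re z powr (- Re a - 2) / \<kappa>"
      using ImZ by (rule Phi_bound) blast
    show ?thesis
    proof (rule summable_comparison_test')
      show "summable (\<lambda>k. 2 * Gamma (Re a + 2) * Re z powr (- Re a - 2) / \<kappa> * real (Suc k) powr (- Re a - 2))"
        using a by (intro summable_mult, subst summable_Suc_iff) (simp add: summable_real_powr_iff)
      show "norm (\<integral>u. norm (f k u) \<partial>pos_lborel) \<le> 2 * Gamma (Re a + 2) * Re z powr (- Re a - 2) / \<kappa> * real (Suc k) powr (- Re a - 2)" for k
      proof -
        have "Re (of_nat (Suc k) * z) = real (Suc k) * Re z" by simp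
        hence "Re (of_nat (Suc k) * z) powr (- Re a - 2) = real (Suc k) powr (- Re a - 2) * Re z powr (- Re a - 2)"
          using Rez by (simp only: powr_mult)
        thus ?thesis using \<kappa>(2)[of a "of_nat (Suc k) * z"] a Rekz[of k] unfolding f_def[symmetric]
          by (simp add: integral_nonneg_AE field_simps del: of_nat_Suc)
      qed
    qed
  qed
  have fae: "AE u in pos_lborel. summable (\<lambda>k. norm (f k u))" using fsumm by (intro AE_I2) auto
  define J where "J = (\<integral>u. g u / (exp (z * of_real u) - 1) \<partial>pos_lborel)"
  have J_sums: "(\<lambda>k. Phi a Z (of_nat (Suc k) * z)) sums J"
  proof -
    have "(\<Sum>k. f k u) = g u / (exp (z * of_real u) - 1)" if "u \<in> space pos_lborel" for u
      using fsums[of u] that by (simp add: sums_iff)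
    hence "(\<integral>u. (\<Sum>k. f k u) \<partial>pos_lborel) = J"
      unfolding J_def by (intro Bochner_Integration.integral_cong refl) auto
    moreover have "summable (\<lambda>k. Phi a Z (of_nat (Suc k) * z))"
    proof (rule summable_comparison_test'[OF fint_summ])
      show "norm (Phi a Z (of_nat (Suc k) * z)) \<le> (\<integral>u. norm (f k u) \<partial>pos_lborel)" for k
        using integral_norm_bound[of pos_lborel "f k"] by (simp add: valf)
    qed
    ultimately show ?thesis
      using integral_suminf[OF intf fae fint_summ] by (simp add: sums_iff valf)
  qed
  define p where "p W u = of_real u powr a / (of_real u ^ 2 - W ^ 2)" for W and u :: real
  define D where "D d = complex_of_nat (Suc d)" for d
  have D_real: "D d = of_real (real (Suc d))" for d by (simp add: D_def)
  have ImDT: "Im (D d * T) < 0" for d unfolding D_real using ImT by (simp add: mult_pos_neg del: of_nat_Suc)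
  define s where "s = - of_real pi / (2 * sin (of_real pi * a))"
  define E where "E = exp (\<i> * of_real pi * a)"
  have intp: "integrable pos_lborel (p W)" if "Im W \<noteq> 0" for W
    unfolding p_def using that a by (intro integrable_powr_over_diff_squares) auto
  have valp: "integral\<^sup>L pos_lborel (p W) = s * W powr (a - 1) * (E - 1)" if "Im W < 0" for W
    unfolding p_def s_def E_def by (rule integral_powr_over_diff_squares(1)[OF that a])
  have intg: "integrable pos_lborel g"
    unfolding g_def using a ImZ by (intro integrable_powr_over_diff_squares) auto
  have valg: "integral\<^sup>L pos_lborel g = s * Z powr a * (E + 1)"
    unfolding g_def s_def E_def by (rule integral_powr_over_diff_squares(2)[OF Z(1) a])
  have cD: "c ^ 2 + D d ^ 2 \<noteq> 0" for d
  proof -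
    obtain \<kappa> where \<kappa>: "\<kappa> > 0" "\<And>u d. u \<ge> 0 \<Longrightarrow> d > 0 \<Longrightarrow> norm (of_real u ^ 2 + (of_real d * c) ^ 2) \<ge> \<kappa> * (u + d) ^ 2"
      using c(1) by (rule norm_sum_squares_ge) blast
    have "0 < \<kappa> * (real (Suc d) + 1) ^ 2" using \<kappa>(1) by (intro mult_pos_pos) auto
    also have "\<dots> \<le> norm (c ^ 2 + D d ^ 2)" using \<kappa>(2)[of "real (Suc d)" 1] by (simp add: D_real add.commute del: of_nat_Suc)
    finally show ?thesis by auto
  qed
  have ZT: "Z ^ 2 - (D d * T) ^ 2 = Z ^ 2 * (c ^ 2 + D d ^ 2) / c ^ 2" for d
    using nz by (simp add: T_def power_mult_distrib power_divide field_simps)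
  have ZT0: "Z ^ 2 - (D d * T) ^ 2 \<noteq> 0" for d unfolding ZT using cD nz by simp
  \<comment> \<open>The d-th partial fraction multiplied by \<open>g\<close>, already decomposed in
    u^2, so that its integral reduces to those of \<open>p\<close> at \<open>Z\<close> and at d T.
    \<open>F_eq\<close> gives the undecomposed form.\<close>
  define F where "F d u = 2 / z * ((Z ^ 2 * p Z u - (D d * T) ^ 2 * p (D d * T) u) / (Z ^ 2 - (D d * T) ^ 2))" for d u
  have intF: "integrable pos_lborel (F d)" for d
    unfolding F_def using intp[OF ImZ] intp[of "D d * T"] ImDT[of d]
    by (intro Bochner_Integration.integrable_mult_right Bochner_Integration.integrable_divide Bochner_Integration.integrable_diff) auto
  have valF: "integral\<^sup>L pos_lborel (F d) = 2 / z * ((Z ^ 2 * (s * Z powr (a - 1) * (E - 1)) - (D d * T) ^ 2 * (s * (D d * T) powr (a - 1) * (E - 1))) / (Z ^ 2 - (D d * T) ^ 2))" for d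
    unfolding F_def using intp[OF ImZ] intp[of "D d * T"] ImDT[of d] valp[OF Z(1)] valp[OF ImDT[of d]]
    by (subst integral_mult_right_zero, subst integral_divide_zero, subst Bochner_Integration.integral_diff)
       (auto intro!: Bochner_Integration.integrable_mult_right)
  have F_eq: "F d u = 2 / z * (of_real u powr (a + 2) / ((of_real u ^ 2 - Z ^ 2) * (of_real u ^ 2 - (D d * T) ^ 2)))" if u: "u > 0" for d u
  proof -
    have n1: "of_real u ^ 2 - Z ^ 2 \<noteq> 0" by (rule diff_squares_neq_0[OF ImZ u])
    have n2: "of_real u ^ 2 - (D d * T) ^ 2 \<noteq> 0" using ImDT[of d] by (intro diff_squares_neq_0 u) auto
    have up: "of_real u powr (a + 2) = of_real u powr a * of_real u ^ 2"
      using u by (simp add: powr_add)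
    have alg: "(A * (P / (y - A)) - B * (P / (y - B))) / (A - B) = P * y / ((y - A) * (y - B))"
      if "y - A \<noteq> 0" "y - B \<noteq> 0" "A - B \<noteq> 0" for A B P y :: complex
    proof -
      have "A * (P / (y - A)) - B * (P / (y - B)) = P * y / ((y - A) * (y - B)) * (A - B)"
        using that(1,2) by (simp add: divide_simps) (simp add: algebra_simps)
      thus ?thesis using that(3) by simp
    qed
    show ?thesis unfolding F_def p_def up
      by (subst alg[OF n1 n2 ZT0]) simp
  qed
  have F_sums: "(\<lambda>d. F d u) sums (g u / (exp (z * of_real u) - 1) - (1 / z * p Z u - 1 / 2 * g u))" if u: "u > 0" for u
  proof -
    have "Re (z * of_real u) > 0" using Rez u by simp
    from sums_mult[OF coth_partial_fractions[OF this], of "g u"]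
    have "(\<lambda>d. g u * (2 * (z * of_real u) / ((z * of_real u) ^ 2 + 4 * of_real pi ^ 2 * of_nat (Suc d) ^ 2))) sums
      (g u * (1 / (exp (z * of_real u) - 1) - 1 / (z * of_real u) + 1 / 2))" .
    moreover have "g u * (2 * (z * of_real u) / ((z * of_real u) ^ 2 + 4 * of_real pi ^ 2 * of_nat (Suc d) ^ 2)) = F d u" for d
    proof -
      have n2: "of_real u ^ 2 - (D d * T) ^ 2 \<noteq> 0" using ImDT[of d] by (intro diff_squares_neq_0 u) auto
      have "(z * of_real u) ^ 2 + 4 * of_real pi ^ 2 * of_nat (Suc d) ^ 2 = z ^ 2 * of_real u ^ 2 - (z ^ 2 * T ^ 2) * D d ^ 2"
        unfolding zT by (simp add: D_def power_mult_distrib)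
      also have "\<dots> = z ^ 2 * (of_real u ^ 2 - (D d * T) ^ 2)" by (simp add: power_mult_distrib algebra_simps)
      finally have den: "(z * of_real u) ^ 2 + 4 * of_real pi ^ 2 * of_nat (Suc d) ^ 2 = z ^ 2 * (of_real u ^ 2 - (D d * T) ^ 2)" .
      have up: "of_real u powr (a + 2) = of_real u powr (a + 1) * of_real u"
        using u powr_add[of "of_real u" "a + 1" 1] by (simp add: add.assoc)
      show ?thesis unfolding den F_eq[OF u] g_def up using z0 by (simp add: power2_eq_square[of z] mult_ac)
    qed
    moreover have "g u * (1 / (exp (z * of_real u) - 1) - 1 / (z * of_real u) + 1 / 2) =
       g u / (exp (z * of_real u) - 1) - (1 / z * p Z u - 1 / 2 * g u)"
    proof -
      have "of_real u powr (a + 1) = of_real u powr a * of_real u" using u by (simp add: powr_add)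
      hence "g u * (1 / (z * of_real u)) = 1 / z * p Z u" using u by (simp add: g_def p_def)
      thus ?thesis by (simp add: algebra_simps)
    qed
    ultimately show ?thesis by (simp only:)
  qed
  \<comment> \<open>A positive \<eta> makes the majorants summable over d, and Re a + \<eta> < 0
    keeps the integral over u convergent at infinity.\<close>
  define \<eta> where "\<eta> = - Re a / 2"
  have \<eta>: "0 < \<eta>" "\<eta> < 1" "Re a + \<eta> < 0" using a by (auto simp: \<eta>_def)
  obtain C where C: "C \<ge> 0" "\<And>d u. u > 0 \<Longrightarrow> norm (F d u) \<le> C * real (Suc d) powr (- 1 - \<eta>) * (u powr (Re a + 1 + \<eta>) / (1 + u) powr 2)"
  proof -
    have nn: "Z \<notin> \<real>\<^sub>\<le>\<^sub>0" "- Z \<notin> \<real>\<^sub>\<le>\<^sub>0" "T \<notin> \<real>\<^sub>\<le>\<^sub>0" "- T \<notin> \<real>\<^sub>\<le>\<^sub>0"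
      by (rule not_nonpos_Reals_Im; use ImZ ImT in simp)+
    obtain \<kappa>1 where 1: "\<kappa>1 > 0" "\<And>u d. u \<ge> 0 \<Longrightarrow> d > 0 \<Longrightarrow> norm (of_real u ^ 2 - (of_real d * Z) ^ 2) \<ge> \<kappa>1 * (u + d) ^ 2"
      using nn(1,2) by (rule norm_diff_squares_ge) blast
    obtain \<kappa>2 where 2: "\<kappa>2 > 0" "\<And>u d. u \<ge> 0 \<Longrightarrow> d > 0 \<Longrightarrow> norm (of_real u ^ 2 - (of_real d * T) ^ 2) \<ge> \<kappa>2 * (u + d) ^ 2"
      using nn(3,4) by (rule norm_diff_squares_ge) blast
    define C where "C = norm (2 / z) / (\<kappa>1 * \<kappa>2)"
    have "norm (F d u) \<le> C * real (Suc d) powr (- 1 - \<eta>) * (u powr (Re a + 1 + \<eta>) / (1 + u) powr 2)" if u: "u > 0" for d u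
    proof -
      define N where "N = real (Suc d)"
      have N: "N > 0" by (simp add: N_def)
      have pw1: "u powr (Re a + 2) = u powr (Re a + 1 + \<eta>) * u powr (1 - \<eta>)"
        by (simp add: algebra_simps flip: powr_add)
      have pw2: "N powr (- 1 - \<eta>) = 1 / N powr (1 + \<eta>)"
        using powr_minus_divide[of N "1 + \<eta>"] by simp
      have "norm (F d u) = norm (2 / z) * (u powr (Re a + 2) / (norm (of_real u ^ 2 - Z ^ 2) * norm (of_real u ^ 2 - (of_real N * T) ^ 2)))"
        using u by (simp add: F_eq norm_mult norm_divide norm_powr_real_powr D_real N_def del: of_nat_Suc)
      also have "\<dots> \<le> norm (2 / z) * (u powr (Re a + 2) / ((\<kappa>1 * (1 + u) powr 2) * (\<kappa>2 * (u powr (1 - \<eta>) * N powr (1 + \<eta>)))))"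
      proof (intro mult_left_mono frac_le mult_mono)
        show "\<kappa>1 * (1 + u) powr 2 \<le> norm (of_real u ^ 2 - Z ^ 2)" using 1(2)[of u 1] u by (simp add: add.commute)
        have "\<kappa>2 * (u powr (1 - \<eta>) * N powr (1 + \<eta>)) \<le> \<kappa>2 * (u + N) ^ 2"
          using 2(1) u N \<eta> by (intro mult_left_mono add_powr_two_ge) auto
        also have "\<dots> \<le> norm (of_real u ^ 2 - (of_real N * T) ^ 2)" using u N by (intro 2(2)) auto
        finally show "\<kappa>2 * (u powr (1 - \<eta>) * N powr (1 + \<eta>)) \<le> norm (of_real u ^ 2 - (of_real N * T) ^ 2)" .
      qed (use u N 1(1) 2(1) in auto)
      also have "\<dots> = C * N powr (- 1 - \<eta>) * (u powr (Re a + 1 + \<eta>) / (1 + u) powr 2)"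
        unfolding C_def pw1 pw2 using u N 1(1) 2(1) by simp
      finally show ?thesis by (simp only: N_def)
    qed
    moreover have "C \<ge> 0" using 1 2 by (simp add: C_def)
    ultimately show thesis using that by blast
  qed
  define B where "B = (\<integral>u. u powr (Re a + 1 + \<eta>) / (1 + u) powr 2 \<partial>pos_lborel)"
  have intB: "integrable pos_lborel (\<lambda>u. u powr (Re a + 1 + \<eta>) / (1 + u) powr 2)"
    using a \<eta> by (intro integrable_powr_over) auto
  have summD: "summable (\<lambda>d. C * real (Suc d) powr (- 1 - \<eta>) * K)" for K
    using \<eta> by (intro summable_mult2 summable_mult, subst summable_Suc_iff) (simp add: summable_real_powr_iff)
  have Fae: "AE u in pos_lborel. summable (\<lambda>d. norm (F d u))"
  proof (intro AE_I2)
    fix u assume "u \<in> space pos_lborel"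
    hence u: "u > 0" by simp
    show "summable (\<lambda>d. norm (F d u))"
      by (rule summable_comparison_test'[OF summD]) (use C(2)[OF u] in \<open>simp only: real_norm_def abs_norm_cancel\<close>)
  qed
  have Fint: "summable (\<lambda>d. \<integral>u. norm (F d u) \<partial>pos_lborel)"
  proof (rule summable_comparison_test'[OF summD])
    fix d
    have "(\<integral>u. norm (F d u) \<partial>pos_lborel) \<le> (\<integral>u. C * real (Suc d) powr (- 1 - \<eta>) * (u powr (Re a + 1 + \<eta>) / (1 + u) powr 2) \<partial>pos_lborel)"
      using intF[of d] intB C(2) by (intro integral_mono Bochner_Integration.integrable_mult_right) auto
    also have "\<dots> = C * real (Suc d) powr (- 1 - \<eta>) * B" by (simp only: B_def integral_mult_right_zero)
    finally show "norm (\<integral>u. norm (F d u) \<partial>pos_lborel) \<le> C * real (Suc d) powr (- 1 - \<eta>) * B"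
      by (simp add: integral_nonneg_AE)
  qed
  have J_eq: "J = 1 / z * (s * Z powr (a - 1) * (E - 1)) - 1 / 2 * (s * Z powr a * (E + 1)) + (\<Sum>d. integral\<^sup>L pos_lborel (F d))"
  proof -
    have "J = (\<integral>u. (1 / z * p Z u - 1 / 2 * g u) + (\<Sum>d. F d u) \<partial>pos_lborel)"
      unfolding J_def by (intro Bochner_Integration.integral_cong refl) (use F_sums in \<open>auto simp: sums_iff\<close>)
    also have "\<dots> = (\<integral>u. 1 / z * p Z u - 1 / 2 * g u \<partial>pos_lborel) + (\<integral>u. (\<Sum>d. F d u) \<partial>pos_lborel)"
      by (intro Bochner_Integration.integral_add Bochner_Integration.integrable_diff
          Bochner_Integration.integrable_mult_right intp intg ImZ integrable_suminf[OF intF Fae Fint])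
    also have "(\<integral>u. (\<Sum>d. F d u) \<partial>pos_lborel) = (\<Sum>d. integral\<^sup>L pos_lborel (F d))"
      by (rule integral_suminf[OF intF Fae Fint])
    also have "(\<integral>u. 1 / z * p Z u - 1 / 2 * g u \<partial>pos_lborel) = (\<integral>u. 1 / z * p Z u \<partial>pos_lborel) - (\<integral>u. 1 / 2 * g u \<partial>pos_lborel)"
      by (intro Bochner_Integration.integral_diff Bochner_Integration.integrable_mult_right intp intg ImZ)
    finally show ?thesis by (simp only: integral_mult_right_zero valp[OF Z(1)] valg)
  qed
  define U where "U = (\<Sum>d. D d powr (a + 1) / (D d ^ 2 + c ^ 2))"
  define q where "q = 1 / (exp X - 1)"
  define \<beta> where "\<beta> = s * (E - 1) / of_real pi * exp (- (\<i> * of_real pi * (a - 1) / 2)) * Z powr a * c powr (- a)"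
  have ZZ: "Z powr a = Z powr (a - 1) * Z" using nz powr_add[of Z "a - 1" 1] by simp
  \<comment> \<open>The contribution of the pole \<open>Z\<close> is again a coth partial fraction,
    now at X = z Z, and sums in closed form. The contribution of the poles d T is the series over d
    in the conclusion.\<close>
  have valF': "integral\<^sup>L pos_lborel (F d) = s * Z powr a * (E - 1) * (2 * X / (X ^ 2 + 4 * of_real pi ^ 2 * of_nat (Suc d) ^ 2)) + \<beta> * (D d powr (a + 1) / (D d ^ 2 + c ^ 2))" for d
  proof -
    have LnT: "T powr (a - 1) = exp (- (\<i> * of_real pi * (a - 1) / 2)) * Z powr (a - 1) * c powr (1 - a)"
    proof -
      have "\<bar>Im (Ln (Z / c))\<bar> < pi / 2" "\<bar>Im (Ln c)\<bar> < pi / 2" by (rule Re_Ln_pos_lt_imp; use ReZc c in simp)+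
      hence "Ln (Z / c * c) = Ln (Z / c) + Ln c" using nz by (intro Ln_times_simple) auto
      hence 1: "Ln (Z / c) = Ln Z - Ln c" using nz by simp
      have "Ln (- \<i> * (Z / c)) = Ln (Z / c) - \<i> * of_real pi / 2"
        using nz Ln_times_ii[of "- (Z / c)"] \<open>\<bar>Im (Ln (Z / c))\<bar> < pi / 2\<close>
        by (subst Ln_times_simple) (auto simp: Ln_minus_ii)
      hence LT: "Ln T = Ln Z - Ln c - \<i> * of_real pi / 2" by (simp add: T_def 1)
      have "T powr (a - 1) = exp ((a - 1) * (Ln Z - Ln c - \<i> * of_real pi / 2))"
        using T0 by (simp only: powr_def LT if_False)
      also have "(a - 1) * (Ln Z - Ln c - \<i> * of_real pi / 2) =
          - (\<i> * of_real pi * (a - 1) / 2) + (a - 1) * Ln Z + (1 - a) * Ln c"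
        by (simp add: field_simps)
      finally show ?thesis using nz by (simp only: exp_add powr_def if_False)
    qed
    have DT: "(D d * T) powr (a - 1) = D d powr (a - 1) * T powr (a - 1)"
      unfolding D_real by (rule powr_mult_of_real) simp
    have D0: "D d \<noteq> 0" unfolding D_def of_nat_eq_0_iff by simp
    have DD: "D d powr (a + 1) = D d powr (a - 1) * D d ^ 2"
    proof -
      have "a + 1 = (a - 1) + 2" by simp
      hence "D d powr (a + 1) = D d powr ((a - 1) + 2)" by (simp only:)
      also have "\<dots> = D d powr (a - 1) * D d powr 2" by (rule powr_add)
      finally show ?thesis using D0 by simp
    qed
    have cc: "c powr (1 - a) = c * c powr (- a)" using nz powr_add[of c 1 "- a"] by simp
    have XX: "X ^ 2 + 4 * of_real pi ^ 2 * of_nat (Suc d) ^ 2 = 4 * of_real pi ^ 2 * (c ^ 2 + D d ^ 2)"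
      by (simp add: X_def D_def power_mult_distrib algebra_simps)
    define V where "V = c ^ 2 + D d ^ 2"
    have V: "V \<noteq> 0" "D d ^ 2 + c ^ 2 = V" using cD by (auto simp: V_def add.commute)
    define e where "e = exp (- (\<i> * of_real pi * (a - 1) / 2))"
    have T2: "(D d * T) ^ 2 = - (D d ^ 2 * Z ^ 2 / c ^ 2)" by (simp add: T_def power_mult_distrib power_divide)
    have "integral\<^sup>L pos_lborel (F d) = 2 / z * ((Z ^ 2 * (s * Z powr (a - 1) * (E - 1)) + D d ^ 2 * Z ^ 2 / c ^ 2 * (s * (D d powr (a - 1) * (e * Z powr (a - 1) * (c * c powr (- a)))) * (E - 1))) / (Z ^ 2 * V / c ^ 2))"
      unfolding valF ZT V_def[symmetric] unfolding DT LnT cc T2 e_def by simp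
    also have "\<dots> = s * (Z powr (a - 1) * Z) * (E - 1) * (c / (of_real pi * V)) + s * (E - 1) / of_real pi * e * (Z powr (a - 1) * Z) * c powr (- a) * (D d powr (a - 1) * D d ^ 2 / V)"
      unfolding z_def using nz V by (simp add: field_simps power2_eq_square)
    also have "c / (of_real pi * V) = 2 * X / (X ^ 2 + 4 * of_real pi ^ 2 * of_nat (Suc d) ^ 2)"
      unfolding XX unfolding V_def[symmetric] X_def using V by (simp add: field_simps power2_eq_square)
    finally show ?thesis
      unfolding \<beta>_def V(2) ZZ[symmetric] DD[symmetric] e_def[symmetric] .
  qed
  have Usums: "(\<lambda>d. D d powr (a + 1) / (D d ^ 2 + c ^ 2)) sums U"
    unfolding U_def D_def using summable_powr_over_sum_squares[OF c(1) a(2)]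
    by (intro summable_sums) (rule summable_norm_cancel)
  have "(\<lambda>d. integral\<^sup>L pos_lborel (F d)) sums (s * Z powr a * (E - 1) * (q - 1 / X + 1 / 2) + \<beta> * U)"
    unfolding valF' q_def by (intro sums_add sums_mult coth_partial_fractions[OF ReX] Usums)
  hence J_eq2: "J = 1 / z * (s * Z powr (a - 1) * (E - 1)) - 1 / 2 * (s * Z powr a * (E + 1)) + (s * Z powr a * (E - 1) * (q - 1 / X + 1 / 2) + \<beta> * U)"
    unfolding J_eq by (simp only: sums_iff)
  have "1 / z * Z powr (a - 1) = Z powr a * (1 / X)"
    unfolding ZZ zZ[symmetric] using nz z0 by (simp add: field_simps)
  hence *: "1 / z * (s * Z powr (a - 1) * (E - 1)) = s * Z powr a * (E - 1) * (1 / X)" by (simp add: mult_ac)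
  \<comment> \<open>Here \<open>x\<close> stands for 1 / X. Those terms cancel, and (E - 1) / 2 - (E
    + 1) / 2 = -1, which is the origin of the cosecant constant.\<close>
  have "t * (E - 1) * x - 1 / 2 * (t * (E + 1)) + (t * (E - 1) * (q - x + 1 / 2) + v) = t * ((E - 1) * q - 1) + v" for t x v :: complex
    by (simp add: algebra_simps add_divide_distrib diff_divide_distrib)
  hence J_eq3: "J = s * Z powr a * ((E - 1) * q - 1) + \<beta> * U"
    unfolding J_eq2 * by (simp only:)
  define h where "h = of_real pi * a / 2"
  have sin0: "sin (of_real pi * a) \<noteq> 0" by (rule sin_pi_neq_0[OF a])
  have pa: "of_real pi * a = 2 * h" by (simp add: h_def)
  have s2: "sin (of_real pi * a) = 2 * sin h * cos h" unfolding pa by (rule sin_double)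
  have sc0: "sin h \<noteq> 0" "cos h \<noteq> 0" using sin0 s2 by auto
  have cs: "2 * cos h / of_real pi * s = - (1 / (2 * sin h))"
    unfolding s_def s2 using sc0 by (simp add: field_simps)
  have E1: "E - 1 = 2 * \<i> * exp (\<i> * h) * sin h"
  proof -
    have "E = exp (\<i> * h) ^ 2" unfolding E_def by (simp add: h_def mult.assoc flip: exp_double)
    thus ?thesis unfolding sin_exp_eq exp_minus by (simp add: field_simps power2_eq_square)
  qed
  have "exp (- (\<i> * of_real pi * (a - 1) / 2)) = exp (- (\<i> * h) + \<i> * (of_real pi / 2))"
    by (simp add: h_def algebra_simps diff_divide_distrib)
  also have "\<dots> = exp (- (\<i> * h)) * \<i>"
  proof -
    have "exp (\<i> * (of_real pi / 2)) = cis (pi / 2)" by (simp add: cis_conv_exp)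
    thus ?thesis by (simp only: exp_add cis_pi_half)
  qed
  finally have e2: "exp (- (\<i> * of_real pi * (a - 1) / 2)) = \<i> / exp (\<i> * h)" by (simp add: exp_minus field_simps)
  have Za: "Z powr (- a) * Z powr a = 1" using nz by (simp add: powr_minus)
  \<comment> \<open>The term with \<open>q\<close> in \<open>J\<close> cancels exactly against the
    sum of the exp (-x) parts of the kernels, since E - 1 = 2 i exp (i h) sin h.\<close>
  have main: "2 * cos h / of_real pi * Z powr (- a) * J + \<i> * exp (\<i> * h) * q = 1 / (2 * sin h) + c powr (- a) / of_real pi * U"
  proof -
    have "2 * cos h / of_real pi * Z powr (- a) * J =
        (2 * cos h / of_real pi * s) * ((Z powr (- a) * Z powr a) * ((E - 1) * q - 1 + (E - 1) / of_real pi * exp (- (\<i> * of_real pi * (a - 1) / 2)) * c powr (- a) * U))"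
      unfolding J_eq3 \<beta>_def by (simp add: algebra_simps add_divide_distrib diff_divide_distrib)
    also have "\<dots> = - (1 / (2 * sin h)) * ((E - 1) * q - 1 + (E - 1) / of_real pi * (\<i> / exp (\<i> * h)) * c powr (- a) * U)"
      unfolding cs Za e2 by simp
    finally show ?thesis unfolding E1 using sc0 by (simp add: field_simps)
  qed
  have "(\<lambda>k. exp (- (X * of_nat (Suc k)))) sums q"
    using sums_exp_minus(1)[OF ReX] by (simp only: q_def mult.commute[of X])
  from sums_add[OF sums_mult[OF J_sums, of "2 * cos h / of_real pi * Z powr (- a)"] sums_mult[OF this, of "\<i> * exp (\<i> * h)"]]
  have "(\<lambda>k. 2 * cos h / of_real pi * Z powr (- a) * Phi a Z (of_nat (Suc k) * z) + \<i> * exp (\<i> * h) * exp (- (X * of_nat (Suc k)))) sums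
    (1 / (2 * sin h) + c powr (- a) / of_real pi * U)"
    unfolding main .
  moreover have "2 * cos h / of_real pi * Z powr (- a) * Phi a Z (of_nat (Suc k) * z) + \<i> * exp (\<i> * h) * exp (- (X * of_nat (Suc k))) =
     kern a Z (2 * of_real pi * c * of_nat (Suc k))" for k
  proof -
    have "2 * of_real pi * c * of_nat (Suc k) / Z = of_nat (Suc k) * z" by (simp add: z_def)
    moreover have "\<i> * of_real pi * a / 2 = \<i> * h" by (simp add: h_def)
    ultimately show ?thesis unfolding kern_def X_def h_def by (simp only:)
  qed
  ultimately show ?thesis by (simp only: U_def D_def h_def)
qed

section \<open>Divisor sums\<close>

lemma suminf_eq_infsum:
  fixes f :: "nat \<Rightarrow> 'a :: banach"
  assumes "f summable_on UNIV"
  shows "suminf f = infsum f UNIV"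
  using has_sum_imp_sums[OF has_sum_infsum[OF assms]] by (simp add: sums_iff)

text \<open>A product majorant reduces absolute summability of a double series to two single series;
  every rearrangement below is justified in this way.\<close>

lemma summable_on_prod_of_bound:
  fixes f :: "nat \<Rightarrow> nat \<Rightarrow> complex"
  assumes f: "\<And>i j. norm (f i j) \<le> A i * B j" and A: "summable A" and B: "summable B"
    and nonneg: "\<And>i. A i \<ge> 0" "\<And>j. B j \<ge> 0"
  shows "Infinite_Sum.abs_summable_on (\<lambda>(i, j). f i j) (UNIV \<times> UNIV)"
proof (rule Infinite_Sum.abs_summable_on_comparison_test)
  have 1: "A summable_on UNIV" "B summable_on UNIV"
    using A B nonneg by (auto simp: summable_on_UNIV_nonneg_real_iff)
  have "Infinite_Sum.abs_summable_on (\<lambda>(i, j). A i * B j) (UNIV \<times> UNIV)"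
    unfolding Infinite_Sum.abs_summable_on_Sigma_iff
    using 1 nonneg by (auto simp: abs_mult infsum_cmult_right' intro!: summable_on_cmult_right summable_on_cmult_left)
  thus "Infinite_Sum.abs_summable_on (\<lambda>(i, j). A i * B j) (UNIV \<times> UNIV)" .
qed (use f nonneg in \<open>auto intro: order_trans[OF _ abs_ge_self]\<close>)

lemma suminf_swap:
  fixes f :: "nat \<Rightarrow> nat \<Rightarrow> complex"
  assumes f: "\<And>i j. norm (f i j) \<le> A i * B j" and A: "summable A" and B: "summable B"
    and nonneg: "\<And>i. A i \<ge> 0" "\<And>j. B j \<ge> 0"
  shows "(\<lambda>i. \<Sum>j. f i j) sums (\<Sum>j. \<Sum>i. f i j)"
proof -
  have s: "(\<lambda>(i, j). f i j) summable_on (UNIV \<times> UNIV)"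
    by (rule Infinite_Sum.abs_summable_summable, rule summable_on_prod_of_bound[of f A B, OF assms])
  have s': "(\<lambda>(j, i). f i j) summable_on (UNIV \<times> UNIV)"
  proof (rule Infinite_Sum.abs_summable_summable, rule summable_on_prod_of_bound[of "\<lambda>j i. f i j" B A])
    show "norm (f i j) \<le> B j * A i" for i j using f[of i j] by (simp add: mult.commute)
  qed (fact A B nonneg)+
  have "f i summable_on UNIV" for i
    by (intro norm_summable_imp_summable_on summable_comparison_test'[OF summable_mult[OF B, of "A i"]]) (use f in auto)
  hence 1: "(\<Sum>j. f i j) = infsum (f i) UNIV" for i by (rule suminf_eq_infsum)
  have "(\<lambda>i. f i j) summable_on UNIV" for j
    by (intro norm_summable_imp_summable_on summable_comparison_test'[OF summable_mult2[OF A, of "B j"]]) (use f in auto)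
  hence 2: "(\<Sum>i. f i j) = infsum (\<lambda>i. f i j) UNIV" for j by (rule suminf_eq_infsum)
  have "(\<lambda>i. infsum (f i) UNIV) summable_on UNIV" "(\<lambda>j. infsum (\<lambda>i. f i j) UNIV) summable_on UNIV"
    using summable_on_Sigma_banach[OF s] summable_on_Sigma_banach[OF s'] by auto
  hence "((\<lambda>i. infsum (f i) UNIV) has_sum infsum (\<lambda>j. infsum (\<lambda>i. f i j) UNIV) UNIV) UNIV"
    "(\<Sum>j. infsum (\<lambda>i. f i j) UNIV) = infsum (\<lambda>j. infsum (\<lambda>i. f i j) UNIV) UNIV"
    using infsum_swap_banach[OF s] by (auto simp: has_sum_iff suminf_eq_infsum)
  hence h1: "((\<lambda>i. infsum (f i) UNIV) has_sum (\<Sum>j. infsum (\<lambda>i. f i j) UNIV)) UNIV" by (simp only:)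
  show ?thesis unfolding 1 2 by (rule has_sum_imp_sums[OF h1])
qed

text \<open>A pair of positive integers corresponds to its product together with the first factor as
  a divisor. Absolute summability permits the regrouping.\<close>

lemma suminf_divisors:
  fixes f :: "nat \<Rightarrow> nat \<Rightarrow> complex"
  assumes f: "\<And>i j. norm (f (Suc i) (Suc j)) \<le> A i * B j" and A: "summable A" and B: "summable B"
    and nonneg: "\<And>i. A i \<ge> 0" "\<And>j. B j \<ge> 0"
  shows "(\<lambda>n. \<Sum>d | d dvd Suc n. f d (Suc n div d)) sums (\<Sum>i. \<Sum>j. f (Suc i) (Suc j))"
proof -
  define g where "g = (\<lambda>(i, j). f (Suc i) (Suc j))"
  define h where "h = (\<lambda>(n, d). f d (Suc n div d))"
  define T where "T = (SIGMA n:UNIV. {d. d dvd Suc n})"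
  have s: "g summable_on (UNIV \<times> UNIV)"
    unfolding g_def
    by (rule Infinite_Sum.abs_summable_summable, rule summable_on_prod_of_bound[of "\<lambda>i j. f (Suc i) (Suc j)" A B, OF assms])
  \<comment> \<open>Indices start at 0 and stand for their successors. Divisors and cofactors are
    positive, so the subtractions of 1 do not truncate.\<close>
  let ?i = "\<lambda>(i, j). (Suc i * Suc j - 1, Suc i)" and ?j = "\<lambda>(n, d). (d - 1, Suc n div d - 1)"
  have bij: "\<And>x. x \<in> T \<Longrightarrow> ?i (?j x) = x" "\<And>x. x \<in> T \<Longrightarrow> ?j x \<in> UNIV \<times> UNIV"
     "\<And>x. x \<in> UNIV \<times> UNIV \<Longrightarrow> ?j (?i x) = x" "\<And>x. x \<in> UNIV \<times> UNIV \<Longrightarrow> ?i x \<in> T"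
     "\<And>x. x \<in> T \<Longrightarrow> g (?j x) = h x"
  proof -
    fix x assume "x \<in> T"
    then obtain n d where x: "x = (n, d)" "d dvd Suc n" by (auto simp: T_def)
    from x(2) have d0: "d > 0" by (cases d) auto
    from x(2) have "d \<le> Suc n" by (rule dvd_imp_le) simp
    hence d: "d > 0" "Suc n div d > 0" "d * (Suc n div d) = Suc n"
      using d0 x(2) by (simp_all add: div_greater_zero_iff)
    have e: "Suc (d - 1) = d" "Suc (Suc n div d - 1) = Suc n div d" using d by auto
    show "?i (?j x) = x" by (simp only: x prod.case e d(3) diff_Suc_1)
    show "g (?j x) = h x" by (simp only: x g_def h_def prod.case e)
  next
    fix x :: "nat \<times> nat"
    obtain i j where x: "x = (i, j)" by (cases x)
    have "Suc (Suc i * Suc j - 1) = Suc i * Suc j" by simp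
    hence e: "Suc (Suc i * Suc j - 1) div Suc i = Suc j" "Suc i dvd Suc (Suc i * Suc j - 1)"
      by (simp_all only: nonzero_mult_div_cancel_left dvd_triv_left Suc_neq_Zero not_False_eq_True)
    show "?j (?i x) = x" by (simp only: x prod.case e diff_Suc_1)
    show "?i x \<in> T" by (simp only: x prod.case T_def mem_Sigma_iff UNIV_I e mem_Collect_eq simp_thms)
  qed simp
  have "h summable_on T \<longleftrightarrow> g summable_on (UNIV \<times> UNIV)"
    by (rule summable_on_reindex_bij_witness[of T ?i ?j "UNIV \<times> UNIV" g h]) (fact bij)+
  hence sT: "h summable_on T" using s by (simp only:)
  have eqT: "infsum h T = infsum g (UNIV \<times> UNIV)"
    by (rule infsum_reindex_bij_witness[of T ?i ?j "UNIV \<times> UNIV" g h]) (fact bij)+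
  have fin: "finite {d. d dvd Suc n}" for n by (rule finite_divisors_nat) simp
  have 1: "(\<Sum>d | d dvd Suc n. f d (Suc n div d)) = (\<Sum>\<^sub>\<infinity>d\<in>{d. d dvd Suc n}. f d (Suc n div d))" for n
    using fin by simp
  have sT': "(\<lambda>(n, d). f d (Suc n div d)) summable_on (SIGMA n:UNIV. {d. d dvd Suc n})"
    using sT by (simp add: h_def T_def)
  have "(\<lambda>n. \<Sum>\<^sub>\<infinity>d\<in>{d. d dvd Suc n}. f d (Suc n div d)) summable_on UNIV"
    by (rule summable_on_Sigma_banach[OF sT'])
  hence "((\<lambda>n. \<Sum>\<^sub>\<infinity>d\<in>{d. d dvd Suc n}. f d (Suc n div d)) has_sum infsum h T) UNIV"
    using infsum_Sigma'_banach[OF sT'] by (simp add: has_sum_iff h_def T_def)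
  hence "(\<lambda>n. \<Sum>\<^sub>\<infinity>d\<in>{d. d dvd Suc n}. f d (Suc n div d)) sums infsum h T" by (rule has_sum_imp_sums)
  also have "infsum h T = (\<Sum>i. \<Sum>j. f (Suc i) (Suc j))"
  proof -
    have "(\<lambda>j. f (Suc i) (Suc j)) summable_on UNIV" for i
      by (intro norm_summable_imp_summable_on summable_comparison_test'[OF summable_mult[OF B, of "A i"]]) (use f in auto)
    hence "(\<Sum>j. f (Suc i) (Suc j)) = (\<Sum>\<^sub>\<infinity>j. f (Suc i) (Suc j))" for i by (rule suminf_eq_infsum)
    moreover have s': "(\<lambda>(i, j). f (Suc i) (Suc j)) summable_on (UNIV \<times> UNIV)" using s by (simp add: g_def)
    have "(\<lambda>i. \<Sum>\<^sub>\<infinity>j. f (Suc i) (Suc j)) summable_on UNIV" by (rule summable_on_Sigma_banach[OF s'])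
    ultimately show ?thesis
      using infsum_Sigma'_banach[OF s'] by (simp only: eqT g_def suminf_eq_infsum)
  qed
  finally show ?thesis by (simp only: 1)
qed

lemma divisor_sigma_mult:
  "divisor_sigma a (Suc n) * \<phi> (Suc n) = (\<Sum>d | d dvd Suc n. of_nat d powr a * \<phi> (d * (Suc n div d)))"
  unfolding divisor_sigma_def sum_distrib_right by (intro sum.cong refl) auto

text \<open>A bound by a power of the product i j factors into a majorant in i and one in j. The
  weight i^a costs Re a, so the two conditions on \<beta> are the convergence of these two
  series.\<close>

lemma divisor_sigma_sums:
  assumes \<phi>: "\<And>n. norm (\<phi> (Suc n)) \<le> C * real (Suc n) powr (- \<beta>)" and \<beta>: "\<beta> > 1" "Re a < \<beta> - 1"
  shows "(\<lambda>n. divisor_sigma a (Suc n) * \<phi> (Suc n)) sums (\<Sum>i. \<Sum>j. of_nat (Suc i) powr a * \<phi> (Suc i * Suc j))"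
    and "summable (\<lambda>i. \<Sum>j. of_nat (Suc i) powr a * \<phi> (Suc i * Suc j))"
proof -
  have "0 \<le> C * real (Suc 0) powr (- \<beta>)" using \<phi>[of 0] norm_ge_zero order_trans by blast
  hence C0: "C \<ge> 0" by simp
  define f where "f d m = of_nat d powr a * \<phi> (d * m)" for d m :: nat
  define A where "A i = C * real (Suc i) powr (Re a - \<beta>)" for i
  define B where "B j = real (Suc j) powr (- \<beta>)" for j
  have bound: "norm (f (Suc i) (Suc j)) \<le> A i * B j" for i j
  proof -
    have "norm (f (Suc i) (Suc j)) = real (Suc i) powr Re a * norm (\<phi> (Suc i * Suc j))"
      unfolding f_def norm_mult norm_of_nat_powr ..
    also have "norm (\<phi> (Suc i * Suc j)) \<le> C * real (Suc i * Suc j) powr (- \<beta>)"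
      using \<phi>[of "Suc i * Suc j - 1"] by (simp del: mult_Suc mult_Suc_right of_nat_mult)
    also have "real (Suc i * Suc j) powr (- \<beta>) = real (Suc i) powr (- \<beta>) * real (Suc j) powr (- \<beta>)"
      by (simp only: of_nat_mult powr_mult of_nat_0_le_iff)
    finally have "norm (f (Suc i) (Suc j)) \<le> real (Suc i) powr Re a * (C * (real (Suc i) powr (- \<beta>) * real (Suc j) powr (- \<beta>)))"
      by (simp only: mult_left_mono powr_ge_zero)
    also have "\<dots> = A i * B j"
      unfolding A_def B_def by (simp add: powr_diff powr_minus divide_inverse mult_ac del: of_nat_Suc)
    finally show ?thesis .
  qed
  have summ: "summable A" "summable B" unfolding A_def B_def using \<beta>
    by (intro summable_mult summable_Suc_iff[THEN iffD2]; simp add: summable_real_powr_iff)+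
  have nonneg: "A i \<ge> 0" "B i \<ge> 0" for i using C0 by (auto simp: A_def B_def)
  have "(\<lambda>n. \<Sum>d | d dvd Suc n. f d (Suc n div d)) sums (\<Sum>i. \<Sum>j. f (Suc i) (Suc j))"
    by (rule suminf_divisors[where f = f and A = A and B = B, OF bound summ nonneg])
  moreover have "(\<Sum>d | d dvd Suc n. f d (Suc n div d)) = divisor_sigma a (Suc n) * \<phi> (Suc n)" for n
    unfolding f_def by (rule divisor_sigma_mult[symmetric])
  ultimately show "(\<lambda>n. divisor_sigma a (Suc n) * \<phi> (Suc n)) sums (\<Sum>i. \<Sum>j. of_nat (Suc i) powr a * \<phi> (Suc i * Suc j))"
    by (simp only: f_def)
  have "summable (\<lambda>i. \<Sum>j. f (Suc i) (Suc j))"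
    using suminf_swap[where f = "\<lambda>i j. f (Suc i) (Suc j)" and A = A and B = B, OF bound summ nonneg] by (rule sums_summable)
  thus "summable (\<lambda>i. \<Sum>j. of_nat (Suc i) powr a * \<phi> (Suc i * Suc j))" by (simp only: f_def)
qed

text \<open>Locally sigma_a is dominated by the divisor sum with real exponent \<alpha>. The
  statement serves both the Lambert series and the kernel series.\<close>

lemma divisor_sigma_summable_holomorphic:
  assumes S: "open S" and hol: "\<And>n. \<phi> n holomorphic_on S"
    and bound: "\<And>a0. a0 \<in> S \<Longrightarrow> \<exists>r>0. \<exists>C \<beta> \<alpha>. \<beta> > 1 \<and> \<alpha> < \<beta> - 1 \<and>
      (\<forall>a\<in>ball a0 r \<inter> S. Re a \<le> \<alpha> \<and> (\<forall>n. norm (\<phi> (Suc n) a) \<le> C * real (Suc n) powr (- \<beta>)))"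
  shows "(\<lambda>a. \<Sum>n. divisor_sigma a (Suc n) * \<phi> (Suc n) a) holomorphic_on S"
    and "a \<in> S \<Longrightarrow> summable (\<lambda>n. divisor_sigma a (Suc n) * \<phi> (Suc n) a)"
proof -
  have *: "\<exists>r>0. \<exists>M N. summable M \<and>
      (\<forall>a\<in>ball a0 r \<inter> S. \<forall>n\<ge>N. norm (divisor_sigma a (Suc n) * \<phi> (Suc n) a) \<le> M n)" if a0: "a0 \<in> S" for a0
  proof -
    from bound[OF a0] obtain r C \<beta> \<alpha> where r: "r > 0" "\<beta> > 1" "\<alpha> < \<beta> - 1"
      and bd: "\<forall>a\<in>ball a0 r \<inter> S. Re a \<le> \<alpha> \<and> (\<forall>n. norm (\<phi> (Suc n) a) \<le> C * real (Suc n) powr (- \<beta>))"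
      by (elim exE conjE)
    have bd1: "Re a \<le> \<alpha>" and bd2: "norm (\<phi> (Suc n) a) \<le> C * real (Suc n) powr (- \<beta>)"
      if "a \<in> ball a0 r" "a \<in> S" for a n
      using bd[rule_format, of a] that by auto
    \<comment> \<open>The majorant is itself a divisor series, with \<phi> replaced by its bound;
      \<open>\<bar>C\<bar>\<close> appears because \<open>C\<close> is not known to be
      nonnegative.\<close>
    have "summable (\<lambda>n. divisor_sigma (of_real \<alpha>) (Suc n) * complex_of_real (C * real (Suc n) powr (- \<beta>)))"
      by (rule sums_summable, rule divisor_sigma_sums(1)[where C = "\<bar>C\<bar>" and \<beta> = \<beta>])
         (use r in \<open>simp_all add: norm_mult del: of_nat_Suc\<close>)
    moreover have "divisor_sigma (of_real \<alpha>) (Suc n) = complex_of_real (\<Sum>d | d dvd Suc n. real d powr \<alpha>)" for n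
    proof -
      have "of_nat d powr of_real \<alpha> = complex_of_real (real d powr \<alpha>)" for d
        using powr_of_real[of "real d" \<alpha>] by simp
      thus ?thesis by (simp only: divisor_sigma_def of_real_sum)
    qed
    ultimately have M: "summable (\<lambda>n. (\<Sum>d | d dvd Suc n. real d powr \<alpha>) * (C * real (Suc n) powr (- \<beta>)))"
      by (simp only: of_real_mult[symmetric] summable_of_real_iff)
    have "norm (divisor_sigma a (Suc n) * \<phi> (Suc n) a) \<le> (\<Sum>d | d dvd Suc n. real d powr \<alpha>) * (C * real (Suc n) powr (- \<beta>))"
      if a: "a \<in> ball a0 r" "a \<in> S" for a n
      unfolding norm_mult
    proof (rule mult_mono)
      show "norm (divisor_sigma a (Suc n)) \<le> (\<Sum>d | d dvd Suc n. real d powr \<alpha>)"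
        unfolding divisor_sigma_def
      proof (rule order_trans[OF norm_sum], rule sum_mono)
        fix d assume "d \<in> {d. d dvd Suc n}"
        hence "d > 0" by (cases d) auto
        thus "norm (complex_of_nat d powr a) \<le> real d powr \<alpha>"
          using bd1[OF a] norm_powr_real_powr[of "of_nat d" a] by (simp add: powr_mono)
      qed
    qed (use bd2[OF a] in \<open>auto intro!: sum_nonneg\<close>)
    thus ?thesis using r(1) M
      by (intro exI[of _ r] conjI exI[of _ "\<lambda>n. (\<Sum>d | d dvd Suc n. real d powr \<alpha>) * (C * real (Suc n) powr (- \<beta>))"] exI[of _ 0]) auto
  qed
  show "(\<lambda>a. \<Sum>n. divisor_sigma a (Suc n) * \<phi> (Suc n) a) holomorphic_on S"
  proof (rule holomorphic_on_suminf[OF S _ *])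
    show "(\<lambda>a. divisor_sigma a (Suc n) * \<phi> (Suc n) a) holomorphic_on S" for n
      unfolding divisor_sigma_def by (auto intro!: holomorphic_intros hol)
  qed
  show "summable (\<lambda>n. divisor_sigma a (Suc n) * \<phi> (Suc n) a)" if "a \<in> S"
  proof -
    from *[OF that] obtain r M N where r: "r > 0" "summable M"
      and bd: "\<forall>b\<in>ball a r \<inter> S. \<forall>n\<ge>N. norm (divisor_sigma b (Suc n) * \<phi> (Suc n) b) \<le> M n"
      by (elim exE conjE)
    show ?thesis
      by (rule summable_comparison_test'[OF r(2)]) (use bd[rule_format, of a] r(1) that in auto)
  qed
qed

text \<open>A single term (\<rho> x)^k / k! of the exponential series, with k >= \<beta>, already
  beats the power.\<close>

lemma exp_le_powr:
  fixes \<rho> \<beta> :: real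
  assumes "\<rho> > 0"
  obtains C where "\<And>n. exp (- (\<rho> * real (Suc n))) \<le> C * real (Suc n) powr (- \<beta>)"
proof -
  obtain k :: nat where k: "real k \<ge> \<beta>" using real_arch_simple by blast
  have "exp (- (\<rho> * real (Suc n))) \<le> (fact k / \<rho> ^ k) * real (Suc n) powr (- \<beta>)" for n
  proof -
    define x where "x = real (Suc n)"
    have x: "x \<ge> 1" by (simp add: x_def)
    have "(\<rho> * x) ^ k / fact k \<le> exp (\<rho> * x)"
    proof -
      have "(\<Sum>n\<in>{k}. inverse (fact n) * (\<rho> * x) ^ n) \<le> (\<Sum>n. inverse (fact n) * (\<rho> * x) ^ n)"
        using assms x by (intro sum_le_suminf[OF summable_exp]) auto
      thus ?thesis by (simp add: exp_def divide_inverse mult.commute)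
    qed
    hence "\<rho> ^ k * x ^ k \<le> fact k * exp (\<rho> * x)" by (simp add: power_mult_distrib field_simps)
    hence "exp (- (\<rho> * x)) \<le> fact k / \<rho> ^ k * (1 / x ^ k)"
      using assms x by (simp add: exp_minus field_simps)
    also have "1 / x ^ k = x powr (- real k)" using x by (simp add: powr_minus_divide powr_realpow)
    also have "fact k / \<rho> ^ k * x powr (- real k) \<le> fact k / \<rho> ^ k * x powr (- \<beta>)"
      using assms x k by (intro mult_left_mono powr_mono) auto
    finally show ?thesis by (simp only: x_def)
  qed
  thus thesis by (rule that)
qed

section \<open>Comparing lattice sums with integrals\<close>

lemma integrable_powr_over_sum_squares:
  fixes b c :: complex
  assumes c: "Re c > 0" and b: "-1 < Re b" "Re b < 1"
  shows "integrable pos_lborel (\<lambda>u. of_real u powr b / (of_real u ^ 2 + c ^ 2))"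
proof -
  have "Im (- \<i> * c) \<noteq> 0" using c by simp
  from integrable_powr_over_diff_squares[OF this b] show ?thesis by (simp add: power_mult_distrib)
qed

lemma sum_squares_neq_0: "Re c > 0 \<Longrightarrow> u > 0 \<Longrightarrow> of_real u ^ 2 + c ^ 2 \<noteq> 0" for c :: complex
  using diff_squares_neq_0[of "\<i> * c" u] by (simp add: power_mult_distrib)

lemma sin_half_neq_0: "-2 < Re a \<Longrightarrow> Re a < 0 \<Longrightarrow> sin (of_real pi * a / 2) \<noteq> (0::complex)"
  using sin_pi_neq_0[of "a / 2"] by simp

text \<open>For Re a > -1 the previous evaluation applies at W = - i c. The integral converges down
  to Re a > -2, and continuation carries the formula to this wider strip, which contains both sides
  of Re a = -1.\<close>

lemma integral_powr_over_sum_squares: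
  fixes a c :: complex
  assumes c: "Re c > 0" and a: "-2 < Re a" "Re a < 0"
  shows "(\<integral>u. of_real u powr (a + 1) / (of_real u ^ 2 + c ^ 2) \<partial>pos_lborel) = - of_real pi * c powr a / (2 * sin (of_real pi * a / 2))"
proof (rule analytic_continuation_open[where s = "{a. Re a > -1} \<inter> {a. Re a < 0}" and s' = "{a. Re a > -2} \<inter> {a. Re a < 0}" and z = a])
  have c0: "c \<noteq> 0" using c by auto
  have "-1/2 \<in> {a::complex. Re a > -1} \<inter> {a. Re a < 0}" by simp
  thus "{a::complex. Re a > -1} \<inter> {a. Re a < 0} \<noteq> {}" by blast
  show "connected ({a. Re a > -2} \<inter> {a. Re a < 0})"
    by (intro convex_connected convex_Int convex_halfspace_Re_gt convex_halfspace_Re_lt)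
  show "(\<lambda>a. - of_real pi * c powr a / (2 * sin (of_real pi * a / 2))) holomorphic_on {a. Re a > -2} \<inter> {a. Re a < 0}"
    using c0 by (intro holomorphic_intros) (auto simp: sin_half_neq_0)
  show "(\<lambda>a. \<integral>u. of_real u powr (a + 1) / (of_real u ^ 2 + c ^ 2) \<partial>pos_lborel) holomorphic_on {a. Re a > -2} \<inter> {a. Re a < 0}"
  proof (rule holomorphic_on_integral_dominated)
    show "(\<lambda>a. of_real u powr (a + 1) / (of_real u ^ 2 + c ^ 2)) holomorphic_on {a. Re a > -2} \<inter> {a. Re a < 0}"
      if "u \<in> space pos_lborel" for u
      using that sum_squares_neq_0[OF c, of u] by (intro holomorphic_intros) auto
    show "(\<lambda>u. of_real u powr (a + 1) / (of_real u ^ 2 + c ^ 2)) \<in> borel_measurable pos_lborel" for a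
      using sum_squares_neq_0[OF c] by (intro borel_measurable_pos_lborel continuous_intros) auto
    fix a0 assume "a0 \<in> {a. Re a > -2} \<inter> {a. Re a < 0}"
    hence a0: "Re a0 > -2" "Re a0 < 0" by auto
    define r where "r = min (Re a0 + 2) (- Re a0) / 2"
    have r: "r > 0" "Re a0 - r > -2" "Re a0 + r < 0" using a0 by (auto simp: r_def min_def field_simps)
    define h where "h u = norm (complex_of_real u powr of_real (Re a0 - r + 1) / (of_real u ^ 2 + c ^ 2)) +
       norm (complex_of_real u powr of_real (Re a0 + r + 1) / (of_real u ^ 2 + c ^ 2))" for u
    have h: "integrable pos_lborel h" unfolding h_def using r
      by (intro Bochner_Integration.integrable_add integrable_norm integrable_powr_over_sum_squares c) auto
    have "norm (of_real u powr (a + 1) / (of_real u ^ 2 + c ^ 2)) \<le> h u" if "a \<in> ball a0 r" and u: "u > 0" for a u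
    proof -
      have "Re a0 - r \<le> Re a" "Re a \<le> Re a0 + r"
        using that abs_Re_le_cmod[of "a0 - a"] by (auto simp: dist_norm abs_le_iff)
      hence "u powr (Re a + 1) \<le> u powr (Re a0 - r + 1) + u powr (Re a0 + r + 1)"
        using u by (intro powr_le_sum_powr) auto
      hence "u powr (Re a + 1) / norm (of_real u ^ 2 + c ^ 2) \<le> (u powr (Re a0 - r + 1) + u powr (Re a0 + r + 1)) / norm (of_real u ^ 2 + c ^ 2)"
        by (intro divide_right_mono) auto
      thus ?thesis using u by (simp add: h_def norm_divide norm_powr_real_powr add_divide_distrib)
    qed
    thus "\<exists>r>0. \<exists>h. integrable pos_lborel h \<and> (\<forall>a\<in>ball a0 r \<inter> ({a. Re a > -2} \<inter> {a. Re a < 0}). \<forall>u\<in>space pos_lborel.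
        norm (of_real u powr (a + 1) / (of_real u ^ 2 + c ^ 2)) \<le> h u)"
      using r(1) h by (intro exI[of _ r] conjI exI[of _ h]) auto
  qed (auto intro!: open_Int open_halfspace_Re_gt open_halfspace_Re_lt)
next
  fix a assume "a \<in> {a. Re a > -1} \<inter> {a. Re a < 0}"
  hence a: "-1 < Re a" "Re a < 0" by auto
  define h where "h = of_real pi * a / 2"
  have c0: "c \<noteq> 0" using c by auto
  have W: "Im (- \<i> * c) < 0" using c by simp
  have "Ln (- \<i> * c) = Ln c - \<i> * of_real pi / 2"
    using c0 Re_Ln_pos_lt_imp[OF c] by (subst Ln_times_simple) (auto simp: Ln_minus_ii)
  hence "(- \<i> * c) powr a = exp (a * (Ln c - \<i> * of_real pi / 2))" using c0 by (simp add: powr_def)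
  also have "a * (Ln c - \<i> * of_real pi / 2) = a * Ln c + - (\<i> * h)" by (simp add: h_def field_simps)
  finally have P: "(- \<i> * c) powr a = c powr a * exp (- (\<i> * h))" using c0 by (simp only: exp_add powr_def if_False)
  have pa: "of_real pi * a = 2 * h" "\<i> * of_real pi * a = 2 * (\<i> * h)" by (simp_all add: h_def)
  have sc: "sin (2 * h) \<noteq> 0" using sin_pi_neq_0[OF a] by (simp add: pa)
  hence sc0: "sin h \<noteq> 0" "cos h \<noteq> 0" by (auto simp: sin_double)
  \<comment> \<open>The branch factor of - i c combines with E + 1 to 2 cos h, which halves the
    angle of the sine in the denominator.\<close>
  have e: "exp (- (\<i> * h)) * (exp (2 * (\<i> * h)) + 1) = 2 * cos h"
    unfolding exp_double cos_exp_eq exp_minus by (simp add: field_simps power2_eq_square)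
  have "(\<integral>u. of_real u powr (a + 1) / (of_real u ^ 2 + c ^ 2) \<partial>pos_lborel) =
      - of_real pi / (2 * sin (2 * h)) * c powr a * (exp (- (\<i> * h)) * (exp (2 * (\<i> * h)) + 1))"
    using integral_powr_over_diff_squares(2)[OF W a] unfolding P pa by (simp add: power_mult_distrib mult_ac)
  thus "(\<integral>u. of_real u powr (a + 1) / (of_real u ^ 2 + c ^ 2) \<partial>pos_lborel) = - of_real pi * c powr a / (2 * sin (of_real pi * a / 2))"
    unfolding e sin_double h_def[symmetric] using sc0 by (simp add: field_simps)
qed (use a in \<open>auto intro!: open_Int open_halfspace_Re_gt open_halfspace_Re_lt\<close>)

lemma integral_indicator_pos_lborel:
  assumes "0 \<le> a" "a \<le> b"
  shows "integrable pos_lborel (indicator {a<..b} :: real \<Rightarrow> real)" "(\<integral>u. indicat_real {a<..b} u \<partial>pos_lborel) = b - a"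
proof -
  have eq: "indicat_real {0<..} u *\<^sub>R indicator {a<..b} u = indicat_real {a<..b} u" for u
    using assms by (auto simp: indicator_def)
  show "integrable pos_lborel (indicator {a<..b} :: real \<Rightarrow> real)"
    using assms by (subst integrable_restrict_space) (simp_all add: eq integrable_indicator_iff del: real_scaleR_def)
  show "(\<integral>u. indicat_real {a<..b} u \<partial>pos_lborel) = b - a"
    using assms by (subst integral_restrict_space) (simp_all add: eq del: real_scaleR_def)
qed

text \<open>Each value f (d + 1) is compared with the mean of \<open>f\<close> over the cell (d, d +
  1]. The half-open cells partition the positive half-line, so their integrals add up to the full
  one.\<close>

lemma sum_minus_integral:
  fixes f :: "real \<Rightarrow> complex"
  assumes int: "integrable pos_lborel f" and summ: "summable (\<lambda>d. f (real (Suc d)))"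
  shows "(\<lambda>d. \<integral>u. indicator {real d<..real (Suc d)} u *\<^sub>R (f (real (Suc d)) - f u) \<partial>pos_lborel)
    sums ((\<Sum>d. f (real (Suc d))) - (\<integral>u. f u \<partial>pos_lborel))"
proof -
  define A where "A d = {real d<..real (Suc d)}" for d
  have indA: "integrable pos_lborel (indicator (A d) :: real \<Rightarrow> real)" "(\<integral>u. indicat_real (A d) u \<partial>pos_lborel) = 1" for d
    unfolding A_def using integral_indicator_pos_lborel[of "real d" "real (Suc d)"]
    by (simp_all del: Bochner_Integration.integral_indicator)
  have intA: "integrable pos_lborel (\<lambda>u. indicator (A d) u *\<^sub>R f u)" for d
  proof (rule Bochner_Integration.integrable_bound[OF int])
    have "A d \<in> sets borel" by (simp add: A_def)
    thus "(\<lambda>u. indicator (A d) u *\<^sub>R f u) \<in> borel_measurable pos_lborel"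
      using borel_measurable_integrable[OF int] by (intro borel_measurable_scaleR borel_measurable_indicator_pos_lborel)
  qed (auto simp: indicator_def)
  have single: "(\<lambda>d. indicator (A d) u *\<^sub>R g) sums g" if "u > 0" for u and g :: "'b :: real_normed_vector"
  proof -
    \<comment> \<open>The cell of \<open>u\<close> has index one below the ceiling, since cells
      contain their right end point.\<close>
    define d0 where "d0 = nat (\<lceil>u\<rceil> - 1)"
    have "\<lceil>u\<rceil> \<ge> 1" using that by simp
    hence "real d0 = of_int \<lceil>u\<rceil> - 1" by (simp add: d0_def)
    hence d0: "real d0 < u" "u \<le> real d0 + 1" using ceiling_correct[of u] by linarith+
    have uniq: "d = d0" if "u \<in> A d" for d
    proof -
      have "real d < real d0 + 1" "real d0 < real d + 1" using that d0 by (auto simp: A_def)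
      thus ?thesis by linarith
    qed
    have mem: "u \<in> A d0" using d0 by (auto simp: A_def)
    have "indicator (A d) u *\<^sub>R g = (if d = d0 then g else 0)" for d
    proof (cases "u \<in> A d")
      case True
      with uniq[OF True] show ?thesis by simp
    next
      case False
      with mem have "d \<noteq> d0" by metis
      with False show ?thesis by simp
    qed
    thus ?thesis using sums_single[of d0 "\<lambda>_. g"] by simp
  qed
  have ae: "AE u in pos_lborel. summable (\<lambda>d. norm (indicator (A d) u *\<^sub>R f u))"
  proof (intro AE_I2)
    fix u assume "u \<in> space pos_lborel"
    hence "(\<lambda>d. indicator (A d) u *\<^sub>R norm (f u)) sums norm (f u)" by (intro single) auto
    thus "summable (\<lambda>d. norm (indicator (A d) u *\<^sub>R f u))" by (simp add: sums_iff)
  qed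
  have si: "summable (\<lambda>d. \<integral>u. norm (indicator (A d) u *\<^sub>R f u) \<partial>pos_lborel)"
  proof (rule summableI_nonneg_bounded)
    fix N
    have "(\<Sum>d<N. \<integral>u. norm (indicator (A d) u *\<^sub>R f u) \<partial>pos_lborel) = (\<integral>u. (\<Sum>d<N. norm (indicator (A d) u *\<^sub>R f u)) \<partial>pos_lborel)"
      by (intro Bochner_Integration.integral_sum[symmetric] integrable_norm intA)
    also have "\<dots> \<le> (\<integral>u. norm (f u) \<partial>pos_lborel)"
    proof (intro integral_mono Bochner_Integration.integrable_sum integrable_norm intA int)
      fix u assume "u \<in> space pos_lborel"
      hence "(\<lambda>d. indicator (A d) u *\<^sub>R norm (f u)) sums norm (f u)" by (intro single) auto
      moreover from this have "(\<Sum>d<N. indicator (A d) u *\<^sub>R norm (f u)) \<le> (\<Sum>d. indicator (A d) u *\<^sub>R norm (f u))"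
        by (intro sum_le_suminf) (auto simp: sums_iff)
      ultimately show "(\<Sum>d<N. norm (indicator (A d) u *\<^sub>R f u)) \<le> norm (f u)" by (simp add: sums_iff)
    qed
    finally show "(\<Sum>d<N. \<integral>u. norm (indicator (A d) u *\<^sub>R f u) \<partial>pos_lborel) \<le> (\<integral>u. norm (f u) \<partial>pos_lborel)" .
  qed (simp add: integral_nonneg_AE)
  have "(\<integral>u. (\<Sum>d. indicator (A d) u *\<^sub>R f u) \<partial>pos_lborel) = (\<integral>u. f u \<partial>pos_lborel)"
  proof (intro Bochner_Integration.integral_cong refl)
    fix u assume "u \<in> space pos_lborel"
    hence "(\<lambda>d. indicator (A d) u *\<^sub>R f u) sums f u" by (intro single) auto
    thus "(\<Sum>d. indicator (A d) u *\<^sub>R f u) = f u" by (simp add: sums_iff)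
  qed
  hence I: "(\<lambda>d. \<integral>u. indicator (A d) u *\<^sub>R f u \<partial>pos_lborel) sums (\<integral>u. f u \<partial>pos_lborel)"
    using sums_integral[OF intA ae si] by simp
  have "(\<integral>u. indicator (A d) u *\<^sub>R (f (real (Suc d)) - f u) \<partial>pos_lborel) =
      f (real (Suc d)) - (\<integral>u. indicator (A d) u *\<^sub>R f u \<partial>pos_lborel)" for d
  proof -
    have "(\<integral>u. indicator (A d) u *\<^sub>R f (real (Suc d)) \<partial>pos_lborel) = (\<integral>u. indicator (A d) u \<partial>pos_lborel) *\<^sub>R f (real (Suc d))"
      using indA(1) by (intro integral_scaleR_left) auto
    moreover have "integrable pos_lborel (\<lambda>u. indicator (A d) u *\<^sub>R f (real (Suc d)))"
      using indA(1)[of d] by (intro integrable_scaleR_left) auto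
    ultimately show ?thesis using intA[of d]
      by (simp only: scaleR_diff_right Bochner_Integration.integral_diff indA(2)) simp
  qed
  thus ?thesis unfolding A_def[symmetric] using sums_diff[OF summable_sums[OF summ] I] by simp
qed

text \<open>Sum and integral are compared cell by cell: crudely on (0, 1], by the derivative
  elsewhere. The point is a decay in \<open>m\<close> better than 1 / m, uniform in
  \<open>a\<close>; the sum and the integral taken separately need not decay that fast.\<close>

lemma sum_minus_integral_bound:
  fixes w :: complex and \<alpha>1 \<alpha>2 \<eta> R :: real
  assumes w: "Re w > 0" and \<alpha>: "-2 < \<alpha>1" "\<alpha>2 + \<eta> < 0" and \<eta>: "0 \<le> \<eta>" "\<eta> \<le> 1"
  obtains C where "\<And>a m. \<alpha>1 \<le> Re a \<Longrightarrow> Re a \<le> \<alpha>2 \<Longrightarrow> norm a \<le> R \<Longrightarrow> m \<ge> 1 \<Longrightarrow>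
    norm ((\<Sum>d. of_nat (Suc d) powr (a + 1) / (of_nat (Suc d) ^ 2 + (of_real m * w) ^ 2)) -
      (\<integral>u. of_real u powr (a + 1) / (of_real u ^ 2 + (of_real m * w) ^ 2) \<partial>pos_lborel)) \<le> C * m powr (- 1 - \<eta>)"
proof -
  obtain \<kappa> where \<kappa>: "\<kappa> > 0" "\<And>u m. u \<ge> 0 \<Longrightarrow> m > 0 \<Longrightarrow> norm (of_real u ^ 2 + (of_real m * w) ^ 2) \<ge> \<kappa> * (u + m) ^ 2"
    using w by (rule norm_sum_squares_ge) blast
  \<comment> \<open>One summand for each term of the derivative of u^(a + 1) / (u^2 + c^2): |a + 1|
    <= |R| + 1 over one denominator, and the factor 2 over its square.\<close>
  define K where "K = (\<bar>R\<bar> + 1) / \<kappa> + 2 / \<kappa> ^ 2"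
  have K: "K \<ge> 0" using \<kappa>(1) by (simp add: K_def)
  define S where "S = (\<Sum>d. real (Suc d) powr (\<alpha>2 - 1 + \<eta>))"
  have summS: "summable (\<lambda>d. real (Suc d) powr (\<alpha>2 - 1 + \<eta>))"
    using \<alpha> by (subst summable_Suc_iff) (simp add: summable_real_powr_iff)
  \<comment> \<open>The 1 stems from f at 1 and 1 / (\<alpha>1 + 2) from the integral of
    u^(\<alpha>1 + 1) over (0, 1]; the last summand collects all other cells.\<close>
  define C where "C = (1 + 1 / (\<alpha>1 + 2)) / \<kappa> + K * S"
  show thesis
  proof (rule that[of C])
    fix a m assume a: "\<alpha>1 \<le> Re a" "Re a \<le> \<alpha>2" "norm a \<le> R" and m: "m \<ge> (1::real)"
    define c where "c = of_real m * w"
    have c: "Re c > 0" using w m by (simp add: c_def)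
    define f where "f u = complex_of_real u powr (a + 1) / (of_real u ^ 2 + c ^ 2)" for u
    define M where "M = m powr (- 1 - \<eta>)"
    have m2: "1 / m ^ 2 \<le> M"
    proof -
      have "1 / m ^ 2 = m powr (- 2)" using m by (simp add: powr_minus_divide)
      also have "\<dots> \<le> M" unfolding M_def using m \<eta> by (intro powr_mono) auto
      finally show ?thesis .
    qed
    have lower: "norm (of_real u ^ 2 + c ^ 2) \<ge> \<kappa> * (u + m) ^ 2" if "u > 0" for u
      unfolding c_def using that m by (intro \<kappa>(2)) auto
    have lower_m: "norm (of_real u ^ 2 + c ^ 2) \<ge> \<kappa> * m ^ 2" if "u > 0" for u
    proof -
      have "\<kappa> * m ^ 2 \<le> \<kappa> * (u + m) ^ 2" using that m \<kappa>(1) by (intro mult_left_mono power_mono) auto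
      thus ?thesis using lower[OF that] by linarith
    qed
    have int: "integrable pos_lborel f"
      unfolding f_def using a \<alpha> \<eta> by (intro integrable_powr_over_sum_squares c) auto
    have summ: "summable (\<lambda>d. f (real (Suc d)))"
      using summable_norm_cancel[OF summable_powr_over_sum_squares[OF c, of a]] a \<alpha> \<eta> by (simp add: f_def del: of_nat_Suc)
    define T where "T d = (\<integral>u. indicator {real d<..real (Suc d)} u *\<^sub>R (f (real (Suc d)) - f u) \<partial>pos_lborel)" for d
    have T: "T sums ((\<Sum>d. f (real (Suc d))) - (\<integral>u. f u \<partial>pos_lborel))"
      unfolding T_def by (rule sum_minus_integral[OF int summ])
    \<comment> \<open>Near 0 the power u^(a + 1) is unbounded when Re a < -1, so the first cell is
      estimated without derivative; the denominator alone contributes m^(-2).\<close>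
    have T0: "norm (T 0) \<le> (1 + 1 / (\<alpha>1 + 2)) / \<kappa> * M"
    proof -
      have fb: "norm (f u) \<le> u powr (\<alpha>1 + 1) / (\<kappa> * m ^ 2)" if "0 < u" "u \<le> 1" for u
      proof -
        have "norm (f u) = u powr (Re a + 1) / norm (of_real u ^ 2 + c ^ 2)"
          using that by (simp add: f_def norm_divide norm_powr_real_powr)
        also have "\<dots> \<le> u powr (\<alpha>1 + 1) / (\<kappa> * m ^ 2)"
          using that a m \<kappa>(1) lower_m[of u] by (intro frac_le powr_mono') auto
        finally show ?thesis .
      qed
      have "norm (T 0) \<le> (\<integral>u. norm (indicator {real 0<..real (Suc 0)} u *\<^sub>R (f (real (Suc 0)) - f u)) \<partial>pos_lborel)"
        unfolding T_def by (rule integral_norm_bound)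
      also have "\<dots> \<le> (\<integral>u. (indicator {0<..1} u + indicator {..1} u * u powr (\<alpha>1 + 2 - 1)) / (\<kappa> * m ^ 2) \<partial>pos_lborel)"
      proof (rule integral_mono')
        show "integrable pos_lborel (\<lambda>u. (indicator {0<..1} u + indicator {..1} u * u powr (\<alpha>1 + 2 - 1)) / (\<kappa> * m ^ 2))"
          using \<alpha> by (intro Bochner_Integration.integrable_divide Bochner_Integration.integrable_add
             integral_indicator_pos_lborel(1) integral_powr_unit_real(1)) auto
        fix u assume "u \<in> space pos_lborel"
        hence u: "u > 0" by simp
        show "norm (indicator {real 0<..real (Suc 0)} u *\<^sub>R (f (real (Suc 0)) - f u)) \<le>
            (indicator {0<..1} u + indicator {..1} u * u powr (\<alpha>1 + 2 - 1)) / (\<kappa> * m ^ 2)"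
        proof (cases "u \<le> 1")
          case True
          have "norm (f 1 - f u) \<le> norm (f 1) + norm (f u)" by (rule norm_triangle_ineq4)
          also have "\<dots> \<le> 1 / (\<kappa> * m ^ 2) + u powr (\<alpha>1 + 1) / (\<kappa> * m ^ 2)"
            using fb[of 1] fb[of u] u True by (intro add_mono) auto
          finally show ?thesis using u True by (simp add: add_divide_distrib add.commute)
        qed (use \<kappa>(1) m in auto)
      qed (use \<kappa>(1) m in auto)
      also have "\<dots> = (1 + 1 / (\<alpha>1 + 2)) / (\<kappa> * m ^ 2)"
      proof -
        have "(\<integral>u. indicator {0<..1} u + indicator {..1} u * u powr (\<alpha>1 + 2 - 1) \<partial>pos_lborel) = 1 + 1 / (\<alpha>1 + 2)"
          using \<alpha> integral_indicator_pos_lborel[of 0 1] integral_powr_unit_real[of "\<alpha>1 + 2"]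
          by (subst Bochner_Integration.integral_add) auto
        thus ?thesis by (simp only: integral_divide_zero)
      qed
      also have "\<dots> = (1 + 1 / (\<alpha>1 + 2)) / \<kappa> * (1 / m ^ 2)" by simp
      also have "\<dots> \<le> (1 + 1 / (\<alpha>1 + 2)) / \<kappa> * M"
        using \<kappa>(1) \<alpha> by (intro mult_left_mono m2) auto
      finally show ?thesis .
    qed
    have TS: "norm (T (Suc d)) \<le> K * M * real (Suc d) powr (\<alpha>2 - 1 + \<eta>)" for d
    proof -
      define D where "D = real (Suc d)"
      have D: "D \<ge> 1" "real (Suc (Suc d)) = D + 1" by (auto simp: D_def)
      define B where "B = K * M * D powr (\<alpha>2 - 1 + \<eta>)"
      have B: "B \<ge> 0" using K by (simp add: B_def M_def)
      define g where "g z = z powr (a + 1) / (z ^ 2 + c ^ 2)" for z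
      define g' where "g' z = (a + 1) * z powr a / (z ^ 2 + c ^ 2) - 2 * z * z powr (a + 1) / (z ^ 2 + c ^ 2) ^ 2" for z
      have fg: "f u = g (of_real u)" for u by (simp add: f_def g_def)
      have lip: "norm (f (D + 1) - f u) \<le> B" if u: "u \<in> {D<..D + 1}" for u
      proof -
        have "norm (g (of_real (D + 1)) - g (of_real u)) \<le> B * norm (complex_of_real (D + 1) - of_real u)"
        proof (rule field_differentiable_bound[where S = "closed_segment (of_real D) (complex_of_real (D + 1))" and f' = g'])
          have mem: "complex_of_real v \<in> closed_segment (of_real D) (complex_of_real (D + 1)) \<longleftrightarrow> v \<in> {D..D + 1}" for v
            unfolding closed_segment_of_real by (auto simp: closed_segment_eq_real_ivl)
          show "complex_of_real (D + 1) \<in> closed_segment (of_real D) (complex_of_real (D + 1))" by simp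
          show "complex_of_real u \<in> closed_segment (of_real D) (complex_of_real (D + 1))" using u unfolding mem by auto
          fix z assume "z \<in> closed_segment (of_real D) (complex_of_real (D + 1))"
          then obtain v where v: "z = of_real v" "D \<le> v" "v \<le> D + 1"
            unfolding closed_segment_of_real by (auto simp: closed_segment_eq_real_ivl)
          have v0: "v > 0" using v D by simp
          have nz: "z ^ 2 + c ^ 2 \<noteq> 0" unfolding v(1) by (rule sum_squares_neq_0[OF c v0])
          have zn: "z \<notin> \<real>\<^sub>\<le>\<^sub>0" using v0 by (simp add: v(1))
          have "(g has_field_derivative ((a + 1) * z powr (a + 1 - 1)) * inverse (z ^ 2 + c ^ 2) + (- (2 * z) * inverse ((z ^ 2 + c ^ 2) ^ 2)) * z powr (a + 1)) (at z)"
            unfolding g_def[abs_def] divide_inverse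
            by (rule DERIV_mult has_field_derivative_powr[OF zn])+
               (use nz in \<open>auto intro!: derivative_eq_intros simp: power2_eq_square field_simps\<close>)
          also have "((a + 1) * z powr (a + 1 - 1)) * inverse (z ^ 2 + c ^ 2) + (- (2 * z) * inverse ((z ^ 2 + c ^ 2) ^ 2)) * z powr (a + 1) = g' z"
            by (simp add: g'_def divide_inverse mult_ac)
          finally show "(g has_field_derivative g' z) (at z within closed_segment (of_real D) (complex_of_real (D + 1)))"
            by (rule has_field_derivative_at_within)
          define Q where "Q = (v + m) ^ 2"
          have Q: "Q > 0" "v ^ 2 \<le> Q" using v0 m by (auto simp: Q_def intro!: power_mono)
          have nQ: "\<kappa> * Q \<le> norm (z ^ 2 + c ^ 2)" unfolding Q_def v(1) by (rule lower[OF v0])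
          have \<kappa>Q: "\<kappa> * Q > 0" using \<kappa>(1) Q by simp
          have "norm (g' z) \<le> norm ((a + 1) * z powr a / (z ^ 2 + c ^ 2)) + norm (2 * z * z powr (a + 1) / (z ^ 2 + c ^ 2) ^ 2)"
            unfolding g'_def by (rule norm_triangle_ineq4)
          also have "norm ((a + 1) * z powr a / (z ^ 2 + c ^ 2)) \<le> (\<bar>R\<bar> + 1) * v powr Re a / (\<kappa> * Q)"
          proof -
            have "norm (a + 1) \<le> \<bar>R\<bar> + 1" using a(3) norm_triangle_ineq[of a 1] by simp
            hence "norm (a + 1) * v powr Re a / norm (z ^ 2 + c ^ 2) \<le> (\<bar>R\<bar> + 1) * v powr Re a / (\<kappa> * Q)"
              using \<kappa>Q nQ by (intro frac_le mult_right_mono) auto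
            thus ?thesis using v0 by (simp add: v(1) norm_mult norm_divide norm_powr_real_powr)
          qed
          also have "norm (2 * z * z powr (a + 1) / (z ^ 2 + c ^ 2) ^ 2) \<le> 2 * (v powr Re a * Q) / (\<kappa> * Q) ^ 2"
          proof -
            have "v * v powr (Re a + 1) = v powr Re a * v ^ 2"
              using v0 by (simp add: powr_add power2_eq_square)
            also have "\<dots> \<le> v powr Re a * Q" using Q by (intro mult_left_mono) auto
            finally have "2 * (v * v powr (Re a + 1)) / norm (z ^ 2 + c ^ 2) ^ 2 \<le> 2 * (v powr Re a * Q) / (\<kappa> * Q) ^ 2"
              using \<kappa>Q nQ Q by (intro frac_le mult_left_mono power_mono) auto
            thus ?thesis using v0 by (simp add: v(1) norm_mult norm_divide norm_power norm_powr_real_powr)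
          qed
          also have "(\<bar>R\<bar> + 1) * v powr Re a / (\<kappa> * Q) + 2 * (v powr Re a * Q) / (\<kappa> * Q) ^ 2 = K * (v powr Re a / Q)"
            unfolding K_def using \<kappa>(1) Q by (simp add: field_simps power2_eq_square)
          \<comment> \<open>The quadratic decay is shared: \<open>m\<close> keeps the exponent -1 -
            \<eta>, while \<open>v\<close> is left with Re a - 1 + \<eta>, which is below -1 because
            \<alpha>2 + \<eta> < 0.\<close>
          also have "\<dots> \<le> K * (v powr Re a / (v powr (1 - \<eta>) * m powr (1 + \<eta>)))"
            unfolding Q_def using v0 m \<eta> K by (intro mult_left_mono divide_left_mono add_powr_two_ge mult_pos_pos) auto
          also have "v powr Re a / (v powr (1 - \<eta>) * m powr (1 + \<eta>)) = v powr (Re a - 1 + \<eta>) * M"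
          proof -
            have "Re a - 1 + \<eta> = Re a - (1 - \<eta>)" by simp
            hence "v powr (Re a - 1 + \<eta>) = v powr Re a / v powr (1 - \<eta>)" by (simp only: powr_diff)
            moreover have "M = 1 / m powr (1 + \<eta>)" unfolding M_def using powr_minus_divide[of m "1 + \<eta>"] by simp
            ultimately show ?thesis by simp
          qed
          also have "K * (v powr (Re a - 1 + \<eta>) * M) \<le> K * (D powr (\<alpha>2 - 1 + \<eta>) * M)"
          proof -
            have "v powr (Re a - 1 + \<eta>) \<le> D powr (Re a - 1 + \<eta>)"
              using v D a \<alpha> by (intro powr_mono2') auto
            also have "\<dots> \<le> D powr (\<alpha>2 - 1 + \<eta>)" using D a by (intro powr_mono) auto
            finally show ?thesis using K by (intro mult_left_mono mult_right_mono) (auto simp: M_def)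
          qed
          also have "\<dots> = B" by (simp add: B_def)
          finally show "norm (g' z) \<le> B" by simp
        qed simp
        also have "norm (complex_of_real (D + 1) - of_real u) = \<bar>D + 1 - u\<bar>" unfolding of_real_diff[symmetric] by (rule norm_of_real)
        also have "B * \<bar>D + 1 - u\<bar> \<le> B * 1" using u B by (intro mult_left_mono) auto
        finally show ?thesis by (simp add: fg)
      qed
      have "norm (T (Suc d)) \<le> (\<integral>u. norm (indicator {D<..D + 1} u *\<^sub>R (f (D + 1) - f u)) \<partial>pos_lborel)"
        unfolding T_def D(2) D_def[symmetric] by (rule integral_norm_bound)
      also have "\<dots> \<le> (\<integral>u. B * indicator {D<..D + 1} u \<partial>pos_lborel)"
      proof (rule integral_mono')
        show "integrable pos_lborel (\<lambda>u. B * indicator {D<..D + 1} u)"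
          using D by (intro Bochner_Integration.integrable_mult_right integral_indicator_pos_lborel(1)) auto
        show "norm (indicator {D<..D + 1} u *\<^sub>R (f (D + 1) - f u)) \<le> B * indicator {D<..D + 1} u" for u
          using lip[of u] by (auto simp: indicator_def)
      qed (use B in auto)
      also have "\<dots> = B" using integral_indicator_pos_lborel(2)[of D "D + 1"] D by simp
      finally show ?thesis by (simp add: B_def D_def)
    qed
    have sT: "summable (\<lambda>d. norm (T (Suc d)))"
      by (rule summable_comparison_test'[OF summable_mult[OF summS, of "K * M"]]) (use TS in auto)
    have "(\<Sum>d. f (real (Suc d))) - (\<integral>u. f u \<partial>pos_lborel) = T 0 + (\<Sum>d. T (Suc d))"
      using T suminf_split_head[of T] by (simp add: sums_iff)
    hence "norm ((\<Sum>d. f (real (Suc d))) - (\<integral>u. f u \<partial>pos_lborel)) \<le> norm (T 0) + norm (\<Sum>d. T (Suc d))"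
      by (simp only: norm_triangle_ineq)
    also have "norm (\<Sum>d. T (Suc d)) \<le> (\<Sum>d. norm (T (Suc d)))" by (rule summable_norm[OF sT])
    also have "\<dots> \<le> (\<Sum>d. K * M * real (Suc d) powr (\<alpha>2 - 1 + \<eta>))"
      by (intro suminf_le TS sT summable_mult summS)
    also have "\<dots> = K * M * S" unfolding S_def by (rule suminf_mult[OF summS])
    also have "norm (T 0) + K * M * S \<le> C * M" using T0 by (simp add: C_def ring_distribs)
    finally show "norm ((\<Sum>d. of_nat (Suc d) powr (a + 1) / (of_nat (Suc d) ^ 2 + (of_real m * w) ^ 2)) -
      (\<integral>u. of_real u powr (a + 1) / (of_real u ^ 2 + (of_real m * w) ^ 2) \<partial>pos_lborel)) \<le> C * m powr (- 1 - \<eta>)"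
      by (simp add: f_def c_def M_def del: of_nat_Suc)
  qed
qed

section \<open>Uniform decay of the kernel and of the lattice defects\<close>

lemma bounded_on_cball:
  assumes "f holomorphic_on UNIV"
  obtains K where "K \<ge> 0" "\<And>a. a \<in> cball a0 r \<Longrightarrow> norm (f a :: complex) \<le> K"
proof -
  have "compact (f ` cball a0 r)"
    by (intro compact_continuous_image holomorphic_on_imp_continuous_on holomorphic_on_subset[OF assms]) auto
  hence "bounded (f ` cball a0 r)" by (rule compact_imp_bounded)
  then obtain K where K: "\<forall>x\<in>f ` cball a0 r. norm x \<le> K" unfolding bounded_iff by (elim exE)
  show thesis by (rule that[of "max K 0"]) (use K in \<open>auto intro: max.coboundedI1\<close>)
qed

lemma Re_bounds_ball:
  assumes "a \<in> ball a0 r"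
  shows "Re a0 - r \<le> Re a" "Re a \<le> Re a0 + r"
  using assms abs_Re_le_cmod[of "a0 - a"] by (auto simp: dist_norm abs_le_iff)

text \<open>\<open>Phi\<close> decays like a power of its argument and the exponential faster than
  any power. On a ball the slowest rate, at the left end \<open>Re a0 - r\<close>, is the common
  one.\<close>

lemma kern_bound:
  assumes Z: "Im Z < 0" "Re Z > 0" and X: "Re X > 0" "Re (X / Z) > 0" and r: "r > 0" "Re a0 - r > -2"
  obtains C where "\<And>a n. a \<in> ball a0 r \<Longrightarrow> norm (kern a Z (X * of_nat (Suc n))) \<le> C * real (Suc n) powr (- (Re a0 - r + 2))"
proof -
  define \<alpha>1 where "\<alpha>1 = Re a0 - r"
  define \<alpha>2 where "\<alpha>2 = Re a0 + r"
  define \<beta> where "\<beta> = Re a0 - r + 2"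
  define \<rho> where "\<rho> = Re (X / Z)"
  have Z0: "Z \<noteq> 0" using Z by auto
  have ImZ: "Im Z \<noteq> 0" using Z by simp
  obtain \<kappa> where \<kappa>: "\<kappa> > 0"
    "\<And>a z \<alpha>1 \<alpha>2. -2 < \<alpha>1 \<Longrightarrow> \<alpha>1 \<le> Re a \<Longrightarrow> Re a \<le> \<alpha>2 \<Longrightarrow> Re z > 0 \<Longrightarrow>
       norm (Phi a Z z) \<le> (Gamma (\<alpha>1 + 2) * Re z powr (- \<alpha>1 - 2) + Gamma (\<alpha>2 + 2) * Re z powr (- \<alpha>2 - 2)) / \<kappa>"
    using ImZ by (rule Phi_bound) blast
  obtain K1 where K1: "K1 \<ge> 0" "\<And>a. a \<in> cball a0 r \<Longrightarrow> norm (2 * cos (of_real pi * a / 2) / of_real pi * Z powr (- a)) \<le> K1"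
    by (rule bounded_on_cball[of "\<lambda>a. 2 * cos (of_real pi * a / 2) / of_real pi * Z powr (- a)" a0 r])
       (use Z0 in \<open>auto intro!: holomorphic_intros\<close>)
  obtain K2 where K2: "K2 \<ge> 0" "\<And>a. a \<in> cball a0 r \<Longrightarrow> norm (\<i> * exp (\<i> * of_real pi * a / 2)) \<le> K2"
    by (rule bounded_on_cball[of "\<lambda>a. \<i> * exp (\<i> * of_real pi * a / 2)" a0 r]) (auto intro!: holomorphic_intros)
  obtain C1 where C1: "\<And>n. exp (- (Re X * real (Suc n))) \<le> C1 * real (Suc n) powr (- \<beta>)"
    using exp_le_powr[OF X(1)] by blast
  define G where "G = (Gamma (\<alpha>1 + 2) * \<rho> powr (- \<alpha>1 - 2) + Gamma (\<alpha>2 + 2) * \<rho> powr (- \<alpha>2 - 2)) / \<kappa>"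
  show thesis
  proof (rule that[of "K1 * G + K2 * C1"])
    fix a n assume a: "a \<in> ball a0 r"
    define N where "N = real (Suc n)"
    have N: "N \<ge> 1" by (simp add: N_def)
    have Ra: "\<alpha>1 \<le> Re a" "Re a \<le> \<alpha>2" using Re_bounds_ball[OF a] by (auto simp: \<alpha>1_def \<alpha>2_def)
    have z: "X * of_nat (Suc n) / Z = N *\<^sub>R (X / Z)" by (simp add: N_def scaleR_conv_of_real)
    have Rez: "Re (X * of_nat (Suc n) / Z) = N * \<rho>" unfolding z by (simp add: \<rho>_def)
    have pos: "\<rho> > 0" "N * \<rho> > 0" using X N by (auto simp: \<rho>_def)
    have G2: "Gamma (\<alpha>1 + 2) \<ge> 0" "Gamma (\<alpha>2 + 2) \<ge> 0"
      using r by (auto simp: \<alpha>1_def \<alpha>2_def intro!: less_imp_le Gamma_real_pos)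
    have "norm (Phi a Z (X * of_nat (Suc n) / Z)) \<le>
       (Gamma (\<alpha>1 + 2) * (N * \<rho>) powr (- \<alpha>1 - 2) + Gamma (\<alpha>2 + 2) * (N * \<rho>) powr (- \<alpha>2 - 2)) / \<kappa>"
      using \<kappa>(2)[of \<alpha>1 a \<alpha>2 "X * of_nat (Suc n) / Z"] Ra pos r unfolding Rez by (simp add: \<alpha>1_def)
    also have "\<dots> \<le> (Gamma (\<alpha>1 + 2) * (N powr (- \<beta>) * \<rho> powr (- \<alpha>1 - 2)) + Gamma (\<alpha>2 + 2) * (N powr (- \<beta>) * \<rho> powr (- \<alpha>2 - 2))) / \<kappa>"
    proof -
      have "(N * \<rho>) powr (- \<alpha>1 - 2) = N powr (- \<beta>) * \<rho> powr (- \<alpha>1 - 2)"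
        using N pos by (simp add: powr_mult \<beta>_def \<alpha>1_def)
      moreover have "(N * \<rho>) powr (- \<alpha>2 - 2) \<le> N powr (- \<beta>) * \<rho> powr (- \<alpha>2 - 2)"
        using N pos r by (simp add: powr_mult \<beta>_def \<alpha>2_def powr_mono mult_right_mono)
      ultimately show ?thesis
        using \<kappa>(1) G2 by (intro divide_right_mono add_mono mult_left_mono) auto
    qed
    also have "\<dots> = G * N powr (- \<beta>)" by (simp add: G_def ring_distribs mult_ac add_divide_distrib)
    finally have Phi: "norm (Phi a Z (X * of_nat (Suc n) / Z)) \<le> G * N powr (- \<beta>)" .
    have "norm (exp (- (X * of_nat (Suc n)))) = exp (- (Re X * N))" by (simp add: N_def)
    also have "\<dots> \<le> C1 * N powr (- \<beta>)" unfolding N_def by (rule C1)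
    finally have E: "norm (exp (- (X * of_nat (Suc n)))) \<le> C1 * N powr (- \<beta>)" .
    have ac: "a \<in> cball a0 r" using a by simp
    have "norm (kern a Z (X * of_nat (Suc n))) \<le> norm (2 * cos (of_real pi * a / 2) / of_real pi * Z powr (- a)) * norm (Phi a Z (X * of_nat (Suc n) / Z))
        + norm (\<i> * exp (\<i> * of_real pi * a / 2)) * norm (exp (- (X * of_nat (Suc n))))"
      unfolding kern_def by (rule order_trans[OF norm_triangle_ineq]) (simp only: norm_mult order_refl)
    also have "\<dots> \<le> K1 * (G * N powr (- \<beta>)) + K2 * (C1 * N powr (- \<beta>))"
      using K1(1) K2(1) by (intro add_mono mult_mono K1(2)[OF ac] K2(2)[OF ac] Phi E) auto
    finally show "norm (kern a Z (X * of_nat (Suc n))) \<le> (K1 * G + K2 * C1) * real (Suc n) powr (- (Re a0 - r + 2))"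
      by (simp add: ring_distribs N_def \<beta>_def)
  qed
qed

lemma holomorphic_on_kern:
  assumes "Im Z < 0" "Re (x / Z) > 0"
  shows "(\<lambda>a. kern a Z x) holomorphic_on {a. Re a > -2}"
proof -
  have "Z \<noteq> 0" using assms by auto
  thus ?thesis unfolding kern_def using assms by (intro holomorphic_intros holomorphic_on_Phi) auto
qed

text \<open>
  The integral is a cosecant. It accounts for the constant \<open>1 / (2 sin (\<pi> a / 2))\<close> in
  \<open>sums_kern\<close> and, after summation over \<open>c\<close>, for the term of \<open>zeta_part\<close> that contains
  the cosecant.
\<close>

definition lattice_defect :: "complex \<Rightarrow> complex \<Rightarrow> complex" where
  "lattice_defect a c = (\<Sum>d. of_nat (Suc d) powr (a + 1) / (of_nat (Suc d) ^ 2 + c ^ 2)) -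
     (\<integral>u. of_real u powr (a + 1) / (of_real u ^ 2 + c ^ 2) \<partial>pos_lborel)"

lemma sums_kern_defect:
  assumes Z: "Im Z < 0" "Re Z > 0" and a: "-1 < Re a" "Re a < 0" and c: "Re c > 0" "Re (c / Z) > 0"
  shows "(\<lambda>k. kern a Z (2 * of_real pi * c * of_nat (Suc k))) sums (c powr (- a) / of_real pi * lattice_defect a c)"
proof -
  have "c \<noteq> 0" using c by auto
  hence cc: "c powr (- a) * c powr a = 1" by (simp add: powr_minus)
  have "c powr (- a) / of_real pi * lattice_defect a c =
     c powr (- a) / of_real pi * (\<Sum>d. of_nat (Suc d) powr (a + 1) / (of_nat (Suc d) ^ 2 + c ^ 2)) +
     (c powr (- a) * c powr a) / (2 * sin (of_real pi * a / 2))"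
  proof -
    have "p / of_real pi * (S - - of_real pi * q / d) = p / of_real pi * S + p * q / d" for p q d S :: complex
      by (simp add: field_simps)
    thus ?thesis unfolding lattice_defect_def using integral_powr_over_sum_squares[OF c(1), of a] a by (simp only:)
  qed
  thus ?thesis using sums_kern[OF Z a c] by (simp add: cc add.commute)
qed

lemma lattice_defect_bound:
  assumes w: "Re w > 0" and a0: "-2 < Re a0" "Re a0 < 0"
  obtains r M where "r > 0" "summable M"
    "\<And>a m. a \<in> ball a0 r \<Longrightarrow> norm (lattice_defect a (of_nat (Suc m) * w)) \<le> M m"
proof -
  \<comment> \<open>\<eta> > 0 makes the bound summable over m; the radius is small enough to keep
    Re a0 + r + \<eta> negative.\<close>
  define \<eta> where "\<eta> = min 1 (- Re a0 / 2)"
  define r where "r = min (Re a0 + 2) (- Re a0 / 2) / 2"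
  have r: "r > 0" "\<eta> > 0" "\<eta> \<le> 1" "-2 < Re a0 - r" "Re a0 + r + \<eta> < 0"
    using a0 by (auto simp: r_def \<eta>_def min_def field_simps)
  obtain C where C: "\<And>a m. Re a0 - r \<le> Re a \<Longrightarrow> Re a \<le> Re a0 + r \<Longrightarrow> norm a \<le> norm a0 + r \<Longrightarrow> m \<ge> 1 \<Longrightarrow>
    norm ((\<Sum>d. of_nat (Suc d) powr (a + 1) / (of_nat (Suc d) ^ 2 + (of_real m * w) ^ 2)) -
      (\<integral>u. of_real u powr (a + 1) / (of_real u ^ 2 + (of_real m * w) ^ 2) \<partial>pos_lborel)) \<le> C * m powr (- 1 - \<eta>)"
    using sum_minus_integral_bound[OF w r(4,5) less_imp_le[OF r(2)] r(3), of "norm a0 + r"] by blast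
  show thesis
  proof (rule that[OF r(1)])
    show "summable (\<lambda>m. C * real (Suc m) powr (- 1 - \<eta>))"
      using r(2) by (intro summable_mult, subst summable_Suc_iff) (simp add: summable_real_powr_iff)
    fix a m assume a: "a \<in> ball a0 r"
    have "norm a \<le> norm a0 + r" using a norm_triangle_ineq2[of a a0] by (simp add: dist_norm norm_minus_commute)
    thus "norm (lattice_defect a (of_nat (Suc m) * w)) \<le> C * real (Suc m) powr (- 1 - \<eta>)"
      using C[of a "real (Suc m)"] Re_bounds_ball[OF a] by (simp add: lattice_defect_def del: of_nat_Suc)
  qed
qed

lemma holomorphic_on_lattice_defect:
  assumes c: "Re c > 0"
  shows "(\<lambda>a. lattice_defect a c) holomorphic_on ({a. Re a > -2} \<inter> {a. Re a < 0})"
proof -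
  have c0: "c \<noteq> 0" using c by auto
  have op: "open ({a. Re a > -2} \<inter> {a. Re a < 0})" by (intro open_Int open_halfspace_Re_gt open_halfspace_Re_lt)
  have "(\<lambda>a. \<Sum>d. of_nat (Suc d) powr (a + 1) / (of_nat (Suc d) ^ 2 + c ^ 2)) holomorphic_on ({a. Re a > -2} \<inter> {a. Re a < 0})"
  proof (rule holomorphic_on_suminf[OF op])
    have nz: "of_nat (Suc d) ^ 2 + c ^ 2 \<noteq> 0" for d
      using sum_squares_neq_0[OF c, of "real (Suc d)"] by (simp del: of_nat_Suc)
    have D0: "complex_of_nat (Suc d) \<noteq> 0" for d unfolding of_nat_eq_0_iff by simp
    show "(\<lambda>a. of_nat (Suc d) powr (a + 1) / (of_nat (Suc d) ^ 2 + c ^ 2)) holomorphic_on ({a. Re a > -2} \<inter> {a. Re a < 0})" for d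
      using nz[of d] D0[of d] by (intro holomorphic_intros) auto
    fix a0 assume "a0 \<in> {a. Re a > -2} \<inter> {a. Re a < 0}"
    hence a0: "Re a0 < 0" by simp
    define r where "r = - Re a0 / 2"
    have r: "r > 0" "Re a0 + r < 0" using a0 by (auto simp: r_def)
    define M where "M d = norm (of_nat (Suc d) powr (of_real (Re a0 + r) + 1) / (of_nat (Suc d) ^ 2 + c ^ 2))" for d
    have "summable M" unfolding M_def using c r by (intro summable_powr_over_sum_squares) auto
    moreover have "norm (of_nat (Suc d) powr (a + 1) / (of_nat (Suc d) ^ 2 + c ^ 2)) \<le> M d" if "a \<in> ball a0 r" for a d
      unfolding M_def norm_divide norm_of_nat_powr using Re_bounds_ball[OF that]
      by (intro divide_right_mono powr_mono) auto
    ultimately show "\<exists>r>0. \<exists>M N. summable M \<and> (\<forall>a\<in>ball a0 r \<inter> ({a. Re a > -2} \<inter> {a. Re a < 0}). \<forall>d\<ge>N.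
        norm (of_nat (Suc d) powr (a + 1) / (of_nat (Suc d) ^ 2 + c ^ 2)) \<le> M d)"
      using r(1) by (intro exI[of _ r] conjI exI[of _ M] exI[of _ 0]) auto
  qed
  \<comment> \<open>Holomorphy of the integral is read off its closed form, whose sine has no zero
    in the strip.\<close>
  moreover have "(\<lambda>a. - of_real pi * c powr a / (2 * sin (of_real pi * a / 2))) holomorphic_on ({a. Re a > -2} \<inter> {a. Re a < 0})"
    using c0 by (intro holomorphic_intros) (auto simp: sin_half_neq_0)
  hence "(\<lambda>a. \<integral>u. of_real u powr (a + 1) / (of_real u ^ 2 + c ^ 2) \<partial>pos_lborel) holomorphic_on ({a. Re a > -2} \<inter> {a. Re a < 0})"
    by (rule holomorphic_transform) (auto simp: integral_powr_over_sum_squares[OF c])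
  ultimately show ?thesis unfolding lattice_defect_def by (rule holomorphic_on_diff)
qed

text \<open>The removed points cover the pole of zeta (-a) at -1, the pole of zeta (1 - a) at 0 and
  the zeros of the sine at the even naturals.\<close>

lemma holomorphic_on_zeta_part:
  assumes y: "y \<noteq> 0"
  shows "zeta_part y holomorphic_on ({a. Re a > -2} - {-1} - \<nat>)"
proof -
  have z: "zeta holomorphic_on - {1}" by (rule holomorphic_on_zeta) simp
  have "(zeta \<circ> (\<lambda>a. - a)) holomorphic_on ({a. Re a > -2} - {-1} - \<nat>)"
    by (rule holomorphic_on_compose_gen[OF _ z]) (auto intro!: holomorphic_intros simp: minus_equation_iff[of _ 1])
  moreover have "(zeta \<circ> (\<lambda>a. 1 - a)) holomorphic_on ({a. Re a > -2} - {-1} - \<nat>)"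
    by (rule holomorphic_on_compose_gen[OF _ z]) (auto intro!: holomorphic_intros)
  ultimately show ?thesis
    unfolding zeta_part_def[abs_def] o_def using y by (intro holomorphic_intros) (auto simp: sin_half_neq_0_Nats)
qed

section \<open>Continuation of the Lambert series identity\<close>

definition lambert :: "complex \<Rightarrow> complex \<Rightarrow> complex" where
  "lambert y a = (\<Sum>n. divisor_sigma a (Suc n) * exp (- of_nat (Suc n) * y))"

lemma lambert_summable_holomorphic:
  assumes y: "Re y > 0"
  shows "lambert y holomorphic_on UNIV"
    and "summable (\<lambda>n. divisor_sigma a (Suc n) * exp (- of_nat (Suc n) * y))"
proof -
  have *: "\<exists>r>0. \<exists>C \<beta> \<alpha>. \<beta> > 1 \<and> \<alpha> < \<beta> - 1 \<and>
      (\<forall>a\<in>ball a0 r \<inter> UNIV. Re a \<le> \<alpha> \<and> (\<forall>n. norm (exp (- of_nat (Suc n) * y)) \<le> C * real (Suc n) powr (- \<beta>)))" for a0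
  proof -
    \<comment> \<open>On the unit ball exponents stay below Re a0 + 1, so decay of order |Re a0| + 3
      meets both requirements on \<beta>.\<close>
    obtain C where C: "\<And>n. exp (- (Re y * real (Suc n))) \<le> C * real (Suc n) powr (- (\<bar>Re a0\<bar> + 3))"
      using exp_le_powr[OF y] by blast
    have "norm (exp (- of_nat (Suc n) * y)) = exp (- (Re y * real (Suc n)))" for n by (simp add: algebra_simps)
    thus ?thesis using C Re_bounds_ball[of _ a0 1]
      by (intro exI[of _ 1] conjI exI[of _ C] exI[of _ "\<bar>Re a0\<bar> + 3"] exI[of _ "Re a0 + 1"]) auto
  qed
  show "lambert y holomorphic_on UNIV"
    unfolding lambert_def[abs_def]
    using divisor_sigma_summable_holomorphic(1)[OF open_UNIV, of "\<lambda>n _. exp (- of_nat n * y)"] * by simp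
  show "summable (\<lambda>n. divisor_sigma a (Suc n) * exp (- of_nat (Suc n) * y))"
    using divisor_sigma_summable_holomorphic(2)[OF open_UNIV, of "\<lambda>n _. exp (- of_nat n * y)" a] * by simp
qed

lemma powr_of_nat_mult: "of_nat (Suc n) powr a * z powr a = (of_nat (Suc n) * z) powr a" for z a :: complex
  using powr_mult_of_real[of "real (Suc n)" z a] by simp

text \<open>Undoing the divisor sum: for a fixed divisor d the sum over the cofactor is
  geometric.\<close>

lemma lambert_eq_suminf:
  assumes y: "Re y > 0"
  shows "(\<lambda>d. of_nat (Suc d) powr a / (exp (of_nat (Suc d) * y) - 1)) sums lambert y a"
proof -
  define \<beta> where "\<beta> = \<bar>Re a\<bar> + 2"
  obtain C where C: "\<And>n. exp (- (Re y * real (Suc n))) \<le> C * real (Suc n) powr (- \<beta>)"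
    using exp_le_powr[OF y] by blast
  have bound: "norm (exp (- of_nat (Suc n) * y)) \<le> C * real (Suc n) powr (- \<beta>)" for n
    using C[of n] by (simp add: algebra_simps)
  have \<beta>: "\<beta> > 1" "Re a < \<beta> - 1" by (auto simp: \<beta>_def)
  have inner: "(\<Sum>m. of_nat (Suc d) powr a * exp (- of_nat (Suc d * Suc m) * y)) = of_nat (Suc d) powr a / (exp (of_nat (Suc d) * y) - 1)" for d
  proof -
    have "Re (of_nat (Suc d) * y) > 0" using y by (simp del: of_nat_Suc)
    from sums_mult[OF sums_exp_minus(1)[OF this], of "of_nat (Suc d) powr a"]
    have "(\<lambda>m. of_nat (Suc d) powr a * exp (- (of_nat (Suc m) * (of_nat (Suc d) * y)))) sums
       (of_nat (Suc d) powr a / (exp (of_nat (Suc d) * y) - 1))" by (simp only: times_divide_eq_right mult_1_right)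
    moreover have "- (of_nat M * (of_nat D * y)) = - of_nat (D * M) * y" for D M by simp
    ultimately show ?thesis by (simp only: sums_iff)
  qed
  show ?thesis
    using divisor_sigma_sums[where \<phi> = "\<lambda>n. exp (- of_nat n * y)", OF bound \<beta>]
    unfolding inner lambert_def by (simp only: sums_iff)
qed

lemma zeta_sums: "Re s > 1 \<Longrightarrow> (\<lambda>n. of_nat (Suc n) powr (- s)) sums zeta s"
  using summable_norm_cancel[OF zeta_integral(3)[of s]] zeta_eq_suminf[of s]
  by (simp add: sums_iff powr_minus_divide del: of_nat_Suc)

text \<open>For Re a < -1 the terms -1 / w and 1/2 of the partial fractions sum over d to Dirichlet
  series for zeta (1 - a) and zeta (-a). After exchanging d and m, subtracting the integrals adds
  the cosecant term, because their values are proportional to m^a and sum to zeta (-a)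
  again.\<close>

lemma lambert_plus_zeta_part_left:
  assumes y: "Re y > 0" and a: "-2 < Re a" "Re a < -1"
  defines "w \<equiv> 2 * of_real pi / y"
  shows "(\<lambda>m. 2 / y * lattice_defect a (of_nat (Suc m) * w)) sums (lambert y a + zeta_part y a)"
proof -
  have y0: "y \<noteq> 0" using y by auto
  have w: "Re w > 0" "w \<noteq> 0"
  proof -
    have "w = (2 * pi) *\<^sub>R (1 / y)" by (simp add: w_def scaleR_conv_of_real)
    thus "Re w > 0" using Re_one_over_pos[OF y] by (simp only: scaleR_complex.simps) simp
    thus "w \<noteq> 0" by auto
  qed
  define U where "U d m = of_nat (Suc d) powr (a + 1) / (of_nat (Suc d) ^ 2 + (of_nat (Suc m) * w) ^ 2)" for d m
  have PF: "(\<lambda>m. 2 / y * U d m) sums (of_nat (Suc d) powr a / (exp (of_nat (Suc d) * y) - 1) - of_nat (Suc d) powr (- (1 - a)) / y + of_nat (Suc d) powr (- (- a)) / 2)" for d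
  proof -
    define D where "D = complex_of_nat (Suc d)"
    have D0: "D \<noteq> 0" unfolding D_def of_nat_eq_0_iff by simp
    have "Re (D * y) > 0" using y unfolding D_def by (simp del: of_nat_Suc)
    from sums_mult[OF coth_partial_fractions[OF this], of "D powr a"]
    have "(\<lambda>m. D powr a * (2 * (D * y) / ((D * y) ^ 2 + 4 * of_real pi ^ 2 * of_nat (Suc m) ^ 2))) sums
       (D powr a * (1 / (exp (D * y) - 1) - 1 / (D * y) + 1 / 2))" .
    moreover have "D powr a * (2 * (D * y) / ((D * y) ^ 2 + 4 * of_real pi ^ 2 * of_nat (Suc m) ^ 2)) = 2 / y * U d m" for m
    proof -
      define V where "V = D ^ 2 + (of_nat (Suc m) * w) ^ 2"
      have "(D * y) ^ 2 + 4 * of_real pi ^ 2 * M ^ 2 = y ^ 2 * (D ^ 2 + (M * w) ^ 2)" for M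
        unfolding w_def using y0 by (simp add: power_mult_distrib power_divide field_simps)
      hence "(D * y) ^ 2 + 4 * of_real pi ^ 2 * of_nat (Suc m) ^ 2 = y ^ 2 * V"
        unfolding V_def by (simp only:)
      moreover have "D powr (a + 1) = D powr a * D" using D0 by (simp add: powr_add)
      ultimately show ?thesis unfolding U_def D_def[symmetric] V_def[symmetric] using y0
        by (simp add: power2_eq_square[of y] mult_ac)
    qed
    moreover have "D powr a * (1 / (exp (D * y) - 1) - 1 / (D * y) + 1 / 2) =
        D powr a / (exp (D * y) - 1) - D powr (- (1 - a)) / y + D powr (- (- a)) / 2"
    proof -
      have "D powr (- (1 - a)) = D powr a / D" using D0 by (simp add: powr_diff)
      thus ?thesis using D0 y0 by (simp add: ring_distribs right_diff_distrib)
    qed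
    ultimately show ?thesis unfolding D_def by (simp only:)
  qed
  \<comment> \<open>The exchange needs decay in both variables: -1 - \<eta> in m and Re a + \<eta> <
    -1 in d. Half of the distance of Re a from -1 serves both.\<close>
  define \<eta> where "\<eta> = (- 1 - Re a) / 2"
  have \<eta>: "0 < \<eta>" "\<eta> \<le> 1" "Re a + \<eta> < -1" using a by (auto simp: \<eta>_def field_simps)
  obtain \<kappa> where \<kappa>: "\<kappa> > 0" "\<And>u d. u \<ge> 0 \<Longrightarrow> d > 0 \<Longrightarrow> norm (of_real u ^ 2 + (of_real d * w) ^ 2) \<ge> \<kappa> * (u + d) ^ 2"
    using w(1) by (rule norm_sum_squares_ge) blast
  define A where "A d = 1 / \<kappa> * real (Suc d) powr (Re a + \<eta>)" for d
  define B where "B m = real (Suc m) powr (- 1 - \<eta>)" for m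
  have bound: "norm (U d m) \<le> A d * B m" for d m
  proof -
    define D M where "D = real (Suc d)" and "M = real (Suc m)"
    have D: "D > 0" "M > 0" by (auto simp: D_def M_def)
    have "norm (U d m) = D powr (Re a + 1) / norm (of_real D ^ 2 + (of_real M * w) ^ 2)"
      unfolding U_def norm_divide norm_of_nat_powr by (simp add: D_def M_def)
    also have "\<dots> \<le> D powr (Re a + 1) / (\<kappa> * (D powr (1 - \<eta>) * M powr (1 + \<eta>)))"
    proof (intro frac_le)
      have "\<kappa> * (D powr (1 - \<eta>) * M powr (1 + \<eta>)) \<le> \<kappa> * (D + M) ^ 2"
        using \<kappa>(1) D \<eta> by (intro mult_left_mono add_powr_two_ge) auto
      also have "\<dots> \<le> norm (of_real D ^ 2 + (of_real M * w) ^ 2)" using D by (intro \<kappa>(2)) auto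
      finally show "\<kappa> * (D powr (1 - \<eta>) * M powr (1 + \<eta>)) \<le> norm (of_real D ^ 2 + (of_real M * w) ^ 2)" .
    qed (use \<kappa>(1) D in auto)
    also have "\<dots> = 1 / \<kappa> * (D powr (Re a + 1) / D powr (1 - \<eta>)) * (1 / M powr (1 + \<eta>))" by simp
    also have "D powr (Re a + 1) / D powr (1 - \<eta>) = D powr (Re a + \<eta>)" by (simp flip: powr_diff)
    also have "1 / M powr (1 + \<eta>) = M powr (- 1 - \<eta>)" using powr_minus_divide[of M "1 + \<eta>"] by simp
    finally show ?thesis by (simp only: A_def B_def D_def M_def)
  qed
  have summ: "summable A" "summable B" unfolding A_def B_def using \<eta>
    by (intro summable_mult summable_Suc_iff[THEN iffD2]; simp add: summable_real_powr_iff)+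
  have nonneg: "A i \<ge> 0" "B i \<ge> 0" for i using \<kappa>(1) by (auto simp: A_def B_def)
  have bound': "norm (U d m) \<le> B m * A d" for d m using bound[of d m] by (simp add: mult.commute)
  have swap: "(\<lambda>m. \<Sum>d. U d m) sums (\<Sum>d. \<Sum>m. U d m)"
    by (rule suminf_swap[where f = "\<lambda>m d. U d m" and A = B and B = A, OF bound' summ(2,1) nonneg(2,1)])
  have summU: "summable (U d)" for d
    by (rule summable_norm_cancel, rule summable_comparison_test'[OF summable_mult[OF summ(2), of "A d"]]) (use bound in auto)
  have z1: "(\<lambda>d. of_nat (Suc d) powr (- (1 - a))) sums zeta (1 - a)" using a by (intro zeta_sums) auto
  have z2: "(\<lambda>d. of_nat (Suc d) powr (- (- a))) sums zeta (- a)" using a by (intro zeta_sums) auto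
  have "(\<lambda>d. 2 / y * (\<Sum>m. U d m)) sums (lambert y a - zeta (1 - a) / y + zeta (- a) / 2)"
  proof -
    have "(\<lambda>d. of_nat (Suc d) powr a / (exp (of_nat (Suc d) * y) - 1) - of_nat (Suc d) powr (- (1 - a)) / y + of_nat (Suc d) powr (- (- a)) / 2)
        sums (lambert y a - zeta (1 - a) / y + zeta (- a) / 2)"
      by (intro sums_add sums_diff sums_divide lambert_eq_suminf y z1 z2)
    moreover have "2 / y * (\<Sum>m. U d m) = of_nat (Suc d) powr a / (exp (of_nat (Suc d) * y) - 1) - of_nat (Suc d) powr (- (1 - a)) / y + of_nat (Suc d) powr (- (- a)) / 2" for d
      using PF[of d] suminf_mult[OF summU[of d], of "2 / y"] by (simp only: sums_iff)
    ultimately show ?thesis by (simp only:)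
  qed
  hence "2 / y * (\<Sum>d. \<Sum>m. U d m) = lambert y a - zeta (1 - a) / y + zeta (- a) / 2"
  proof -
    assume *: "(\<lambda>d. 2 / y * (\<Sum>m. U d m)) sums (lambert y a - zeta (1 - a) / y + zeta (- a) / 2)"
    hence "summable (\<lambda>d. \<Sum>m. U d m)" using y0 by (simp add: sums_iff)
    from suminf_mult[OF this, of "2 / y"] * show ?thesis by (simp only: sums_iff)
  qed
  with sums_mult[OF swap, of "2 / y"]
  have S1: "(\<lambda>m. 2 / y * (\<Sum>d. U d m)) sums (lambert y a - zeta (1 - a) / y + zeta (- a) / 2)" by (simp only:)
  define h where "h = of_real pi * a / 2"
  have I: "2 / y * (\<integral>u. of_real u powr (a + 1) / (of_real u ^ 2 + (of_nat (Suc m) * w) ^ 2) \<partial>pos_lborel) =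
      - (1 / 2 * w powr (1 + a) / sin h) * of_nat (Suc m) powr (- (- a))" for m
  proof -
    have "Re (of_nat (Suc m) * w) > 0" using w by (simp del: of_nat_Suc)
    hence "(\<integral>u. of_real u powr (a + 1) / (of_real u ^ 2 + (of_nat (Suc m) * w) ^ 2) \<partial>pos_lborel) =
        - of_real pi * (of_nat (Suc m) * w) powr a / (2 * sin h)"
      unfolding h_def using a by (intro integral_powr_over_sum_squares) auto
    moreover have "w powr (1 + a) = 2 * of_real pi / y * w powr a" using w(2) by (simp add: powr_add w_def)
    ultimately show ?thesis unfolding powr_of_nat_mult[symmetric] using y0 by (simp del: of_nat_Suc)
  qed
  have S2: "(\<lambda>m. 2 / y * (\<integral>u. of_real u powr (a + 1) / (of_real u ^ 2 + (of_nat (Suc m) * w) ^ 2) \<partial>pos_lborel)) sums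
      (- (1 / 2 * w powr (1 + a) / sin h) * zeta (- a))"
    unfolding I by (intro sums_mult z2)
  have "(lambert y a - zeta (1 - a) / y + zeta (- a) / 2) - (- (1 / 2 * w powr (1 + a) / sin h) * zeta (- a)) = lambert y a + zeta_part y a"
    unfolding zeta_part_def w_def[symmetric] h_def[symmetric] by (simp add: field_simps)
  with sums_diff[OF S1 S2] show ?thesis
    unfolding lattice_defect_def U_def by (simp only: right_diff_distrib)
qed

text \<open>Here the Dirichlet series of zeta (-a) diverges, so the double series cannot be
  rearranged as before. The defects are still summable, and the identity is continued through the
  strip without -1, which remains connected.\<close>

lemma lambert_plus_zeta_part_strip:
  assumes y: "Re y > 0" and a: "-1 < Re a" "Re a < 0"
  defines "w \<equiv> 2 * of_real pi / y"
  shows "lambert y a + zeta_part y a = (\<Sum>m. 2 / y * lattice_defect a (of_nat (Suc m) * w))"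
proof -
  define S where "S = {a. Re a > -2} \<inter> {a. Re a < 0}"
  have y0: "y \<noteq> 0" using y by auto
  have w: "Re w > 0"
  proof -
    have "w = (2 * pi) *\<^sub>R (1 / y)" by (simp add: w_def scaleR_conv_of_real)
    thus ?thesis using Re_one_over_pos[OF y] by (simp only: scaleR_complex.simps) simp
  qed
  have opS: "open S" unfolding S_def by (intro open_Int open_halfspace_Re_gt open_halfspace_Re_lt)
  have coS: "connected (S - {-1})"
    unfolding S_def by (intro connected_open_diff_countable open_Int open_halfspace_Re_gt open_halfspace_Re_lt
        convex_connected convex_Int convex_halfspace_Re_gt convex_halfspace_Re_lt) auto
  have D: "(\<lambda>a. \<Sum>m. 2 / y * lattice_defect a (of_nat (Suc m) * w)) holomorphic_on S"
  proof (rule holomorphic_on_suminf[OF opS])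
    show "(\<lambda>a. 2 / y * lattice_defect a (of_nat (Suc m) * w)) holomorphic_on S" for m
      unfolding S_def using w by (intro holomorphic_intros holomorphic_on_lattice_defect) (simp del: of_nat_Suc)
    fix a0 assume "a0 \<in> S"
    hence a0: "-2 < Re a0" "Re a0 < 0" by (auto simp: S_def)
    obtain r M where r: "r > 0" "summable M"
      "\<And>a m. a \<in> ball a0 r \<Longrightarrow> norm (lattice_defect a (of_nat (Suc m) * w)) \<le> M m"
      using lattice_defect_bound[OF w a0] by blast
    have "norm (2 / y * lattice_defect a (of_nat (Suc m) * w)) \<le> norm (2 / y) * M m" if "a \<in> ball a0 r" for a m
      unfolding norm_mult using r(3)[OF that, of m] by (intro mult_left_mono) auto
    thus "\<exists>r>0. \<exists>M N. summable M \<and> (\<forall>a\<in>ball a0 r \<inter> S. \<forall>m\<ge>N. norm (2 / y * lattice_defect a (of_nat (Suc m) * w)) \<le> M m)"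
      using r(1,2) by (intro exI[of _ r] conjI exI[of _ "\<lambda>m. norm (2 / y) * M m"] exI[of _ 0] summable_mult) auto
  qed
  have "lambert y a + zeta_part y a = (\<Sum>m. 2 / y * lattice_defect a (of_nat (Suc m) * w))"
  proof (rule analytic_continuation_open[where s = "{a. Re a > -2} \<inter> {a. Re a < -1}" and s' = "S - {-1}" and z = a])
    show "open ({a. Re a > -2} \<inter> {a. Re a < -1})" by (intro open_Int open_halfspace_Re_gt open_halfspace_Re_lt)
    show "open (S - {-1})" using opS by (rule open_delete)
    have "of_real (-3/2) \<in> {a::complex. Re a > -2} \<inter> {a. Re a < -1}" by simp
    thus "{a::complex. Re a > -2} \<inter> {a. Re a < -1} \<noteq> {}" by blast
    show "{a. Re a > -2} \<inter> {a. Re a < -1} \<subseteq> S - {-1}" by (auto simp: S_def)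
    have "S - {-1} \<subseteq> {a. Re a > -2} - {-1} - \<nat>" by (auto simp: S_def elim!: Nats_cases)
    thus "(\<lambda>a. lambert y a + zeta_part y a) holomorphic_on (S - {-1})"
      by (intro holomorphic_intros holomorphic_on_subset[OF lambert_summable_holomorphic(1)[OF y]]
          holomorphic_on_subset[OF holomorphic_on_zeta_part[OF y0]]) auto
    show "(\<lambda>a. \<Sum>m. 2 / y * lattice_defect a (of_nat (Suc m) * w)) holomorphic_on (S - {-1})"
      using D by (rule holomorphic_on_subset) auto
    show "lambert y a + zeta_part y a = (\<Sum>m. 2 / y * lattice_defect a (of_nat (Suc m) * w))"
      if "a \<in> {a. Re a > -2} \<inter> {a. Re a < -1}" for a
      using lambert_plus_zeta_part_left[OF y, of a] that by (simp add: sums_iff w_def)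
    show "a \<in> S - {-1}" using a by (auto simp: S_def)
  qed (use coS in auto)
  thus ?thesis .
qed

text \<open>Away from the naturals this is \<open>rhs_factor\<close> times \<open>rhs_term\<close>
  without the divisor sum; it continues that product holomorphically to the naturals.\<close>

definition kern_term :: "complex \<Rightarrow> complex \<Rightarrow> nat \<Rightarrow> complex \<Rightarrow> complex" where
  "kern_term y Z n a = (2 * of_real pi / y) powr (1 + a) * kern a Z (4 * of_real pi ^ 2 * of_nat n / y)"

text \<open>The series is regular on the whole half-plane, the naturals included, but its value is
  computed only for Re a < 0, where the kernel sums are known. Continuation closes this gap
  afterwards.\<close>

lemma kern_term_series:
  assumes y: "Re y > 0" and Z: "Im Z < 0" "Re Z > 0" and yZ: "Re (1 / (y * Z)) > 0"
  shows "(\<lambda>a. \<Sum>n. divisor_sigma a (Suc n) * kern_term y Z (Suc n) a) holomorphic_on {a. Re a > -1}"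
    and "Re a > -1 \<Longrightarrow> summable (\<lambda>n. divisor_sigma a (Suc n) * kern_term y Z (Suc n) a)"
    and "n > 0 \<Longrightarrow> kern_term y Z n holomorphic_on {a. Re a > -1}"
    and "-1 < Re a \<Longrightarrow> Re a < 0 \<Longrightarrow>
           (\<Sum>n. divisor_sigma a (Suc n) * kern_term y Z (Suc n) a) = lambert y a + zeta_part y a"
proof -
  define w where "w = 2 * of_real pi / y"
  define X where "X = 2 * of_real pi * w"
  have w: "Re w > 0" "w \<noteq> 0"
  proof -
    have "w = (2 * pi) *\<^sub>R (1 / y)" by (simp add: w_def scaleR_conv_of_real)
    thus "Re w > 0" using Re_one_over_pos[OF y] by (simp only: scaleR_complex.simps) simp
    thus "w \<noteq> 0" by auto
  qed
  have wZ: "Re (w / Z) > 0"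
  proof -
    have "w / Z = (2 * pi) *\<^sub>R (1 / (y * Z))" by (simp add: w_def scaleR_conv_of_real)
    thus ?thesis using yZ by (simp only: scaleR_complex.simps) simp
  qed
  have XZ: "Re X > 0" "Re (X / Z) > 0"
  proof -
    have "X = (2 * pi) *\<^sub>R w" "X / Z = (2 * pi) *\<^sub>R (w / Z)" by (simp_all add: X_def scaleR_conv_of_real)
    thus "Re X > 0" "Re (X / Z) > 0" using w(1) wZ by (simp_all only: scaleR_complex.simps) simp_all
  qed
  have kt: "kern_term y Z n a = w powr (1 + a) * kern a Z (X * of_nat n)" for n a
  proof -
    have "4 * of_real pi ^ 2 * of_nat n / y = X * of_nat n"
      by (simp add: X_def w_def power2_eq_square)
    thus ?thesis unfolding kern_term_def w_def by (simp only:)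
  qed
  show hol: "kern_term y Z n holomorphic_on {a. Re a > -1}" if "n > 0" for n
  proof -
    have "X * of_nat n / Z = real n *\<^sub>R (X / Z)" by (simp add: scaleR_conv_of_real)
    hence "Re (X * of_nat n / Z) > 0" using XZ(2) that by (simp only: scaleR_complex.simps) simp
    hence "(\<lambda>a. kern a Z (X * of_nat n)) holomorphic_on {a. Re a > -1}"
      using Z by (intro holomorphic_on_subset[OF holomorphic_on_kern[of Z "X * of_nat n"]]) auto
    moreover have "(\<lambda>a. w powr (1 + a)) holomorphic_on {a. Re a > -1}"
      by (intro holomorphic_intros)
    ultimately show ?thesis unfolding kt[abs_def] by (rule holomorphic_on_mult[rotated])
  qed
  have op: "open {a. Re a > -1}" by (rule open_halfspace_Re_gt)
  \<comment> \<open>The holomorphy lemma asks about every index, while the kernel at n = 0 would be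
    taken at x = 0, outside Re (x / Z) > 0.\<close>
  define \<phi> where "\<phi> n = (if n = 0 then (\<lambda>_. 0) else kern_term y Z n)" for n
  have \<phi>: "\<phi> (Suc n) = kern_term y Z (Suc n)" for n by (simp add: \<phi>_def)
  have hol\<phi>: "\<phi> n holomorphic_on {a. Re a > -1}" for n
    using hol[of n] by (cases n) (auto simp: \<phi>_def)
  have bd: "\<exists>C. \<forall>a\<in>ball a0 r. \<forall>n. norm (kern_term y Z (Suc n) a) \<le> C * real (Suc n) powr (- (Re a0 - r + 2))"
    if r: "r > 0" "Re a0 - r > -2" for a0 r
  proof -
    obtain C where C: "\<And>a n. a \<in> ball a0 r \<Longrightarrow> norm (kern a Z (X * of_nat (Suc n))) \<le> C * real (Suc n) powr (- (Re a0 - r + 2))"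
      using kern_bound[OF Z XZ r] by blast
    obtain K where K: "K \<ge> 0" "\<And>a. a \<in> cball a0 r \<Longrightarrow> norm (w powr (1 + a)) \<le> K"
      by (rule bounded_on_cball[of "\<lambda>a. w powr (1 + a)" a0 r]) (use w(2) in \<open>auto intro!: holomorphic_intros\<close>)
    have "norm (kern_term y Z (Suc n) a) \<le> (K * C) * real (Suc n) powr (- (Re a0 - r + 2))" if a: "a \<in> ball a0 r" for a n
    proof -
      have "norm (kern_term y Z (Suc n) a) \<le> K * (C * real (Suc n) powr (- (Re a0 - r + 2)))"
        unfolding kt norm_mult using a by (intro mult_mono K C) auto
      thus ?thesis by (simp only: mult.assoc)
    qed
    thus ?thesis by blast
  qed
  have bound: "\<exists>r>0. \<exists>C \<beta> \<alpha>. \<beta> > 1 \<and> \<alpha> < \<beta> - 1 \<and>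
      (\<forall>a\<in>ball a0 r \<inter> {a. Re a > -1}. Re a \<le> \<alpha> \<and> (\<forall>n. norm (\<phi> (Suc n) a) \<le> C * real (Suc n) powr (- \<beta>)))"
    if "a0 \<in> {a. Re a > -1}" for a0
  proof -
    from that have a0: "Re a0 > -1" by simp
    \<comment> \<open>With \<beta> = Re a0 - r + 2 and \<alpha> = Re a0 + r, the condition \<alpha>
      < \<beta> - 1 means r < 1/2, and \<beta> > 1 means Re a0 - r > -1.\<close>
    define r where "r = min (1/4) ((Re a0 + 1) / 2)"
    have r: "r > 0" "Re a0 - r > -1" "r \<le> 1/4" using a0 by (auto simp: r_def min_def field_simps)
    obtain C where "\<forall>a\<in>ball a0 r. \<forall>n. norm (kern_term y Z (Suc n) a) \<le> C * real (Suc n) powr (- (Re a0 - r + 2))"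
      using bd[of r a0] r by auto
    thus ?thesis unfolding \<phi> using r Re_bounds_ball[of _ a0 r]
      by (intro exI[of _ r] conjI exI[of _ C] exI[of _ "Re a0 - r + 2"] exI[of _ "Re a0 + r"]) auto
  qed
  show "(\<lambda>a. \<Sum>n. divisor_sigma a (Suc n) * kern_term y Z (Suc n) a) holomorphic_on {a. Re a > -1}"
    using divisor_sigma_summable_holomorphic(1)[OF op hol\<phi> bound] by (simp only: \<phi>)
  show "summable (\<lambda>n. divisor_sigma a (Suc n) * kern_term y Z (Suc n) a)" if "Re a > -1"
    using divisor_sigma_summable_holomorphic(2)[OF op hol\<phi> bound, of a] that by (simp only: \<phi> mem_Collect_eq)
  show "(\<Sum>n. divisor_sigma a (Suc n) * kern_term y Z (Suc n) a) = lambert y a + zeta_part y a"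
    if a: "-1 < Re a" "Re a < 0"
  proof -
    define r where "r = min (1/4) ((Re a + 1) / 2)"
    have r: "r > 0" "Re a - r > -1" "r \<le> 1/4" using a by (auto simp: r_def min_def field_simps)
    define \<beta> where "\<beta> = Re a - r + 2"
    have "\<exists>C. \<forall>b\<in>ball a r. \<forall>n. norm (kern_term y Z (Suc n) b) \<le> C * real (Suc n) powr (- \<beta>)"
      unfolding \<beta>_def by (rule bd) (use r in auto)
    then obtain C where "\<forall>b\<in>ball a r. \<forall>n. norm (kern_term y Z (Suc n) b) \<le> C * real (Suc n) powr (- \<beta>)" ..
    hence C: "norm (kern_term y Z (Suc n) a) \<le> C * real (Suc n) powr (- \<beta>)" for n using r(1) by auto
    define f where "f d m = of_nat d powr a * kern_term y Z (d * m) a" for d m :: nat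
    have "(\<lambda>n. divisor_sigma a (Suc n) * kern_term y Z (Suc n) a) sums (\<Sum>i. \<Sum>j. f (Suc i) (Suc j))"
      unfolding f_def by (rule divisor_sigma_sums(1)[where \<phi> = "\<lambda>n. kern_term y Z n a", OF C]) (use r a in \<open>auto simp: \<beta>_def\<close>)
    moreover have "(\<Sum>j. f (Suc i) (Suc j)) = 2 / y * lattice_defect a (of_nat (Suc i) * w)" for i
    proof -
      define c where "c = of_nat (Suc i) * w"
      have "c = real (Suc i) *\<^sub>R w" "c / Z = real (Suc i) *\<^sub>R (w / Z)" by (simp_all add: c_def scaleR_conv_of_real)
      hence c: "Re c > 0" "Re (c / Z) > 0" using w(1) wZ by (simp_all only: scaleR_complex.simps) simp_all
      have c0: "c \<noteq> 0" using c by auto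
      have "f (Suc i) (Suc j) = of_nat (Suc i) powr a * w powr (1 + a) * kern a Z (2 * of_real pi * c * of_nat (Suc j))" for j
      proof -
        have "X * of_nat (I * J) = 2 * of_real pi * (of_nat I * w) * of_nat J" for I J by (simp add: X_def)
        thus ?thesis unfolding f_def kt c_def by (simp only: mult.assoc)
      qed
      moreover have "(\<lambda>j. of_nat (Suc i) powr a * w powr (1 + a) * kern a Z (2 * of_real pi * c * of_nat (Suc j))) sums
         (of_nat (Suc i) powr a * w powr (1 + a) * (c powr (- a) / of_real pi * lattice_defect a c))"
        by (intro sums_mult sums_kern_defect Z a c)
      \<comment> \<open>\<open>c\<close> is a positive multiple of \<open>w\<close>, so the powers
        combine to c^a and cancel against c^(-a); what remains is w / pi = 2 / y.\<close>
      moreover have "of_nat (Suc i) powr a * w powr (1 + a) * (c powr (- a) / of_real pi * lattice_defect a c) = 2 / y * lattice_defect a c"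
      proof -
        have "of_nat (Suc i) powr a * w powr (1 + a) = w * (of_nat (Suc i) powr a * w powr a)"
          using w(2) by (simp add: powr_add)
        also have "\<dots> = w * c powr a" unfolding powr_of_nat_mult c_def ..
        finally have "of_nat (Suc i) powr a * w powr (1 + a) * (c powr (- a) / of_real pi * lattice_defect a c) =
            w / of_real pi * (c powr a * c powr (- a)) * lattice_defect a c" by (simp only:) simp
        also have "c powr a * c powr (- a) = 1" using c0 by (simp add: powr_minus)
        finally show ?thesis by (simp add: w_def)
      qed
      ultimately show ?thesis unfolding c_def[symmetric] by (simp only: sums_iff)
    qed
    ultimately show ?thesis
      using lambert_plus_zeta_part_strip[OF y a] by (simp add: sums_iff w_def del: of_nat_Suc)
  qed
qed

text \<open>Continuation from the strip to the half-plane without the naturals. Removing a countable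
  set leaves an open half-plane connected.\<close>

lemma lambert_plus_zeta_part:
  assumes y: "Re y > 0" and Z: "Im Z < 0" "Re Z > 0" and yZ: "Re (1 / (y * Z)) > 0" and a: "Re a > -1" "a \<notin> \<nat>"
  shows "lambert y a + zeta_part y a = (\<Sum>n. divisor_sigma a (Suc n) * kern_term y Z (Suc n) a)"
proof (rule analytic_continuation_open[where s = "{a. Re a > -1} \<inter> {a. Re a < 0}" and s' = "{a. Re a > -1} - \<nat>" and z = a])
  have y0: "y \<noteq> 0" using y by auto
  have "of_real (-1/2) \<in> {a::complex. Re a > -1} \<inter> {a. Re a < 0}" by simp
  thus "{a::complex. Re a > -1} \<inter> {a. Re a < 0} \<noteq> {}" by blast
  show "open ({a. Re a > -1} - (\<nat> :: complex set))" by (intro open_Diff open_halfspace_Re_gt closed_Nats)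
  have "countable (\<nat> :: complex set)" unfolding Nats_def by simp
  thus "connected ({a. Re a > -1} - (\<nat> :: complex set))"
    by (intro connected_open_diff_countable open_halfspace_Re_gt convex_connected convex_halfspace_Re_gt) auto
  show "{a. Re a > -1} \<inter> {a. Re a < 0} \<subseteq> {a. Re a > -1} - (\<nat> :: complex set)" by (auto elim!: Nats_cases)
  have "{a. Re a > -1} - \<nat> \<subseteq> {a. Re a > -2} - {-1} - (\<nat> :: complex set)" by auto
  thus "(\<lambda>a. lambert y a + zeta_part y a) holomorphic_on {a. Re a > -1} - \<nat>"
    by (intro holomorphic_intros holomorphic_on_subset[OF lambert_summable_holomorphic(1)[OF y]]
        holomorphic_on_subset[OF holomorphic_on_zeta_part[OF y0]]) auto
  show "(\<lambda>a. \<Sum>n. divisor_sigma a (Suc n) * kern_term y Z (Suc n) a) holomorphic_on {a. Re a > -1} - \<nat>"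
    by (rule holomorphic_on_subset[OF kern_term_series(1)[OF y Z yZ]]) auto
  show "lambert y a + zeta_part y a = (\<Sum>n. divisor_sigma a (Suc n) * kern_term y Z (Suc n) a)"
    if "a \<in> {a. Re a > -1} \<inter> {a. Re a < 0}" for a
    using kern_term_series(4)[OF y Z yZ, of a] that by simp
qed (use a in \<open>auto intro!: open_Int open_halfspace_Re_gt open_halfspace_Re_lt\<close>)

theorem theorem2p4:
  fixes a y :: complex
  assumes "Re y > 0" and "Re a > -1"
  shows
    "summable (\<lambda>n. divisor_sigma a (Suc n) * exp (- of_nat (Suc n) * y)) \<and>
     (a \<notin> \<nat> \<longrightarrow>
        summable (\<lambda>n. rhs_term y (Suc n) a) \<and>
        (\<Sum>n. divisor_sigma a (Suc n) * exp (- of_nat (Suc n) * y)) + zeta_part y a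
          = rhs_factor y a * (\<Sum>n. rhs_term y (Suc n) a)) \<and>
     (a \<in> \<nat> \<longrightarrow>
        (\<exists>Z T. (zeta_part y \<longlongrightarrow> Z) (at a) \<and>
           (\<forall>n. ((\<lambda>b. rhs_factor y b * rhs_term y (Suc n) b) \<longlongrightarrow> T n) (at a)) \<and>
           summable T \<and>
           (\<Sum>n. divisor_sigma a (Suc n) * exp (- of_nat (Suc n) * y)) + Z = (\<Sum>n. T n)))"
proof (intro conjI impI)
  note y = assms(1)
  have y0: "y \<noteq> 0" using y by auto
  \<comment> \<open>With 1 / Z = 1 + i t and v = 1 / y, the last condition reads t Im v < Re v. The
    chosen t makes the left side at most Re v / 2, and t > 0 puts \<open>Z\<close> in the fourth
    quadrant.\<close>
  obtain Z where Z: "Im Z < 0" "Re Z > 0" and yZ: "Re (1 / (y * Z)) > 0"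
  proof -
    define v where "v = 1 / y"
    have v: "Re v > 0" unfolding v_def by (rule Re_one_over_pos[OF y])
    define t where "t = Re v / (2 * (\<bar>Im v\<bar> + 1))"
    have t: "t > 0" using v by (simp add: t_def)
    define Z where "Z = 1 / Complex 1 t"
    have pos: "1 + t\<^sup>2 > 0" by (intro add_pos_nonneg) auto
    have "Re Z = 1 / (1 + t\<^sup>2)" "Im Z = - t / (1 + t\<^sup>2)" by (simp_all add: Z_def Re_divide Im_divide)
    hence "Im Z < 0" "Re Z > 0" using pos t by (simp_all add: divide_neg_pos)
    moreover have "1 / (y * Z) = v * Complex 1 t" by (simp add: v_def Z_def)
    hence "Re (1 / (y * Z)) = Re v - t * Im v" by simp
    moreover have "t * Im v < Re v"
    proof -
      have "t * Im v \<le> t * (\<bar>Im v\<bar> + 1)" using t by (intro mult_left_mono) auto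
      also have "\<dots> = Re v / 2"
      proof -
        have "\<bar>Im v\<bar> + 1 \<noteq> 0" by linarith
        thus ?thesis unfolding t_def by (simp add: divide_simps)
      qed
      also have "\<dots> < Re v" using v by simp
      finally show ?thesis .
    qed
    ultimately show thesis using that by simp
  qed
  define V where "V b = (\<Sum>n. divisor_sigma b (Suc n) * kern_term y Z (Suc n) b)" for b
  note facts = kern_term_series[OF y Z yZ]
  have eq: "lambert y b + zeta_part y b = V b" if "Re b > -1" "b \<notin> \<nat>" for b
    unfolding V_def by (rule lambert_plus_zeta_part[OF y Z yZ that])
  have rt: "rhs_factor y b * rhs_term y (Suc n) b = divisor_sigma b (Suc n) * kern_term y Z (Suc n) b"
    if "Re b > -1" "b \<notin> \<nat>" for b n
    unfolding kern_term_def by (rule rhs_factor_mult_rhs_term[OF Z that y yZ]) simp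
  show "summable (\<lambda>n. divisor_sigma a (Suc n) * exp (- of_nat (Suc n) * y))"
    by (rule lambert_summable_holomorphic(2)[OF y])
  {
    assume a: "a \<notin> \<nat>"
    have "sin (of_real pi * a / 2) \<noteq> 0" using a assms by (intro sin_half_neq_0_Nats) auto
    hence rf: "rhs_factor y a \<noteq> 0" using y0 by (simp add: rhs_factor_def)
    have "summable (\<lambda>n. rhs_factor y a * rhs_term y (Suc n) a)"
      unfolding rt[OF assms(2) a] by (rule facts(2)[OF assms(2)])
    thus summ: "summable (\<lambda>n. rhs_term y (Suc n) a)" using rf by simp
    show "(\<Sum>n. divisor_sigma a (Suc n) * exp (- of_nat (Suc n) * y)) + zeta_part y a
          = rhs_factor y a * (\<Sum>n. rhs_term y (Suc n) a)"
      using eq[OF assms(2) a] suminf_mult[OF summ, of "rhs_factor y a"]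
      by (simp only: lambert_def V_def rt[OF assms(2) a])
  next
    assume "a \<in> \<nat>"
    then obtain k where k: "a = of_nat k" by (elim Nats_cases)
    \<comment> \<open>Distinct naturals are at distance at least 1, so a punctured unit disc around
      \<open>a\<close> contains none, and the regular formulas hold there.\<close>
    have ev: "eventually (\<lambda>b. Re b > -1 \<and> b \<notin> \<nat>) (at a)"
    proof -
      have "b \<notin> \<nat>" if "b \<noteq> a" "dist b a < 1" for b
      proof
        assume "b \<in> \<nat>"
        then obtain j where j: "b = of_nat j" by (elim Nats_cases)
        have "norm (complex_of_real (real j - real k)) < 1" using that(2) by (simp add: dist_norm j k)
        hence "\<bar>real j - real k\<bar> < 1" by (simp only: norm_of_real)
        hence "j = k" by linarith
        thus False using that(1) j k by simp
      qed
      hence "eventually (\<lambda>b. b \<notin> \<nat>) (at a)" unfolding eventually_at by (intro exI[of _ 1]) auto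
      moreover have "eventually (\<lambda>b. b \<in> {b. Re b > -1}) (at a)"
        using assms(2) by (intro eventually_at_in_open' open_halfspace_Re_gt) auto
      ultimately show ?thesis by eventually_elim auto
    qed
    have aS: "a \<in> {b. Re b > -1}" using assms(2) by simp
    have cont: "(f \<longlongrightarrow> f a) (at a)" if "f holomorphic_on {b. Re b > -1}" for f :: "complex \<Rightarrow> complex"
    proof -
      have "isCont f a"
        using holomorphic_on_imp_continuous_on[OF that] aS
        by (simp add: continuous_on_eq_continuous_at open_halfspace_Re_gt)
      thus ?thesis by (simp add: isCont_def)
    qed
    have L: "(lambert y \<longlongrightarrow> lambert y a) (at a)"
      by (intro cont holomorphic_on_subset[OF lambert_summable_holomorphic(1)[OF y]]) auto
    have V: "(V \<longlongrightarrow> V a) (at a)" using facts(1) unfolding V_def by (intro cont) simp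
    have "((\<lambda>b. V b - lambert y b) \<longlongrightarrow> V a - lambert y a) (at a)" by (intro tendsto_diff V L)
    \<comment> \<open>Near \<open>a\<close> the zeta part equals the difference of two functions
      that are holomorphic at \<open>a\<close>. Its singularities at \<open>a\<close> thus cancel,
      and the limit is the value of that difference.\<close>
    hence "(zeta_part y \<longlongrightarrow> V a - lambert y a) (at a)"
    proof (rule Lim_transform_eventually)
      show "eventually (\<lambda>b. V b - lambert y b = zeta_part y b) (at a)"
        using ev by eventually_elim (simp add: eq[symmetric])
    qed
    moreover have "((\<lambda>b. rhs_factor y b * rhs_term y (Suc n) b) \<longlongrightarrow> divisor_sigma a (Suc n) * kern_term y Z (Suc n) a) (at a)" for n
    proof (rule Lim_transform_eventually)
      show "((\<lambda>b. divisor_sigma b (Suc n) * kern_term y Z (Suc n) b) \<longlongrightarrow> divisor_sigma a (Suc n) * kern_term y Z (Suc n) a) (at a)"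
        unfolding divisor_sigma_def by (intro cont holomorphic_intros facts(3)) auto
      show "eventually (\<lambda>b. divisor_sigma b (Suc n) * kern_term y Z (Suc n) b = rhs_factor y b * rhs_term y (Suc n) b) (at a)"
        using ev by eventually_elim (simp add: rt)
    qed
    moreover have "summable (\<lambda>n. divisor_sigma a (Suc n) * kern_term y Z (Suc n) a)" by (rule facts(2)[OF assms(2)])
    moreover have "(\<Sum>n. divisor_sigma a (Suc n) * exp (- of_nat (Suc n) * y)) + (V a - lambert y a) = (\<Sum>n. divisor_sigma a (Suc n) * kern_term y Z (Suc n) a)"
      by (simp add: lambert_def V_def)
    ultimately show "\<exists>Z T. (zeta_part y \<longlongrightarrow> Z) (at a) \<and>
           (\<forall>n. ((\<lambda>b. rhs_factor y b * rhs_term y (Suc n) b) \<longlongrightarrow> T n) (at a)) \<and>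
           summable T \<and>
           (\<Sum>n. divisor_sigma a (Suc n) * exp (- of_nat (Suc n) * y)) + Z = (\<Sum>n. T n)"
      by (intro exI[of _ "V a - lambert y a"] exI[of _ "\<lambda>n. divisor_sigma a (Suc n) * kern_term y Z (Suc n) a"] conjI allI)
  }
qed

end
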